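(* Let $p$ be a prime and let $\langle M, W, \beta\rangle$ be an $\aleph_0$-categorical bilinear map in $\mathcal{B}(p)$ with few relations; let $k\ge 1$ be an integer such that $\dim(N(H_0))\le k\dim(H_0)$ for every finite subspace $H_0$ of $M$. If $H$ is a definable (possibly with parameters) selfsufficient subspace of $M$, then $\mathrm{cl}_k(H)/H$ is finite. Hence $\mathrm{cl}_k(H)$ is definable with the parameters of $H$ (i.e. the parameters used in a definition of $H$), and $\mathrm{cl}_k(H)\subseteq \mathrm{acl}(H)$.
   Context: Let $p$ be a prime. $\mathcal{B}(p)$ consists of the structures $\langle M,W,\beta\rangle$ where $M$ and $W$ are vector spaces over the field $\mathbb{F}_p$ and $\beta: M\times M\to W$ is an alternating bilinear map whose image generates $W$. Such a structure is regarded as a two-sorted first-order structure (vector space structure on both sorts together with $\beta$); $\aleph_0$-categorical means that its complete first-order theory is $\aleph_0$-categorical, and $\mathrm{acl}$ is the model-theoretic algebraic closure in this structure. Let $\Lambda^2 M$ be the exterior square of $M$ and $f_\beta:\Lambda^2 M\to W$ the linear map with $f_\beta(a\wedge b)=\beta(a,b)$; put $N(\beta)=\ker f_\beta$. For a subspace $H$ of $M$, $\Lambda^2 H$ is regarded as a subspace of $\Lambda^2 M$ in the canonical way and $N(H)=N(\beta)\cap\Lambda^2 H$. Here $\dim$ is linear dimension over $\mathbb{F}_p$. The map $\langle M,W,\beta\rangle$ has few relations if there is a natural number $k$ with $\dim(N(H))\le k\dim(H)$ for all finite subspaces $H$ of $M$. Fix such a $k\geq 1$. For a finite subspace $H$ of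 $M$ put $\delta_k(H)=\dim(H)-\frac1k\dim(N(H))$. A finite subspace $H$ is selfsufficient if $\delta_k(K)\ge\delta_k(H)$ for every finite subspace $K\supseteq H$ of $M$. An infinite subset $B$ of $M$ is selfsufficient if $B$ is a subspace and for every finite $A\subseteq B$ there is a finite selfsufficient subspace $B_0$ with $A\subseteq B_0\subseteq B$. For a finite subspace $H$, $CSS(H)$ is the intersection of all finite selfsufficient subspaces of $M$ containing $H$ (it is finite and selfsufficient). $\langle X\rangle$ denotes the linear span of $X$. For finite subsets $A,B$ of $M$, one says $A\subseteq\mathrm{cl}_k(B)$ if $\delta_k(CSS(\langle B\rangle))=\delta_k(CSS(\langle A\cup B\rangle))$. For an infinite subset $B$ of $M$ and finite $A\subseteq M$, one says $A\subseteq \mathrm{cl}_k(B)$ if $A\subseteq\mathrm{cl}_k(B_0)$ for some finite $B_0\subseteq B$. As a set, $\mathrm{cl}_k(B)$ consists of all $a\in M$ with $\{a\}\subseteq\mathrm{cl}_k(B)$. *)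

theory Defs
  imports "HOL-Library.Poly_Mapping" "Berlekamp_Zassenhaus.Finite_Field"
begin

section \<open>The exterior square of a vector space\<close>

text \<open>
  The exterior square of \<open>M\<close> is the quotient \<open>V / R\<close>, where \<open>V\<close> is the free vector space on
  \<open>M \<times> M\<close> and \<open>R\<close> is spanned by the relations of an alternating bilinear map. As the relations
  depend on the scalar multiplication of \<open>M\<close>, which is a term and not a part of the type, the
  quotient is not formed as a type: a linear system of representatives of the cosets of \<open>R\<close> is
  chosen, and an element of \<open>V / R\<close> is identified with its representative. The lemmas below show
  that the result has the universal property of the exterior square.
\<close>

definition free_scale :: "'f::field \<Rightarrow> ('x \<Rightarrow>\<^sub>0 'f) \<Rightarrow> ('x \<Rightarrow>\<^sub>0 'f)" where
  "free_scale c v = Poly_Mapping.map (\<lambda>d. c * d) v"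

lemma lookup_free_scale [simp]: "Poly_Mapping.lookup (free_scale c v) x = c * Poly_Mapping.lookup v x"
  by (simp add: free_scale_def Poly_Mapping.map.rep_eq when_def)

interpretation free: vector_space free_scale
  by unfold_locales
    (auto intro!: poly_mapping_eqI simp: lookup_add algebra_simps)

definition ext_relations ::
    "('f::field \<Rightarrow> 'm::ab_group_add \<Rightarrow> 'm) \<Rightarrow> ('m \<times> 'm \<Rightarrow>\<^sub>0 'f) set" where
  "ext_relations sM = free.span (
     {Poly_Mapping.single (a + b, c) 1 - Poly_Mapping.single (a, c) 1 - Poly_Mapping.single (b, c) 1 | a b c. True} \<union>
     {Poly_Mapping.single (a, b + c) 1 - Poly_Mapping.single (a, b) 1 - Poly_Mapping.single (a, c) 1 | a b c. True} \<union>
     {Poly_Mapping.single (sM r a, b) 1 - free_scale r (Poly_Mapping.single (a, b) 1) | r a b. True} \<union>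
     {Poly_Mapping.single (a, sM r b) 1 - free_scale r (Poly_Mapping.single (a, b) 1) | r a b. True} \<union>
     {Poly_Mapping.single (a, a) 1 | a. True})"

definition ext_rep ::
    "('f::field \<Rightarrow> 'm::ab_group_add \<Rightarrow> 'm) \<Rightarrow> ('m \<times> 'm \<Rightarrow>\<^sub>0 'f) \<Rightarrow> ('m \<times> 'm \<Rightarrow>\<^sub>0 'f)" where
  "ext_rep sM = (SOME q. Vector_Spaces.linear free_scale free_scale q \<and>
     (\<forall>v. v - q v \<in> ext_relations sM) \<and> (\<forall>v\<in>ext_relations sM. q v = 0))"

definition wedge ::
    "('f::field \<Rightarrow> 'm::ab_group_add \<Rightarrow> 'm) \<Rightarrow> 'm \<Rightarrow> 'm \<Rightarrow> ('m \<times> 'm \<Rightarrow>\<^sub>0 'f)" where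
  "wedge sM a b = ext_rep sM (Poly_Mapping.single (a, b) 1)"

text \<open>For a subspace \<open>H\<close>, this is the exterior square of \<open>H\<close> as a subspace of that of \<open>M\<close>.\<close>

definition ext_square ::
    "('f::field \<Rightarrow> 'm::ab_group_add \<Rightarrow> 'm) \<Rightarrow> 'm set \<Rightarrow> ('m \<times> 'm \<Rightarrow>\<^sub>0 'f) set" where
  "ext_square sM H = free.span {wedge sM a b | a b. a \<in> H \<and> b \<in> H}"

locale alternating_bilinear =
  M: vector_space sM + W: vector_space sW
  for sM :: "'f::field \<Rightarrow> 'm::ab_group_add \<Rightarrow> 'm"
    and sW :: "'f \<Rightarrow> 'w::ab_group_add \<Rightarrow> 'w" +
  fixes \<beta> :: "'m \<Rightarrow> 'm \<Rightarrow> 'w"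
  assumes linear_right: "Vector_Spaces.linear sM sW (\<lambda>b. \<beta> a b)"
    and linear_left: "Vector_Spaces.linear sM sW (\<lambda>a. \<beta> a b)"
    and alternating: "\<beta> a a = 0"

text \<open>The linear map on \<open>V\<close> that sends the generator \<open>(a, b)\<close> to \<open>\<beta> a b\<close>. It vanishes on \<open>R\<close>, so
  that its value at a representative is that of the induced map on \<open>V / R\<close> at the coset.\<close>

definition ext_map ::
    "('f::field \<Rightarrow> 'w::ab_group_add \<Rightarrow> 'w) \<Rightarrow> ('m \<Rightarrow> 'm \<Rightarrow> 'w) \<Rightarrow> ('m \<times> 'm \<Rightarrow>\<^sub>0 'f) \<Rightarrow> 'w" where
  "ext_map sW \<beta> v = (\<Sum>(a, b)\<in>Poly_Mapping.keys v. sW (Poly_Mapping.lookup v (a, b)) (\<beta> a b))"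

lemma ext_rep_exists:
  fixes R :: "('x \<Rightarrow>\<^sub>0 'f::field) set"
  assumes R: "free.subspace R"
  shows "\<exists>q. Vector_Spaces.linear free_scale free_scale q \<and> (\<forall>v. v - q v \<in> R) \<and> (\<forall>v\<in>R. q v = 0)"
proof -
  interpret P: vector_space_pair free_scale free_scale
    by unfold_locales
  obtain B where B: "B \<subseteq> R" "free.independent B" "R \<subseteq> free.span B"
    using free.maximal_independent_subset by blast
  let ?C = "free.extend_basis B"
  have C: "B \<subseteq> ?C" "free.independent ?C" "free.span ?C = UNIV"
    using free.extend_basis_superset free.independent_extend_basis free.span_extend_basis B(2)
    by auto
  define q where "q = P.construct ?C (\<lambda>b. if b \<in> B then 0 else b)"
  have q: "Vector_Spaces.linear free_scale free_scale q"
    unfolding q_def by (rule P.linear_construct[OF C(2)])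
  interpret q: Vector_Spaces.linear free_scale free_scale q by (fact q)
  have qb: "q b = (if b \<in> B then 0 else b)" if "b \<in> ?C" for b
    unfolding q_def by (subst P.construct_basis[OF C(2) that]) simp
  have zero: "q v = 0" if "v \<in> R" for v
  proof -
    have "v \<in> free.span B" using that B(3) by auto
    then show ?thesis
    proof (induction rule: free.span_induct_alt)
      case base then show ?case by (simp add: q.zero)
    next
      case (step c x y) then show ?case using qb[of x] C(1) by (auto simp: q.add q.scale)
    qed
  qed
  have "v - q v \<in> R" for v
  proof -
    have "v \<in> free.span ?C" using C(3) by auto
    then show ?thesis
    proof (induction rule: free.span_induct_alt)
      case base then show ?case using free.subspace_0[OF R] by (simp add: q.zero)
    next
      case (step c x y)
      have "free_scale c x + y - q (free_scale c x + y) = free_scale c (x - q x) + (y - q y)"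
        by (simp add: q.add q.scale free.scale_right_diff_distrib)
      moreover have "x - q x \<in> R"
        using qb[of x] step(1) B(1) free.subspace_0[OF R] by auto
      ultimately show ?case
        using step free.subspace_add[OF R] free.subspace_scale[OF R] by metis
    qed
  qed
  with q zero show ?thesis by blast
qed

lemma ext_rep:
  shows linear_ext_rep: "Vector_Spaces.linear free_scale free_scale (ext_rep sM)"
    and diff_ext_rep: "v - ext_rep sM v \<in> ext_relations sM"
    and ext_rep_relations: "v \<in> ext_relations sM \<Longrightarrow> ext_rep sM v = 0"
  using someI_ex[OF ext_rep_exists[of "ext_relations sM"], folded ext_rep_def]
  by (auto simp: ext_relations_def free.subspace_span)

lemma ext_square_UNIV:
  fixes sM :: "'f::field \<Rightarrow> 'm::ab_group_add \<Rightarrow> 'm"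
  shows "ext_square sM UNIV = range (ext_rep sM)"
proof -
  interpret q: Vector_Spaces.linear free_scale free_scale "ext_rep sM" by (rule linear_ext_rep)
  have "v \<in> free.span (range (\<lambda>x. Poly_Mapping.single x (1::'f)))" for v :: "'m \<times> 'm \<Rightarrow>\<^sub>0 'f"
  proof (induction v rule: update_induct)
    case const then show ?case by (rule free.span_zero)
  next
    case (update v x c)
    have "Poly_Mapping.update x c v = v + free_scale c (Poly_Mapping.single x 1)"
      using update(1)
      by (intro poly_mapping_eqI)
        (auto simp: Poly_Mapping.update.rep_eq lookup_add lookup_single when_def in_keys_iff)
    then show ?case
      using update by (auto intro!: free.span_add free.span_scale intro: free.span_base)
  qed
  then have "free.span (range (\<lambda>x. Poly_Mapping.single x (1::'f))) = (UNIV :: ('m \<times> 'm \<Rightarrow>\<^sub>0 'f) set)"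
    by auto
  moreover have "{wedge sM a b | a b. a \<in> UNIV \<and> b \<in> UNIV} =
      ext_rep sM ` range (\<lambda>x. Poly_Mapping.single x (1::'f))"
    by (auto simp: wedge_def image_def)
  ultimately show ?thesis
    unfolding ext_square_def by (simp add: q.span_image)
qed

lemma alternating_bilinear_wedge:
  fixes sM :: "'f::field \<Rightarrow> 'm::ab_group_add \<Rightarrow> 'm"
  assumes "vector_space sM"
  shows "alternating_bilinear sM free_scale (wedge sM)"
proof -
  interpret M: vector_space sM by fact
  interpret q: Vector_Spaces.linear free_scale free_scale "ext_rep sM" by (rule linear_ext_rep)
  let ?s = "\<lambda>a b. Poly_Mapping.single (a, b) (1::'f)"
  have 1: "?s (a + b) c - ?s a c - ?s b c \<in> ext_relations sM" for a b c
    unfolding ext_relations_def by (intro free.span_base) blast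
  have 2: "?s a (b + c) - ?s a b - ?s a c \<in> ext_relations sM" for a b c
    unfolding ext_relations_def by (intro free.span_base) blast
  have 3: "?s (sM r a) b - free_scale r (?s a b) \<in> ext_relations sM" for a b r
    unfolding ext_relations_def by (intro free.span_base) blast
  have 4: "?s a (sM r b) - free_scale r (?s a b) \<in> ext_relations sM" for a b r
    unfolding ext_relations_def by (intro free.span_base) blast
  have 5: "?s a a \<in> ext_relations sM" for a
    unfolding ext_relations_def by (intro free.span_base) blast
  show ?thesis
  proof
    fix a b b1 b2 r
    show "wedge sM a (b1 + b2) = wedge sM a b1 + wedge sM a b2"
      "wedge sM (b1 + b2) a = wedge sM b1 a + wedge sM b2 a"
      using ext_rep_relations[OF 2[of a b1 b2]] ext_rep_relations[OF 1[of b1 b2 a]]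
      by (simp_all add: wedge_def q.diff q.add algebra_simps)
    show "wedge sM a (sM r b) = free_scale r (wedge sM a b)"
      "wedge sM (sM r b) a = free_scale r (wedge sM b a)"
      using ext_rep_relations[OF 4[of a r b]] ext_rep_relations[OF 3[of r b a]]
      by (simp_all add: wedge_def q.diff q.scale)
    show "wedge sM a a = 0"
      using ext_rep_relations[OF 5[of a]] by (simp add: wedge_def)
  qed
qed

context alternating_bilinear
begin

lemma ext_map_superset:
  assumes "finite S" "Poly_Mapping.keys v \<subseteq> S"
  shows "ext_map sW \<beta> v = (\<Sum>(a, b)\<in>S. sW (Poly_Mapping.lookup v (a, b)) (\<beta> a b))"
  unfolding ext_map_def using assms
  by (intro sum.mono_neutral_left) (auto simp: in_keys_iff)

lemma linear_ext_map: "Vector_Spaces.linear free_scale sW (ext_map sW \<beta>)"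
proof
  fix u v :: "'m \<times> 'm \<Rightarrow>\<^sub>0 'f" and c
  let ?S = "Poly_Mapping.keys u \<union> Poly_Mapping.keys v"
  have "finite ?S" by simp
  then show "ext_map sW \<beta> (u + v) = ext_map sW \<beta> u + ext_map sW \<beta> v"
    using keys_add[of u v]
    by (simp add: ext_map_superset[of ?S] lookup_add W.scale_left_distrib sum.distrib case_prod_beta)
  have "Poly_Mapping.keys (free_scale c u) \<subseteq> Poly_Mapping.keys u"
    by (auto simp: in_keys_iff)
  then show "ext_map sW \<beta> (free_scale c u) = sW c (ext_map sW \<beta> u)"
    by (simp add: ext_map_superset[of "Poly_Mapping.keys u"] W.scale_sum_right case_prod_beta)
qed

lemma ext_map_single [simp]: "ext_map sW \<beta> (Poly_Mapping.single (a, b) 1) = \<beta> a b"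
  by (simp add: ext_map_def)

lemma ext_map_relations:
  assumes "v \<in> ext_relations sM"
  shows "ext_map sW \<beta> v = 0"
proof -
  interpret f: Vector_Spaces.linear free_scale sW "ext_map sW \<beta>" by (rule linear_ext_map)
  interpret r: Vector_Spaces.linear sM sW "\<lambda>b. \<beta> a b" for a by (rule linear_right)
  interpret l: Vector_Spaces.linear sM sW "\<lambda>a. \<beta> a b" for b by (rule linear_left)
  show ?thesis
    using assms unfolding ext_relations_def
  proof (induction rule: free.span_induct_alt)
    case base then show ?case by (simp add: f.zero)
  next
    case (step c x y)
    then have "ext_map sW \<beta> x = 0"
      by (auto simp: f.diff f.scale l.add r.add l.scale r.scale alternating)
    with step show ?case by (simp add: f.add f.scale)
  qed
qed

lemma ext_map_wedge: "ext_map sW \<beta> (wedge sM a b) = \<beta> a b"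
proof -
  interpret f: Vector_Spaces.linear free_scale sW "ext_map sW \<beta>" by (rule linear_ext_map)
  show ?thesis
    using ext_map_relations[OF diff_ext_rep[of "Poly_Mapping.single (a, b) 1" sM]]
    by (simp add: wedge_def f.diff)
qed

lemma ext_map_unique:
  assumes "Vector_Spaces.linear free_scale sW g" "\<And>a b. g (wedge sM a b) = \<beta> a b"
    and "x \<in> ext_square sM UNIV"
  shows "g x = ext_map sW \<beta> x"
proof -
  interpret f: Vector_Spaces.linear free_scale sW "ext_map sW \<beta>" by (rule linear_ext_map)
  interpret g: Vector_Spaces.linear free_scale sW g by fact
  show ?thesis
    using assms(3) unfolding ext_square_def
  proof (induction rule: free.span_induct_alt)
    case base then show ?case by (simp add: f.zero g.zero)
  next
    case (step c x y)
    then show ?case by (auto simp: f.add f.scale g.add g.scale ext_map_wedge assms(2))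
  qed
qed

end


section \<open>Few relations, selfsufficient subspaces and the closure operator\<close>

text \<open>The class \<open>\<B>(p)\<close> is the case \<open>'f = 'p mod_ring\<close> with \<open>'p::prime_card\<close> and \<open>p = CARD('p)\<close>.\<close>

locale generating_alternating_bilinear = alternating_bilinear sM sW \<beta>
  for sM :: "'f::field \<Rightarrow> 'm::ab_group_add \<Rightarrow> 'm"
    and sW :: "'f \<Rightarrow> 'w::ab_group_add \<Rightarrow> 'w"
    and \<beta> :: "'m \<Rightarrow> 'm \<Rightarrow> 'w" +
  assumes generating: "W.span (range (\<lambda>(a, b). \<beta> a b)) = UNIV"
begin

definition N_kernel :: "('m \<times> 'm \<Rightarrow>\<^sub>0 'f) set" where
  "N_kernel = {x \<in> ext_square sM UNIV. ext_map sW \<beta> x = 0}"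

definition N :: "'m set \<Rightarrow> ('m \<times> 'm \<Rightarrow>\<^sub>0 'f) set" where
  "N H = N_kernel \<inter> ext_square sM H"

definition relation_bound :: "nat \<Rightarrow> bool" where
  "relation_bound k \<longleftrightarrow> (\<forall>H. finite H \<and> M.subspace H \<longrightarrow> free.dim (N H) \<le> k * M.dim H)"

definition few_relations :: bool where
  "few_relations \<longleftrightarrow> (\<exists>k. relation_bound k)"

definition \<delta> :: "nat \<Rightarrow> 'm set \<Rightarrow> real" where
  "\<delta> k H = real (M.dim H) - 1 / real k * real (free.dim (N H))"

definition fin_selfsufficient :: "nat \<Rightarrow> 'm set \<Rightarrow> bool" where
  "fin_selfsufficient k H \<longleftrightarrow> finite H \<and> M.subspace H \<and>
     (\<forall>K. finite K \<and> M.subspace K \<and> H \<subseteq> K \<longrightarrow> \<delta> k K \<ge> \<delta> k H)"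

definition selfsufficient :: "nat \<Rightarrow> 'm set \<Rightarrow> bool" where
  "selfsufficient k B \<longleftrightarrow>
     (if finite B then fin_selfsufficient k B
      else M.subspace B \<and>
        (\<forall>A. finite A \<and> A \<subseteq> B \<longrightarrow> (\<exists>B\<^sub>0. fin_selfsufficient k B\<^sub>0 \<and> A \<subseteq> B\<^sub>0 \<and> B\<^sub>0 \<subseteq> B)))"

definition CSS :: "nat \<Rightarrow> 'm set \<Rightarrow> 'm set" where
  "CSS k H = \<Inter> {K. fin_selfsufficient k K \<and> H \<subseteq> K}"

definition fin_in_cl :: "nat \<Rightarrow> 'm set \<Rightarrow> 'm set \<Rightarrow> bool" where
  "fin_in_cl k A B \<longleftrightarrow> \<delta> k (CSS k (M.span B)) = \<delta> k (CSS k (M.span (A \<union> B)))"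

text \<open>The relation \<open>A \<subseteq> cl\<^sub>k(B)\<close>, for finite \<open>A\<close>.\<close>

definition in_cl :: "nat \<Rightarrow> 'm set \<Rightarrow> 'm set \<Rightarrow> bool" where
  "in_cl k A B \<longleftrightarrow>
     (if finite B then fin_in_cl k A B
      else (\<exists>B\<^sub>0. finite B\<^sub>0 \<and> B\<^sub>0 \<subseteq> B \<and> fin_in_cl k A B\<^sub>0))"

definition cl :: "nat \<Rightarrow> 'm set \<Rightarrow> 'm set" where
  "cl k B = {a. in_cl k {a} B}"

end


section \<open>First-order logic of two-sorted structures\<close>

text \<open>The language has the two sorts \<open>M\<close> and \<open>W\<close>, the vector space operations (with a unary
  function symbol for each scalar) on both sorts, and \<open>\<beta>\<close>. The variables of each sort are
  named by natural numbers.\<close>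

datatype 'f mterm = MVar nat | MZero | MAdd "'f mterm" "'f mterm" | MScale 'f "'f mterm"

datatype 'f wterm = WVar nat | WZero | WAdd "'f wterm" "'f wterm" | WScale 'f "'f wterm"
  | Beta "'f mterm" "'f mterm"

datatype 'f form = MEq "'f mterm" "'f mterm" | WEq "'f wterm" "'f wterm"
  | Neg "'f form" | Conj "'f form" "'f form" | MEx nat "'f form" | WEx nat "'f form"

primrec mterm_vars :: "'f mterm \<Rightarrow> nat set" where
  "mterm_vars (MVar i) = {i}"
| "mterm_vars MZero = {}"
| "mterm_vars (MAdd s t) = mterm_vars s \<union> mterm_vars t"
| "mterm_vars (MScale c t) = mterm_vars t"

primrec wterm_mvars :: "'f wterm \<Rightarrow> nat set" where
  "wterm_mvars (WVar j) = {}"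
| "wterm_mvars WZero = {}"
| "wterm_mvars (WAdd s t) = wterm_mvars s \<union> wterm_mvars t"
| "wterm_mvars (WScale c t) = wterm_mvars t"
| "wterm_mvars (Beta s t) = mterm_vars s \<union> mterm_vars t"

primrec wterm_wvars :: "'f wterm \<Rightarrow> nat set" where
  "wterm_wvars (WVar j) = {j}"
| "wterm_wvars WZero = {}"
| "wterm_wvars (WAdd s t) = wterm_wvars s \<union> wterm_wvars t"
| "wterm_wvars (WScale c t) = wterm_wvars t"
| "wterm_wvars (Beta s t) = {}"

primrec free_mvars :: "'f form \<Rightarrow> nat set" where
  "free_mvars (MEq s t) = mterm_vars s \<union> mterm_vars t"
| "free_mvars (WEq s t) = wterm_mvars s \<union> wterm_mvars t"
| "free_mvars (Neg \<phi>) = free_mvars \<phi>"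
| "free_mvars (Conj \<phi> \<psi>) = free_mvars \<phi> \<union> free_mvars \<psi>"
| "free_mvars (MEx i \<phi>) = free_mvars \<phi> - {i}"
| "free_mvars (WEx j \<phi>) = free_mvars \<phi>"

primrec free_wvars :: "'f form \<Rightarrow> nat set" where
  "free_wvars (MEq s t) = {}"
| "free_wvars (WEq s t) = wterm_wvars s \<union> wterm_wvars t"
| "free_wvars (Neg \<phi>) = free_wvars \<phi>"
| "free_wvars (Conj \<phi> \<psi>) = free_wvars \<phi> \<union> free_wvars \<psi>"
| "free_wvars (MEx i \<phi>) = free_wvars \<phi>"
| "free_wvars (WEx j \<phi>) = free_wvars \<phi> - {j}"

text \<open>Explicit carriers are needed for the models of a theory, which range over all structures
  for the language and not only over bilinear maps.\<close>

record ('f, 'm, 'w) two_sorted =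
  mcarrier :: "'m set"
  mzero :: 'm
  madd :: "'m \<Rightarrow> 'm \<Rightarrow> 'm"
  mscale :: "'f \<Rightarrow> 'm \<Rightarrow> 'm"
  wcarrier :: "'w set"
  wzero :: 'w
  wadd :: "'w \<Rightarrow> 'w \<Rightarrow> 'w"
  wscale :: "'f \<Rightarrow> 'w \<Rightarrow> 'w"
  beta :: "'m \<Rightarrow> 'm \<Rightarrow> 'w"

definition is_structure :: "('f, 'm, 'w) two_sorted \<Rightarrow> bool" where
  "is_structure S \<longleftrightarrow>
     mzero S \<in> mcarrier S \<and>
     (\<forall>a\<in>mcarrier S. \<forall>b\<in>mcarrier S. madd S a b \<in> mcarrier S) \<and>
     (\<forall>c. \<forall>a\<in>mcarrier S. mscale S c a \<in> mcarrier S) \<and>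
     wzero S \<in> wcarrier S \<and>
     (\<forall>x\<in>wcarrier S. \<forall>y\<in>wcarrier S. wadd S x y \<in> wcarrier S) \<and>
     (\<forall>c. \<forall>x\<in>wcarrier S. wscale S c x \<in> wcarrier S) \<and>
     (\<forall>a\<in>mcarrier S. \<forall>b\<in>mcarrier S. beta S a b \<in> wcarrier S)"

primrec mval :: "('f, 'm, 'w) two_sorted \<Rightarrow> (nat \<Rightarrow> 'm) \<Rightarrow> 'f mterm \<Rightarrow> 'm" where
  "mval S e (MVar i) = e i"
| "mval S e MZero = mzero S"
| "mval S e (MAdd s t) = madd S (mval S e s) (mval S e t)"
| "mval S e (MScale c t) = mscale S c (mval S e t)"

primrec wval ::
    "('f, 'm, 'w) two_sorted \<Rightarrow> (nat \<Rightarrow> 'm) \<Rightarrow> (nat \<Rightarrow> 'w) \<Rightarrow> 'f wterm \<Rightarrow> 'w" where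
  "wval S e f (WVar j) = f j"
| "wval S e f WZero = wzero S"
| "wval S e f (WAdd s t) = wadd S (wval S e f s) (wval S e f t)"
| "wval S e f (WScale c t) = wscale S c (wval S e f t)"
| "wval S e f (Beta s t) = beta S (mval S e s) (mval S e t)"

primrec sat ::
    "('f, 'm, 'w) two_sorted \<Rightarrow> (nat \<Rightarrow> 'm) \<Rightarrow> (nat \<Rightarrow> 'w) \<Rightarrow> 'f form \<Rightarrow> bool" where
  "sat S e f (MEq s t) \<longleftrightarrow> mval S e s = mval S e t"
| "sat S e f (WEq s t) \<longleftrightarrow> wval S e f s = wval S e f t"
| "sat S e f (Neg \<phi>) \<longleftrightarrow> \<not> sat S e f \<phi>"
| "sat S e f (Conj \<phi> \<psi>) \<longleftrightarrow> sat S e f \<phi> \<and> sat S e f \<psi>"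
| "sat S e f (MEx i \<phi>) \<longleftrightarrow> (\<exists>a\<in>mcarrier S. sat S (e(i := a)) f \<phi>)"
| "sat S e f (WEx j \<phi>) \<longleftrightarrow> (\<exists>x\<in>wcarrier S. sat S e (f(j := x)) \<phi>)"

definition sentence :: "'f form \<Rightarrow> bool" where
  "sentence \<phi> \<longleftrightarrow> free_mvars \<phi> = {} \<and> free_wvars \<phi> = {}"

definition theory_of :: "('f, 'm, 'w) two_sorted \<Rightarrow> 'f form set" where
  "theory_of S = {\<phi>. sentence \<phi> \<and> (\<forall>e f. sat S e f \<phi>)}"

definition is_model :: "('f, 'm, 'w) two_sorted \<Rightarrow> 'f form set \<Rightarrow> bool" where
  "is_model S T \<longleftrightarrow> is_structure S \<and> (\<forall>\<phi>\<in>T. \<forall>e f. sat S e f \<phi>)"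

definition isomorphic ::
    "('f, 'm, 'w) two_sorted \<Rightarrow> ('f, 'n, 'v) two_sorted \<Rightarrow> bool" where
  "isomorphic S T \<longleftrightarrow> (\<exists>g h.
     bij_betw g (mcarrier S) (mcarrier T) \<and> bij_betw h (wcarrier S) (wcarrier T) \<and>
     g (mzero S) = mzero T \<and>
     (\<forall>a\<in>mcarrier S. \<forall>b\<in>mcarrier S. g (madd S a b) = madd T (g a) (g b)) \<and>
     (\<forall>c. \<forall>a\<in>mcarrier S. g (mscale S c a) = mscale T c (g a)) \<and>
     h (wzero S) = wzero T \<and>
     (\<forall>x\<in>wcarrier S. \<forall>y\<in>wcarrier S. h (wadd S x y) = wadd T (h x) (h y)) \<and>
     (\<forall>c. \<forall>x\<in>wcarrier S. h (wscale S c x) = wscale T c (h x)) \<and>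
     (\<forall>a\<in>mcarrier S. \<forall>b\<in>mcarrier S. h (beta S a b) = beta T (g a) (g b)))"

text \<open>Any two models of cardinality \<open>\<aleph>\<^sub>0\<close> are isomorphic. Such models have copies whose carriers
  are sets of natural numbers. The cardinality of a two-sorted structure is that of the disjoint
  union of its sorts, so one of the sorts may be finite.\<close>

definition aleph0_categorical :: "'f form set \<Rightarrow> bool" where
  "aleph0_categorical T \<longleftrightarrow>
     (\<forall>(A :: ('f, nat, nat) two_sorted) (B :: ('f, nat, nat) two_sorted).
        is_model A T \<and> (infinite (mcarrier A) \<or> infinite (wcarrier A)) \<and>
        is_model B T \<and> (infinite (mcarrier B) \<or> infinite (wcarrier B)) \<longrightarrow> isomorphic A B)"

text \<open>\<open>X\<close> is a subset of the sort \<open>M\<close> that is defined by a formula in the free variable \<open>MVar 0\<close>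
  with parameters from \<open>P\<close> (in the sort \<open>M\<close>) and \<open>Q\<close> (in the sort \<open>W\<close>): the other free variables
  of the formula are the places of the parameters.\<close>

definition definable_over ::
    "('f, 'm, 'w) two_sorted \<Rightarrow> 'm set \<Rightarrow> 'w set \<Rightarrow> 'm set \<Rightarrow> bool" where
  "definable_over S P Q X \<longleftrightarrow> (\<exists>\<phi> e f.
     (\<forall>i\<in>free_mvars \<phi> - {0}. e i \<in> P) \<and> (\<forall>j\<in>free_wvars \<phi>. f j \<in> Q) \<and>
     X = {a \<in> mcarrier S. sat S (e(0 := a)) f \<phi>})"

text \<open>The elements of the sort \<open>M\<close> that are algebraic over \<open>P\<close> and \<open>Q\<close>.\<close>

definition acl :: "('f, 'm, 'w) two_sorted \<Rightarrow> 'm set \<Rightarrow> 'w set \<Rightarrow> 'm set" where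
  "acl S P Q = {a. \<exists>X. definable_over S P Q X \<and> finite X \<and> a \<in> X}"

definition bilinear_structure ::
    "('f \<Rightarrow> 'm \<Rightarrow> 'm) \<Rightarrow> ('f \<Rightarrow> 'w \<Rightarrow> 'w) \<Rightarrow> ('m \<Rightarrow> 'm \<Rightarrow> 'w) \<Rightarrow>
      ('f, 'm::ab_group_add, 'w::ab_group_add) two_sorted" where
  "bilinear_structure sM sW \<beta> =
     \<lparr>mcarrier = UNIV, mzero = 0, madd = (+), mscale = sM,
      wcarrier = UNIV, wzero = 0, wadd = (+), wscale = sW, beta = \<beta>\<rparr>"

end

theory Submission
  imports Defs "HOL-Library.Countable_Set" "HOL-Library.FuncSet"
begin

text \<open>
  \<open>cl\<^sub>k(H)\<close> is the directed union of the finite subspaces \<open>A\<close> with \<open>\<delta>\<^sub>k(A) \<le> \<delta>\<^sub>k(A \<inter> H)\<close>. For two such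
  subspaces \<open>A\<close> and \<open>B\<close> equality holds in the submodularity of \<open>\<delta>\<^sub>k\<close> over \<open>H\<close>, so that
  \<open>N(A + B) \<subseteq> N(A) + N(B) + N(H\<^sub>1)\<close> for some \<open>H\<^sub>1 \<subseteq> H\<close>, and \<open>N(A)\<close> has dimension \<open>k dim(A / A \<inter> H)\<close> modulo
  \<open>N(A \<inter> H)\<close>. By \<open>\<aleph>\<^sub>0\<close>-categoricity there are only finitely many types of elements of the span of
  \<open>\<beta>(cl\<^sub>k(H), cl\<^sub>k(H))\<close> over the parameters of \<open>H\<close>, so each of these elements lies in the span of
  \<open>\<beta>(D, D)\<close> for some \<open>D\<close> as above of bounded size. Hence every element of the exterior square of
  \<open>A / A \<inter> H\<close> is a sum of boundedly many elements \<open>x \<and> y\<close>, up to a space whose dimension is linear in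
  \<open>dim(A / A \<inter> H)\<close>. As the dimension of the exterior square is quadratic, \<open>dim(A / A \<inter> H)\<close> is bounded.

  The same finiteness of the number of types yields the definability of \<open>cl\<^sub>k(H)\<close>, the union of the
  copies of all \<open>A\<close>. Finally, an element of \<open>cl\<^sub>k(H)\<close> lies in \<open>cl\<^sub>k(H\<^sub>1)\<close> for a finite selfsufficient
  \<open>H\<^sub>1 \<subseteq> H\<close>, and \<open>cl\<^sub>k(H\<^sub>1)\<close> is finite and definable over \<open>H\<^sub>1\<close>.
\<close>

text \<open>Categoricity controls relations in a fixed finite set of variables, while the spaces
  \<open>A\<close> have unbounded size. This is why types of single elements are counted: of one
  element of \<open>W\<close> for the bound and of one element of \<open>M\<close> for the
  definability, over the parameters in a definition of \<open>H\<close>. All variables for a copy of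
  \<open>A\<close> are quantified away. The finiteness of the number of types is used only as a
  covering statement, \<open>finite_union_fo\<close>.

  Categoricity speaks of countable models, but \<open>M\<close> may be uncountable. Both models of
  the contradiction are therefore countable elementary substructures of an ultrapower, which yields
  compactness and the descent to a countable model at once; the choice of the sequences decides
  whether the limit type is realized or omitted.

  In the dimension count the size of \<open>H\<^sub>1\<close> is not controlled. It disappears under
  the exterior square of a linear map that kills all of \<open>H\<close> and is the identity on a
  complement \<open>E\<close> of \<open>A \<inter> H\<close> in \<open>A\<close>. There the
  representable elements number at most \<open>CARD('f) ^ ((k + 2 * T) * dim E)\<close>, against a
  quadratic exponent for the whole exterior square.\<close>

instance mterm :: (countable) countable by countable_datatype
instance wterm :: (countable) countable by countable_datatype
instance form :: (countable) countable by countable_datatype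

section \<open>Ultrafilters on the natural numbers\<close>

definition nonprincipal_ultrafilter :: "nat filter \<Rightarrow> bool" where
  "nonprincipal_ultrafilter U \<longleftrightarrow> U \<noteq> bot \<and> U \<le> sequentially \<and>
     (\<forall>P. eventually P U \<or> eventually (\<lambda>n. \<not> P n) U)"

text \<open>Zorn's lemma gives a minimal, that is finest, proper filter below
  \<open>sequentially\<close>; minimality makes it an ultrafilter.\<close>

lemma nonprincipal_ultrafilter_exists: "\<exists>U. nonprincipal_ultrafilter U"
proof -
  let ?A = "{F :: nat filter. F \<noteq> bot \<and> F \<le> sequentially}"
  let ?P = "\<lambda>F G :: nat filter. G \<le> F"
  have "\<exists>F\<in>?A. \<forall>G\<in>?A. ?P F G \<longrightarrow> G = F"
  proof (rule predicate_Zorn)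
    show "partial_order_on ?A (relation_of ?P ?A)"
      by (rule partial_order_on_relation_ofI) auto
  next
    fix \<C> assume "\<C> \<in> Chains (relation_of ?P ?A)"
    then have C: "\<And>F. F \<in> \<C> \<Longrightarrow> F \<in> ?A" "\<And>F G. F \<in> \<C> \<Longrightarrow> G \<in> \<C> \<Longrightarrow> F \<le> G \<or> G \<le> F"
      unfolding Chains_def relation_of_def by auto
    show "\<exists>G\<in>?A. \<forall>F\<in>\<C>. G \<le> F"
    proof (cases "\<C> = {}")
      case True
      then show ?thesis by (intro bexI[of _ sequentially]) auto
    next
      case False
      \<comment> \<open>In a chain any two members are comparable, so the infimum contains only sets
        of its members and stays proper.\<close>
      have "eventually P (Inf \<C>) \<longleftrightarrow> (\<exists>F\<in>\<C>. eventually P F)" for P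
      proof (rule eventually_Inf_base[OF False])
        fix F G assume "F \<in> \<C>" "G \<in> \<C>"
        then show "\<exists>x\<in>\<C>. x \<le> inf F G" using C(2)[of F G] by (auto intro: inf_absorb1)
      qed
      then have "Inf \<C> \<noteq> bot"
        using C(1) by (auto simp: trivial_limit_def)
      moreover have "Inf \<C> \<le> sequentially"
        using C(1) False by (metis (mono_tags, lifting) Inf_lower2 ex_in_conv mem_Collect_eq)
      ultimately show ?thesis by (auto intro: Inf_lower)
    qed
  qed
  then obtain U where U: "U \<noteq> bot" "U \<le> sequentially"
    and max: "\<And>G. G \<noteq> bot \<Longrightarrow> G \<le> U \<Longrightarrow> G = U"
    by (auto intro: order_trans)
  have "eventually P U" if "\<not> eventually (\<lambda>n. \<not> P n) U" for P
  proof -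
    \<comment> \<open>\<open>P\<close> can be adjoined without losing properness, so by minimality
      it already belongs to \<open>U\<close>.\<close>
    have "inf U (principal {n. P n}) \<noteq> bot"
      using that by (simp add: trivial_limit_def eventually_inf_principal)
    then have "inf U (principal {n. P n}) = U" by (intro max) auto
    moreover have "eventually P (inf U (principal {n. P n}))"
      by (simp add: eventually_inf_principal)
    ultimately show ?thesis by simp
  qed
  with U show ?thesis unfolding nonprincipal_ultrafilter_def by blast
qed

section \<open>Definable relations on assignments\<close>

lemma mval_cong: "(\<And>i. i \<in> mterm_vars t \<Longrightarrow> e i = e' i) \<Longrightarrow> mval S e t = mval S e' t"
  by (induction t) auto

lemma wval_cong:
  "(\<And>i. i \<in> wterm_mvars t \<Longrightarrow> e i = e' i) \<Longrightarrow> (\<And>j. j \<in> wterm_wvars t \<Longrightarrow> f j = f' j) \<Longrightarrow>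
    wval S e f t = wval S e' f' t"
  by (induction t) (auto intro: arg_cong2[of _ _ _ _ "beta S"] mval_cong)

lemma sat_cong:
  "(\<And>i. i \<in> free_mvars \<phi> \<Longrightarrow> e i = e' i) \<Longrightarrow> (\<And>j. j \<in> free_wvars \<phi> \<Longrightarrow> f j = f' j) \<Longrightarrow>
    sat S e f \<phi> = sat S e' f' \<phi>"
proof (induction \<phi> arbitrary: e e' f f')
  case (MEq s t)
  then show ?case by (simp add: mval_cong[of _ e e'])
next
  case (WEq s t)
  then show ?case by (simp add: wval_cong[of _ e e' f f'])
next
  case (Neg \<phi>)
  then show ?case by (metis free_mvars.simps(3) free_wvars.simps(3) sat.simps(3))
next
  case (Conj \<phi> \<psi>)
  then show ?case by (metis UnCI free_mvars.simps(4) free_wvars.simps(4) sat.simps(4))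
next
  case (MEx i \<phi>)
  have "sat S (e(i := a)) f \<phi> = sat S (e'(i := a)) f' \<phi>" for a
    using MEx.prems by (intro MEx.IH) auto
  then show ?case by simp
next
  case (WEx j \<phi>)
  have "sat S e (f(j := x)) \<phi> = sat S e' (f'(j := x)) \<phi>" for x
    using WEx.prems by (intro WEx.IH) auto
  then show ?case by simp
qed

lemma finite_mterm_vars: "finite (mterm_vars t)"
  by (induction t) auto

lemma finite_wterm_mvars: "finite (wterm_mvars t)"
  by (induction t) (auto simp: finite_mterm_vars)

lemma finite_wterm_wvars: "finite (wterm_wvars t)"
  by (induction t) auto

lemma finite_free_mvars [simp]: "finite (free_mvars \<phi>)"
  by (induction \<phi>) (auto simp: finite_mterm_vars finite_wterm_mvars)

lemma finite_free_wvars [simp]: "finite (free_wvars \<phi>)"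
  by (induction \<phi>) (auto simp: finite_wterm_wvars)

section \<open>Renaming of all variables, free and bound, by one injective map\<close>

primrec mterm_rename :: "(nat \<Rightarrow> nat) \<Rightarrow> 'f mterm \<Rightarrow> 'f mterm" where
  "mterm_rename \<pi> (MVar i) = MVar (\<pi> i)"
| "mterm_rename \<pi> MZero = MZero"
| "mterm_rename \<pi> (MAdd s t) = MAdd (mterm_rename \<pi> s) (mterm_rename \<pi> t)"
| "mterm_rename \<pi> (MScale c t) = MScale c (mterm_rename \<pi> t)"

primrec wterm_rename :: "(nat \<Rightarrow> nat) \<Rightarrow> 'f wterm \<Rightarrow> 'f wterm" where
  "wterm_rename \<pi> (WVar j) = WVar (\<pi> j)"
| "wterm_rename \<pi> WZero = WZero"
| "wterm_rename \<pi> (WAdd s t) = WAdd (wterm_rename \<pi> s) (wterm_rename \<pi> t)"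
| "wterm_rename \<pi> (WScale c t) = WScale c (wterm_rename \<pi> t)"
| "wterm_rename \<pi> (Beta s t) = Beta (mterm_rename \<pi> s) (mterm_rename \<pi> t)"

primrec form_rename :: "(nat \<Rightarrow> nat) \<Rightarrow> 'f form \<Rightarrow> 'f form" where
  "form_rename \<pi> (MEq s t) = MEq (mterm_rename \<pi> s) (mterm_rename \<pi> t)"
| "form_rename \<pi> (WEq s t) = WEq (wterm_rename \<pi> s) (wterm_rename \<pi> t)"
| "form_rename \<pi> (Neg \<phi>) = Neg (form_rename \<pi> \<phi>)"
| "form_rename \<pi> (Conj \<phi> \<psi>) = Conj (form_rename \<pi> \<phi>) (form_rename \<pi> \<psi>)"
| "form_rename \<pi> (MEx i \<phi>) = MEx (\<pi> i) (form_rename \<pi> \<phi>)"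
| "form_rename \<pi> (WEx j \<phi>) = WEx (\<pi> j) (form_rename \<pi> \<phi>)"

lemma mval_rename: "mval S e (mterm_rename \<pi> t) = mval S (e \<circ> \<pi>) t"
  by (induction t) auto

lemma wval_rename: "wval S e f (wterm_rename \<pi> t) = wval S (e \<circ> \<pi>) (f \<circ> \<pi>) t"
  by (induction t) (auto simp: mval_rename comp_def)

lemma upd_comp_inj: "inj \<pi> \<Longrightarrow> e(\<pi> i := a) \<circ> \<pi> = (e \<circ> \<pi>)(i := a)"
  by (auto simp: fun_eq_iff inj_eq)

lemma sat_rename: "inj \<pi> \<Longrightarrow> sat S e f (form_rename \<pi> \<phi>) = sat S (e \<circ> \<pi>) (f \<circ> \<pi>) \<phi>"
  by (induction \<phi> arbitrary: e f) (auto simp: mval_rename wval_rename upd_comp_inj)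

lemma mterm_vars_rename: "mterm_vars (mterm_rename \<pi> t) = \<pi> ` mterm_vars t"
  by (induction t) auto

lemma wterm_mvars_rename: "wterm_mvars (wterm_rename \<pi> t) = \<pi> ` wterm_mvars t"
  by (induction t) (auto simp: mterm_vars_rename)

lemma wterm_wvars_rename: "wterm_wvars (wterm_rename \<pi> t) = \<pi> ` wterm_wvars t"
  by (induction t) auto

lemma free_mvars_rename: "inj \<pi> \<Longrightarrow> free_mvars (form_rename \<pi> \<phi>) = \<pi> ` free_mvars \<phi>"
  by (induction \<phi>) (auto simp: mterm_vars_rename wterm_mvars_rename image_set_diff)

lemma free_wvars_rename: "inj \<pi> \<Longrightarrow> free_wvars (form_rename \<pi> \<phi>) = \<pi> ` free_wvars \<phi>"
  by (induction \<phi>) (auto simp: wterm_wvars_rename image_set_diff)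

section \<open>Closure properties of the relations defined by formulas\<close>

locale full_structure =
  fixes S :: "('f, 'm, 'w) two_sorted"
  assumes mcarrier [simp]: "mcarrier S = UNIV" and wcarrier [simp]: "wcarrier S = UNIV"
begin

text \<open>Relations stand for formulas up to equivalence, so that formulas can be assembled
  semantically. The sets \<open>V\<close> and \<open>U\<close> are only bounds on the free
  variables.\<close>

definition fo :: "nat set \<Rightarrow> nat set \<Rightarrow> ((nat \<Rightarrow> 'm) \<Rightarrow> (nat \<Rightarrow> 'w) \<Rightarrow> bool) \<Rightarrow> bool" where
  "fo V U R \<longleftrightarrow> (\<exists>\<phi>. free_mvars \<phi> \<subseteq> V \<and> free_wvars \<phi> \<subseteq> U \<and> R = (\<lambda>e f. sat S e f \<phi>))"

lemma foI: "free_mvars \<phi> \<subseteq> V \<Longrightarrow> free_wvars \<phi> \<subseteq> U \<Longrightarrow> (\<And>e f. R e f = sat S e f \<phi>) \<Longrightarrow> fo V U R"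
  unfolding fo_def by blast

lemma foE:
  assumes "fo V U R"
  obtains \<phi> where "free_mvars \<phi> \<subseteq> V" "free_wvars \<phi> \<subseteq> U" "\<And>e f. R e f = sat S e f \<phi>"
  using assms unfolding fo_def by blast

lemma fo_sat: "fo (free_mvars \<phi>) (free_wvars \<phi>) (\<lambda>e f. sat S e f \<phi>)"
  by (rule foI[of \<phi>]) auto

lemma fo_mono: "fo V U R \<Longrightarrow> V \<subseteq> V' \<Longrightarrow> U \<subseteq> U' \<Longrightarrow> fo V' U' R"
  unfolding fo_def by blast

lemma fo_cong:
  assumes "fo V U R" "\<And>i. i \<in> V \<Longrightarrow> e i = e' i" "\<And>j. j \<in> U \<Longrightarrow> f j = f' j"
  shows "R e f = R e' f'"
  using assms(1) by (rule foE) (auto intro!: sat_cong assms(2,3))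

lemma fo_meq: "mterm_vars s \<union> mterm_vars t \<subseteq> V \<Longrightarrow> fo V U (\<lambda>e f. mval S e s = mval S e t)"
  by (rule foI[of "MEq s t"]) auto

lemma fo_weq:
  "wterm_mvars s \<union> wterm_mvars t \<subseteq> V \<Longrightarrow> wterm_wvars s \<union> wterm_wvars t \<subseteq> U \<Longrightarrow>
    fo V U (\<lambda>e f. wval S e f s = wval S e f t)"
  by (rule foI[of "WEq s t"]) auto

lemma fo_mvar_eq: "i \<in> V \<Longrightarrow> j \<in> V \<Longrightarrow> fo V U (\<lambda>e f. e i = e j)"
  using fo_meq[of "MVar i" "MVar j" V U] by simp

lemma fo_wvar_eq: "i \<in> U \<Longrightarrow> j \<in> U \<Longrightarrow> fo V U (\<lambda>e f. f i = f j)"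
  using fo_weq[of "WVar i" "WVar j" V U] by simp

lemma fo_not: "fo V U R \<Longrightarrow> fo V U (\<lambda>e f. \<not> R e f)"
  by (erule foE) (rule foI[of "Neg _"], auto)

lemma fo_conj: "fo V U R \<Longrightarrow> fo V U R' \<Longrightarrow> fo V U (\<lambda>e f. R e f \<and> R' e f)"
  by (elim foE) (rule foI[of "Conj _ _"], auto)

lemma fo_disj: "fo V U R \<Longrightarrow> fo V U R' \<Longrightarrow> fo V U (\<lambda>e f. R e f \<or> R' e f)"
  using fo_not[OF fo_conj[OF fo_not fo_not], of V U R R'] by simp

lemma fo_True: "fo V U (\<lambda>e f. True)"
  using fo_meq[of MZero MZero V U] by simp

lemma fo_const: "fo V U (\<lambda>e f. b)"
  using fo_True fo_not[OF fo_True] by (cases b) auto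

lemma fo_Ball: "finite I \<Longrightarrow> (\<And>i. i \<in> I \<Longrightarrow> fo V U (R i)) \<Longrightarrow> fo V U (\<lambda>e f. \<forall>i\<in>I. R i e f)"
  by (induction I rule: finite_induct) (auto intro: fo_True fo_conj)

lemma fo_Bex: "finite I \<Longrightarrow> (\<And>i. i \<in> I \<Longrightarrow> fo V U (R i)) \<Longrightarrow> fo V U (\<lambda>e f. \<exists>i\<in>I. R i e f)"
  using fo_not[OF fo_Ball[OF _ fo_not], of I V U R] by simp

lemma fo_iff: "fo V U R \<Longrightarrow> fo V U R' \<Longrightarrow> fo V U (\<lambda>e f. R e f \<longleftrightarrow> R' e f)"
  using fo_disj[OF fo_conj[of V U R R'] fo_conj[OF fo_not[of V U R] fo_not[of V U R']]]
  by (rule back_subst[of "fo V U"]) auto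

lemma fo_MEx: "fo V U R \<Longrightarrow> fo (V - {i}) U (\<lambda>e f. \<exists>a. R (e(i := a)) f)"
  by (erule foE) (rule foI[of "MEx i _"], auto)

lemma fo_WEx: "fo V U R \<Longrightarrow> fo V (U - {j}) (\<lambda>e f. \<exists>x. R e (f(j := x)))"
  by (erule foE) (rule foI[of "WEx j _"], auto)

text \<open>A block of quantifiers overwrites the assignment on \<open>I\<close>; values of
  \<open>g\<close> outside \<open>I\<close> are never read, so one function serves for the whole
  block.\<close>

lemma fo_MExs:
  assumes "finite I" "fo V U R"
  shows "fo (V - I) U (\<lambda>e f. \<exists>g. R (\<lambda>i. if i \<in> I then g i else e i) f)"
  using assms(1)
proof (induction I rule: finite_induct)
  case empty
  then show ?case using assms(2) by simp
next
  case (insert i I)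
  have "(\<exists>g. R (\<lambda>j. if j \<in> insert i I then g j else e j) f) \<longleftrightarrow>
      (\<exists>a g. R (\<lambda>j. if j \<in> I then g j else (e(i := a)) j) f)" for e f
  proof
    assume "\<exists>g. R (\<lambda>j. if j \<in> insert i I then g j else e j) f"
    then obtain g where "R (\<lambda>j. if j \<in> insert i I then g j else e j) f" ..
    also have "(\<lambda>j. if j \<in> insert i I then g j else e j) = (\<lambda>j. if j \<in> I then g j else (e(i := g i)) j)"
      using insert(2) by auto
    finally show "\<exists>a g. R (\<lambda>j. if j \<in> I then g j else (e(i := a)) j) f" by blast
  next
    assume "\<exists>a g. R (\<lambda>j. if j \<in> I then g j else (e(i := a)) j) f"
    then obtain a g where "R (\<lambda>j. if j \<in> I then g j else (e(i := a)) j) f" by blast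
    also have "(\<lambda>j. if j \<in> I then g j else (e(i := a)) j) =
        (\<lambda>j. if j \<in> insert i I then (g(i := a)) j else e j)"
      using insert(2) by auto
    finally show "\<exists>g. R (\<lambda>j. if j \<in> insert i I then g j else e j) f" by blast
  qed
  then show ?case
    using fo_MEx[OF insert.IH, of i] by (simp add: Diff_insert[symmetric])
qed

lemma fo_WExs:
  assumes "finite I" "fo V U R"
  shows "fo V (U - I) (\<lambda>e f. \<exists>g. R e (\<lambda>j. if j \<in> I then g j else f j))"
  using assms(1)
proof (induction I rule: finite_induct)
  case empty
  then show ?case using assms(2) by simp
next
  case (insert i I)
  have "(\<exists>g. R e (\<lambda>j. if j \<in> insert i I then g j else f j)) \<longleftrightarrow>
      (\<exists>a g. R e (\<lambda>j. if j \<in> I then g j else (f(i := a)) j))" for e f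
  proof
    assume "\<exists>g. R e (\<lambda>j. if j \<in> insert i I then g j else f j)"
    then obtain g where "R e (\<lambda>j. if j \<in> insert i I then g j else f j)" ..
    also have "(\<lambda>j. if j \<in> insert i I then g j else f j) = (\<lambda>j. if j \<in> I then g j else (f(i := g i)) j)"
      using insert(2) by auto
    finally show "\<exists>a g. R e (\<lambda>j. if j \<in> I then g j else (f(i := a)) j)" by blast
  next
    assume "\<exists>a g. R e (\<lambda>j. if j \<in> I then g j else (f(i := a)) j)"
    then obtain a g where "R e (\<lambda>j. if j \<in> I then g j else (f(i := a)) j)" by blast
    also have "(\<lambda>j. if j \<in> I then g j else (f(i := a)) j) =
        (\<lambda>j. if j \<in> insert i I then (g(i := a)) j else f j)"
      using insert(2) by auto
    finally show "\<exists>g. R e (\<lambda>j. if j \<in> insert i I then g j else f j)" by blast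
  qed
  then show ?case
    using fo_WEx[OF insert.IH, of i] by (simp add: Diff_insert[symmetric])
qed

text \<open>The variables of the formula are moved out of the way by an injective renaming, which may
  also act on the bound variables, and the copies are then equated with the intended variables.\<close>

lemma fo_rename:
  assumes "finite V" "finite U" "fo V U R"
  shows "fo (\<tau> ` V) (\<sigma> ` U) (\<lambda>e f. R (e \<circ> \<tau>) (f \<circ> \<sigma>))"
proof -
  obtain N where N: "\<tau> ` V \<subseteq> {..<N}" "\<sigma> ` U \<subseteq> {..<N}"
    using assms(1,2) by (meson finite_UnI finite_imageI finite_nat_iff_bounded le_sup_iff)
  let ?\<pi> = "(+) N"
  obtain \<phi> where \<phi>: "free_mvars \<phi> \<subseteq> V" "free_wvars \<phi> \<subseteq> U" "\<And>e f. R e f = sat S e f \<phi>"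
    using foE[OF assms(3)] by metis
  have R1: "fo (?\<pi> ` V) (?\<pi> ` U) (\<lambda>e f. R (e \<circ> ?\<pi>) (f \<circ> ?\<pi>))"
    using \<phi> by (intro foI[of "form_rename ?\<pi> \<phi>"])
      (auto simp: sat_rename free_mvars_rename free_wvars_rename)
  have R2: "fo (\<tau> ` V \<union> ?\<pi> ` V) (\<sigma> ` U \<union> ?\<pi> ` U) (\<lambda>e f. R (e \<circ> ?\<pi>) (f \<circ> ?\<pi>) \<and>
      (\<forall>i\<in>V. e (N + i) = e (\<tau> i)) \<and> (\<forall>j\<in>U. f (N + j) = f (\<sigma> j)))"
    using assms by (intro fo_conj fo_mono[OF R1] fo_Ball fo_mvar_eq fo_wvar_eq) auto
  have Q: "fo (\<tau> ` V \<union> ?\<pi> ` V - ?\<pi> ` V) (\<sigma> ` U \<union> ?\<pi> ` U - ?\<pi> ` U) (\<lambda>e f. \<exists>h g.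
      R ((\<lambda>i. if i \<in> ?\<pi> ` V then g i else e i) \<circ> ?\<pi>) ((\<lambda>j. if j \<in> ?\<pi> ` U then h j else f j) \<circ> ?\<pi>) \<and>
      (\<forall>i\<in>V. (\<lambda>i. if i \<in> ?\<pi> ` V then g i else e i) (N + i) = (\<lambda>i. if i \<in> ?\<pi> ` V then g i else e i) (\<tau> i)) \<and>
      (\<forall>j\<in>U. (\<lambda>j. if j \<in> ?\<pi> ` U then h j else f j) (N + j) = (\<lambda>j. if j \<in> ?\<pi> ` U then h j else f j) (\<sigma> j)))"
    (is "fo _ _ ?Q")
    by (rule fo_WExs[OF finite_imageI[OF assms(2)] fo_MExs[OF finite_imageI[OF assms(1)] R2]])
  have Q_iff: "?Q e f = R (e \<circ> \<tau>) (f \<circ> \<sigma>)" for e f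
  proof -
    have out: "\<tau> i \<notin> ?\<pi> ` V" if "i \<in> V" for i using N(1) that by force
    have out': "\<sigma> i \<notin> ?\<pi> ` U" if "i \<in> U" for i using N(2) that by force
    show ?thesis
    proof
      assume "?Q e f"
      then obtain h g where
        *: "R ((\<lambda>i. if i \<in> ?\<pi> ` V then g i else e i) \<circ> ?\<pi>) ((\<lambda>j. if j \<in> ?\<pi> ` U then h j else f j) \<circ> ?\<pi>)"
        "\<forall>i\<in>V. g (N + i) = e (\<tau> i)" "\<forall>j\<in>U. h (N + j) = f (\<sigma> j)"
        using out out' by auto
      have "R ((\<lambda>i. if i \<in> ?\<pi> ` V then g i else e i) \<circ> ?\<pi>) ((\<lambda>j. if j \<in> ?\<pi> ` U then h j else f j) \<circ> ?\<pi>) =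
          R (e \<circ> \<tau>) (f \<circ> \<sigma>)"
        using *(2,3) by (intro fo_cong[OF assms(3)]) auto
      with *(1) show "R (e \<circ> \<tau>) (f \<circ> \<sigma>)" by simp
    next
      assume "R (e \<circ> \<tau>) (f \<circ> \<sigma>)"
      moreover have "R ((\<lambda>i. if i \<in> ?\<pi> ` V then e (\<tau> (i - N)) else e i) \<circ> ?\<pi>)
          ((\<lambda>j. if j \<in> ?\<pi> ` U then f (\<sigma> (j - N)) else f j) \<circ> ?\<pi>) = R (e \<circ> \<tau>) (f \<circ> \<sigma>)"
        by (intro fo_cong[OF assms(3)]) auto
      ultimately have "R ((\<lambda>i. if i \<in> ?\<pi> ` V then e (\<tau> (i - N)) else e i) \<circ> ?\<pi>)
          ((\<lambda>j. if j \<in> ?\<pi> ` U then f (\<sigma> (j - N)) else f j) \<circ> ?\<pi>)" by simp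
      then show "?Q e f"
        using out out'
        by (intro exI[of _ "\<lambda>j. f (\<sigma> (j - N))"] exI[of _ "\<lambda>i. e (\<tau> (i - N))"]) auto
    qed
  qed
  show ?thesis
    by (rule fo_mono[OF Q[unfolded Q_iff]]) auto
qed

end

section \<open>Countable models\<close>

lemma mval_closed:
  "is_structure S \<Longrightarrow> (\<And>i. e i \<in> mcarrier S) \<Longrightarrow> mval S e t \<in> mcarrier S"
  by (induction t) (auto simp: is_structure_def)

lemma wval_closed:
  "is_structure S \<Longrightarrow> (\<And>i. e i \<in> mcarrier S) \<Longrightarrow> (\<And>j. f j \<in> wcarrier S) \<Longrightarrow> wval S e f t \<in> wcarrier S"
  by (induction t) (auto simp: is_structure_def mval_closed)

text \<open>Injectivity settles the equations and surjectivity the quantifiers. The maps are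
  returned because the image of a particular tuple is needed later.\<close>

lemma isomorphic_sat:
  assumes "isomorphic A B" "is_structure A"
  obtains g h where "\<And>a. a \<in> mcarrier A \<Longrightarrow> g a \<in> mcarrier B" "\<And>x. x \<in> wcarrier A \<Longrightarrow> h x \<in> wcarrier B"
    "\<And>e f \<phi>. (\<And>i. e i \<in> mcarrier A) \<Longrightarrow> (\<And>j. f j \<in> wcarrier A) \<Longrightarrow>
      sat A e f \<phi> = sat B (g \<circ> e) (h \<circ> f) \<phi>"
proof -
  obtain g h where gh: "bij_betw g (mcarrier A) (mcarrier B)" "bij_betw h (wcarrier A) (wcarrier B)"
    "g (mzero A) = mzero B"
    "\<forall>a\<in>mcarrier A. \<forall>b\<in>mcarrier A. g (madd A a b) = madd B (g a) (g b)"
    "\<forall>c. \<forall>a\<in>mcarrier A. g (mscale A c a) = mscale B c (g a)"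
    "h (wzero A) = wzero B"
    "\<forall>x\<in>wcarrier A. \<forall>y\<in>wcarrier A. h (wadd A x y) = wadd B (h x) (h y)"
    "\<forall>c. \<forall>x\<in>wcarrier A. h (wscale A c x) = wscale B c (h x)"
    "\<forall>a\<in>mcarrier A. \<forall>b\<in>mcarrier A. h (beta A a b) = beta B (g a) (g b)"
    using assms(1) unfolding isomorphic_def by (elim exE conjE)
  have g: "g (mval A e t) = mval B (g \<circ> e) t" if "\<And>i. e i \<in> mcarrier A" for e t
    by (induction t) (auto simp: gh mval_closed assms(2) that)
  have h: "h (wval A e f t) = wval B (g \<circ> e) (h \<circ> f) t"
    if "\<And>i. e i \<in> mcarrier A" "\<And>j. f j \<in> wcarrier A" for e f t
    by (induction t) (auto simp: gh mval_closed wval_closed assms(2) that g comp_def)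
  have inj: "inj_on g (mcarrier A)" "inj_on h (wcarrier A)"
    and im: "mcarrier B = g ` mcarrier A" "wcarrier B = h ` wcarrier A"
    using gh(1,2) by (auto simp: bij_betw_def)
  have "sat A e f \<phi> = sat B (g \<circ> e) (h \<circ> f) \<phi>"
    if "\<And>i. e i \<in> mcarrier A" "\<And>j. f j \<in> wcarrier A" for e f \<phi>
    using that
  proof (induction \<phi> arbitrary: e f)
    case (MEq s t)
    note closed = mval_closed[OF assms(2) MEq(1)]
    show ?case
      unfolding sat.simps g[OF MEq(1), symmetric] inj_on_eq_iff[OF inj(1) closed closed] ..
  next
    case (WEq s t)
    note closed = wval_closed[OF assms(2) WEq]
    show ?case
      unfolding sat.simps h[OF WEq, symmetric] inj_on_eq_iff[OF inj(2) closed closed] ..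
  next
    case (Neg \<phi>)
    then show ?case by simp
  next
    case (Conj \<phi> \<psi>)
    then show ?case by simp
  next
    case (MEx i \<phi>)
    have "sat A (e(i := a)) f \<phi> = sat B ((g \<circ> e)(i := g a)) (h \<circ> f) \<phi>" if "a \<in> mcarrier A" for a
      unfolding fun_upd_comp[symmetric] by (rule MEx.IH) (use MEx.prems that in auto)
    then show ?case unfolding sat.simps im by blast
  next
    case (WEx i \<phi>)
    have "sat A e (f(i := a)) \<phi> = sat B (g \<circ> e) ((h \<circ> f)(i := h a)) \<phi>" if "a \<in> wcarrier A" for a
      unfolding fun_upd_comp[symmetric] by (rule WEx.IH) (use WEx.prems that in auto)
    then show ?case unfolding sat.simps im by blast
  qed
  then show thesis
    using that[of g h] im by blast
qed

text \<open>\<open>E\<close> and \<open>F\<close> are sequences of assignments, and the \<open>j\<close>-th variable stands for the element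
  \<open>\<lambda>n. E n j\<close> of the ultrapower. By assumption, the elements of this form are a countable elementary
  substructure, which is represented on the natural numbers by choosing the least of all variables
  for the same element.\<close>

locale henkin = full_structure S for S :: "('f, 'm, 'w) two_sorted" +
  fixes E :: "nat \<Rightarrow> nat \<Rightarrow> 'm" and F :: "nat \<Rightarrow> nat \<Rightarrow> 'w" and U :: "nat filter"
  assumes U: "nonprincipal_ultrafilter U"
    and witness_M: "\<And>\<phi> v. eventually (\<lambda>n. \<exists>a. sat S ((E n)(v := a)) (F n) \<phi>) U \<Longrightarrow>
      \<exists>j. eventually (\<lambda>n. sat S ((E n)(v := E n j)) (F n) \<phi>) U"
    and witness_W: "\<And>\<phi> v. eventually (\<lambda>n. \<exists>x. sat S (E n) ((F n)(v := x)) \<phi>) U \<Longrightarrow>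
      \<exists>j. eventually (\<lambda>n. sat S (E n) ((F n)(v := F n j)) \<phi>) U"
begin

abbreviation ae :: "(nat \<Rightarrow> bool) \<Rightarrow> bool" where
  "ae P \<equiv> eventually P U"

text \<open>Properness and maximality of the ultrafilter make \<open>ae\<close> commute with
  negation, as the negation case of \<open>sat_model\<close> requires.\<close>

lemma ae_not: "ae (\<lambda>n. \<not> P n) \<longleftrightarrow> \<not> ae P"
proof -
  have "\<not> (ae P \<and> ae (\<lambda>n. \<not> P n))"
    using U by (auto simp: nonprincipal_ultrafilter_def trivial_limit_def
      eventually_conj_iff[symmetric] simp del: eventually_conj_iff)
  then show ?thesis using U by (auto simp: nonprincipal_ultrafilter_def)
qed

lemma fo_witness_M:
  assumes "fo V V' R" "finite V" "finite V'" "ae (\<lambda>n. \<exists>a. R ((E n \<circ> \<tau>)(i := a)) (F n \<circ> \<sigma>))"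
  shows "\<exists>j. ae (\<lambda>n. R (E n \<circ> \<tau>(i := j)) (F n \<circ> \<sigma>))"
proof -
  obtain v where v: "v \<notin> \<tau> ` V"
    using assms(2) ex_new_if_finite infinite_UNIV_nat by blast
  obtain \<phi> where \<phi>: "\<And>e f. R (e \<circ> \<tau>(i := v)) (f \<circ> \<sigma>) = sat S e f \<phi>"
    using foE[OF fo_rename[OF assms(2,3,1)]] by metis
  have *: "sat S ((E n)(v := a)) (F n) \<phi> = R ((E n \<circ> \<tau>)(i := a)) (F n \<circ> \<sigma>)" for n a
    unfolding \<phi>[symmetric] using v by (intro fo_cong[OF assms(1)]) auto
  have "ae (\<lambda>n. \<exists>a. sat S ((E n)(v := a)) (F n) \<phi>)"
    using assms(4) by (simp add: *)
  from witness_M[OF this] show ?thesis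
    by (simp add: * fun_upd_comp)
qed

lemma fo_witness_W:
  assumes "fo V V' R" "finite V" "finite V'" "ae (\<lambda>n. \<exists>a. R (E n \<circ> \<tau>) ((F n \<circ> \<sigma>)(i := a)))"
  shows "\<exists>j. ae (\<lambda>n. R (E n \<circ> \<tau>) (F n \<circ> \<sigma>(i := j)))"
proof -
  obtain v where v: "v \<notin> \<sigma> ` V'"
    using assms(3) ex_new_if_finite infinite_UNIV_nat by blast
  obtain \<phi> where \<phi>: "\<And>e f. R (e \<circ> \<tau>) (f \<circ> \<sigma>(i := v)) = sat S e f \<phi>"
    using foE[OF fo_rename[OF assms(2,3,1)]] by metis
  have *: "sat S (E n) ((F n)(v := a)) \<phi> = R (E n \<circ> \<tau>) ((F n \<circ> \<sigma>)(i := a))" for n a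
    unfolding \<phi>[symmetric] using v by (intro fo_cong[OF assms(1)]) auto
  have "ae (\<lambda>n. \<exists>a. sat S (E n) ((F n)(v := a)) \<phi>)"
    using assms(4) by (simp add: *)
  from witness_W[OF this] show ?thesis
    by (simp add: * fun_upd_comp)
qed

definition repM :: "nat \<Rightarrow> nat" where
  "repM i = (LEAST j. ae (\<lambda>n. E n j = E n i))"

definition repW :: "nat \<Rightarrow> nat" where
  "repW i = (LEAST j. ae (\<lambda>n. F n j = F n i))"

lemma ae_repM: "ae (\<lambda>n. E n (repM i) = E n i)"
  using LeastI[of "\<lambda>j. ae (\<lambda>n. E n j = E n i)" i] by (simp add: repM_def)

lemma ae_repW: "ae (\<lambda>n. F n (repW i) = F n i)"
  using LeastI[of "\<lambda>j. ae (\<lambda>n. F n j = F n i)" i] by (simp add: repW_def)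

lemma repM_eq_iff: "repM i = repM j \<longleftrightarrow> ae (\<lambda>n. E n i = E n j)"
proof
  assume "repM i = repM j"
  with ae_repM[of i] ae_repM[of j] show "ae (\<lambda>n. E n i = E n j)"
    by (auto elim: eventually_elim2)
next
  assume "ae (\<lambda>n. E n i = E n j)"
  then have "ae (\<lambda>n. E n k = E n i) = ae (\<lambda>n. E n k = E n j)" for k
    by (intro iffI) (auto elim: eventually_elim2)
  then show "repM i = repM j" by (simp add: repM_def)
qed

lemma repW_eq_iff: "repW i = repW j \<longleftrightarrow> ae (\<lambda>n. F n i = F n j)"
proof
  assume "repW i = repW j"
  with ae_repW[of i] ae_repW[of j] show "ae (\<lambda>n. F n i = F n j)"
    by (auto elim: eventually_elim2)
next
  assume "ae (\<lambda>n. F n i = F n j)"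
  then have "ae (\<lambda>n. F n k = F n i) = ae (\<lambda>n. F n k = F n j)" for k
    by (intro iffI) (auto elim: eventually_elim2)
  then show "repW i = repW j" by (simp add: repW_def)
qed

definition opM :: "'f mterm \<Rightarrow> (nat \<Rightarrow> nat) \<Rightarrow> nat" where
  "opM t \<tau> = repM (SOME j. ae (\<lambda>n. E n j = mval S (E n \<circ> \<tau>) t))"

definition opW :: "'f wterm \<Rightarrow> (nat \<Rightarrow> nat) \<Rightarrow> (nat \<Rightarrow> nat) \<Rightarrow> nat" where
  "opW t \<tau> \<sigma> = repW (SOME j. ae (\<lambda>n. F n j = wval S (E n \<circ> \<tau>) (F n \<circ> \<sigma>) t))"

text \<open>The value of \<open>t\<close> is a witness for the formula \<open>x = t\<close>, so some
  variable names it almost everywhere. The shift by \<open>Suc\<close> frees the variable 0 for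
  \<open>x\<close>.\<close>

lemma ae_opM: "ae (\<lambda>n. E n (opM t \<tau>) = mval S (E n \<circ> \<tau>) t)"
proof -
  let ?t = "mterm_rename Suc t" and ?\<tau> = "case_nat 0 \<tau>"
  let ?R = "\<lambda>e f :: nat \<Rightarrow> 'w. mval S e (MVar 0) = mval S e ?t"
  have R: "fo (insert 0 (mterm_vars ?t)) {} ?R"
    by (rule fo_meq) auto
  have s: "(E n \<circ> ?\<tau>)(0 := a) \<circ> Suc = E n \<circ> \<tau>" "(E n \<circ> ?\<tau>(0 := j)) \<circ> Suc = E n \<circ> \<tau>" for n a j
    by auto
  have "\<exists>j. ae (\<lambda>n. ?R (E n \<circ> ?\<tau>(0 := j)) (F n \<circ> id))"
    using R by (rule fo_witness_M) (auto simp: finite_mterm_vars mval_rename s simp del: fun_upd_apply, simp)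
  then have "\<exists>j. ae (\<lambda>n. E n j = mval S (E n \<circ> \<tau>) t)"
    unfolding mval_rename s by simp
  from someI_ex[OF this] ae_repM[of "SOME j. ae (\<lambda>n. E n j = mval S (E n \<circ> \<tau>) t)"] show ?thesis
    unfolding opM_def by eventually_elim (simp only:)
qed

lemma ae_opW: "ae (\<lambda>n. F n (opW t \<tau> \<sigma>) = wval S (E n \<circ> \<tau>) (F n \<circ> \<sigma>) t)"
proof -
  let ?t = "wterm_rename Suc t" and ?\<tau> = "case_nat 0 \<tau>" and ?\<sigma> = "case_nat 0 \<sigma>"
  let ?R = "\<lambda>e f. wval S e f (WVar 0) = wval S e f ?t"
  have R: "fo (wterm_mvars ?t) (insert 0 (wterm_wvars ?t)) ?R"
    by (rule fo_weq) auto
  have s: "(F n \<circ> ?\<sigma>)(0 := a) \<circ> Suc = F n \<circ> \<sigma>" "(F n \<circ> ?\<sigma>(0 := j)) \<circ> Suc = F n \<circ> \<sigma>"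
    "(E n \<circ> ?\<tau>) \<circ> Suc = E n \<circ> \<tau>" for n a j
    by auto
  have "\<exists>j. ae (\<lambda>n. ?R (E n \<circ> ?\<tau>) (F n \<circ> ?\<sigma>(0 := j)))"
    using R by (rule fo_witness_W)
      (auto simp: finite_wterm_mvars finite_wterm_wvars wval_rename s simp del: fun_upd_apply, simp)
  then have "\<exists>j. ae (\<lambda>n. F n j = wval S (E n \<circ> \<tau>) (F n \<circ> \<sigma>) t)"
    unfolding wval_rename s by simp
  from someI_ex[OF this] ae_repW[of "SOME j. ae (\<lambda>n. F n j = wval S (E n \<circ> \<tau>) (F n \<circ> \<sigma>) t)"] show ?thesis
    unfolding opW_def by eventually_elim (simp only:)
qed

lemma repM_opM: "repM (opM t \<tau>) = opM t \<tau>"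
  using ae_repM by (simp add: opM_def repM_eq_iff)

lemma repW_opW: "repW (opW t \<tau> \<sigma>) = opW t \<tau> \<sigma>"
  using ae_repW by (simp add: opW_def repW_eq_iff)

lemma opM_eqI:
  assumes "ae (\<lambda>n. E n j = mval S (E n \<circ> \<tau>) t)"
  shows "opM t \<tau> = repM j"
proof -
  have "repM (opM t \<tau>) = repM j"
    unfolding repM_eq_iff using assms ae_opM[of t \<tau>] by (rule eventually_elim2) simp
  then show ?thesis by (simp add: repM_opM)
qed

lemma opW_eqI:
  assumes "ae (\<lambda>n. F n j = wval S (E n \<circ> \<tau>) (F n \<circ> \<sigma>) t)"
  shows "opW t \<tau> \<sigma> = repW j"
proof -
  have "repW (opW t \<tau> \<sigma>) = repW j"
    unfolding repW_eq_iff using assms ae_opW[of t \<tau> \<sigma>] by (rule eventually_elim2) simp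
  then show ?thesis by (simp add: repW_opW)
qed

text \<open>Elements are variables themselves, so an operation is evaluated by substituting its
  arguments for the places 0 and 1 of a term.\<close>

definition model :: "('f, nat, nat) two_sorted" where
  "model = \<lparr>mcarrier = range repM, mzero = opM MZero id,
     madd = (\<lambda>x y. opM (MAdd (MVar 0) (MVar 1)) (\<lambda>i. if i = 0 then x else y)),
     mscale = (\<lambda>c x. opM (MScale c (MVar 0)) (\<lambda>i. x)),
     wcarrier = range repW, wzero = opW WZero id id,
     wadd = (\<lambda>x y. opW (WAdd (WVar 0) (WVar 1)) id (\<lambda>i. if i = 0 then x else y)),
     wscale = (\<lambda>c x. opW (WScale c (WVar 0)) id (\<lambda>i. x)),
     beta = (\<lambda>x y. opW (Beta (MVar 0) (MVar 1)) (\<lambda>i. if i = 0 then x else y) id)\<rparr>"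

lemma mcarrier_model: "mcarrier model = range repM" and wcarrier_model: "wcarrier model = range repW"
  by (simp_all add: model_def)

lemma model_ops:
  "mzero model = opM MZero id"
  "madd model x y = opM (MAdd (MVar 0) (MVar 1)) (\<lambda>i. if i = 0 then x else y)"
  "mscale model c x = opM (MScale c (MVar 0)) (\<lambda>i. x)"
  "wzero model = opW WZero id id"
  "wadd model x y = opW (WAdd (WVar 0) (WVar 1)) id (\<lambda>i. if i = 0 then x else y)"
  "wscale model c x = opW (WScale c (WVar 0)) id (\<lambda>i. x)"
  "beta model x y = opW (Beta (MVar 0) (MVar 1)) (\<lambda>i. if i = 0 then x else y) id"
  by (simp_all add: model_def)

lemma is_structure_model: "is_structure model"
proof -
  have "opM t \<tau> \<in> range repM" "opW u \<tau> \<sigma> \<in> range repW" for t u \<tau> \<sigma>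
    by (metis repM_opM rangeI) (metis repW_opW rangeI)
  then show ?thesis by (simp add: is_structure_def model_def)
qed

lemma mval_model: "mval model (repM \<circ> \<tau>) t = opM t \<tau>"
proof (induction t)
  case (MVar i)
  show ?case by (auto intro!: opM_eqI[symmetric])
next
  case MZero
  have "opM MZero id = repM (opM MZero \<tau>)"
    using ae_opM[of MZero \<tau>] by (intro opM_eqI) simp
  then show ?case by (simp only: mval.simps wval.simps model_ops repM_opM)
next
  case (MAdd s t)
  have "opM (MAdd (MVar 0) (MVar 1)) (\<lambda>i. if i = 0 then opM s \<tau> else opM t \<tau>) = repM (opM (MAdd s t) \<tau>)"
    using ae_opM[of s \<tau>] ae_opM[of t \<tau>] ae_opM[of "MAdd s t" \<tau>]
    by (intro opM_eqI, eventually_elim) simp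
  then show ?case by (simp only: mval.simps wval.simps model_ops repM_opM MAdd)
next
  case (MScale c t)
  have "opM (MScale c (MVar 0)) (\<lambda>i. opM t \<tau>) = repM (opM (MScale c t) \<tau>)"
    using ae_opM[of t \<tau>] ae_opM[of "MScale c t" \<tau>]
    by (intro opM_eqI, eventually_elim) simp
  then show ?case by (simp only: mval.simps wval.simps model_ops repM_opM MScale)
qed

lemma wval_model: "wval model (repM \<circ> \<tau>) (repW \<circ> \<sigma>) t = opW t \<tau> \<sigma>"
proof (induction t)
  case (WVar i)
  show ?case by (auto intro!: opW_eqI[symmetric])
next
  case WZero
  have "opW WZero id id = repW (opW WZero \<tau> \<sigma>)"
    using ae_opW[of WZero \<tau> \<sigma>] by (intro opW_eqI) simp
  then show ?case by (simp only: mval.simps wval.simps model_ops repW_opW)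
next
  case (WAdd s t)
  have "opW (WAdd (WVar 0) (WVar 1)) id (\<lambda>i. if i = 0 then opW s \<tau> \<sigma> else opW t \<tau> \<sigma>) =
      repW (opW (WAdd s t) \<tau> \<sigma>)"
    using ae_opW[of s \<tau> \<sigma>] ae_opW[of t \<tau> \<sigma>] ae_opW[of "WAdd s t" \<tau> \<sigma>]
    by (intro opW_eqI, eventually_elim) simp
  then show ?case by (simp only: mval.simps wval.simps model_ops repW_opW WAdd)
next
  case (WScale c t)
  have "opW (WScale c (WVar 0)) id (\<lambda>i. opW t \<tau> \<sigma>) = repW (opW (WScale c t) \<tau> \<sigma>)"
    using ae_opW[of t \<tau> \<sigma>] ae_opW[of "WScale c t" \<tau> \<sigma>]
    by (intro opW_eqI, eventually_elim) simp
  then show ?case by (simp only: mval.simps wval.simps model_ops repW_opW WScale)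
next
  case (Beta s t)
  have "opW (Beta (MVar 0) (MVar 1)) (\<lambda>i. if i = 0 then opM s \<tau> else opM t \<tau>) id =
      repW (opW (Beta s t) \<tau> \<sigma>)"
    using ae_opM[of s \<tau>] ae_opM[of t \<tau>] ae_opW[of "Beta s t" \<tau> \<sigma>]
    by (intro opW_eqI, eventually_elim) simp
  then show ?case by (simp only: mval.simps wval.simps model_ops repW_opW mval_model)
qed

text \<open>The theorem of Los for the named elements of the ultrapower. In the existential cases
  the witness property finds one variable that works almost everywhere. The substitutions
  \<open>\<tau>\<close> and \<open>\<sigma>\<close> turn a quantifier over representatives into an
  update.\<close>

theorem sat_model:
  "sat model (repM \<circ> \<tau>) (repW \<circ> \<sigma>) \<phi> \<longleftrightarrow> ae (\<lambda>n. sat S (E n \<circ> \<tau>) (F n \<circ> \<sigma>) \<phi>)"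
proof (induction \<phi> arbitrary: \<tau> \<sigma>)
  case (MEq s t)
  have "opM s \<tau> = opM t \<tau> \<longleftrightarrow> ae (\<lambda>n. E n (opM s \<tau>) = E n (opM t \<tau>))"
    using repM_eq_iff[of "opM s \<tau>" "opM t \<tau>"] by (simp add: repM_opM)
  also have "\<dots> \<longleftrightarrow> ae (\<lambda>n. mval S (E n \<circ> \<tau>) s = mval S (E n \<circ> \<tau>) t)"
  proof -
    have "ae (\<lambda>n. (E n (opM s \<tau>) = E n (opM t \<tau>)) = (mval S (E n \<circ> \<tau>) s = mval S (E n \<circ> \<tau>) t))"
      using ae_opM[of s \<tau>] ae_opM[of t \<tau>] by eventually_elim (simp only:)
    then show ?thesis by (rule eventually_subst)
  qed
  finally show ?case unfolding sat.simps mval_model .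
next
  case (WEq s t)
  have "opW s \<tau> \<sigma> = opW t \<tau> \<sigma> \<longleftrightarrow> ae (\<lambda>n. F n (opW s \<tau> \<sigma>) = F n (opW t \<tau> \<sigma>))"
    using repW_eq_iff[of "opW s \<tau> \<sigma>" "opW t \<tau> \<sigma>"] by (simp add: repW_opW)
  also have "\<dots> \<longleftrightarrow> ae (\<lambda>n. wval S (E n \<circ> \<tau>) (F n \<circ> \<sigma>) s = wval S (E n \<circ> \<tau>) (F n \<circ> \<sigma>) t)"
  proof -
    have "ae (\<lambda>n. (F n (opW s \<tau> \<sigma>) = F n (opW t \<tau> \<sigma>)) =
        (wval S (E n \<circ> \<tau>) (F n \<circ> \<sigma>) s = wval S (E n \<circ> \<tau>) (F n \<circ> \<sigma>) t))"
      using ae_opW[of s \<tau> \<sigma>] ae_opW[of t \<tau> \<sigma>] by eventually_elim (simp only:)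
    then show ?thesis by (rule eventually_subst)
  qed
  finally show ?case unfolding sat.simps wval_model .
next
  case (Neg \<phi>)
  then show ?case by (simp only: sat.simps ae_not)
next
  case (Conj \<phi> \<psi>)
  then show ?case by (simp only: sat.simps eventually_conj_iff)
next
  case (MEx i \<phi>)
  have "sat model ((repM \<circ> \<tau>)(i := repM j)) (repW \<circ> \<sigma>) \<phi> \<longleftrightarrow>
      ae (\<lambda>n. sat S ((E n \<circ> \<tau>)(i := E n j)) (F n \<circ> \<sigma>) \<phi>)" for j
    using MEx[of "\<tau>(i := j)" \<sigma>] unfolding fun_upd_comp .
  then have "sat model (repM \<circ> \<tau>) (repW \<circ> \<sigma>) (MEx i \<phi>) \<longleftrightarrow>
      (\<exists>j. ae (\<lambda>n. sat S ((E n \<circ> \<tau>)(i := E n j)) (F n \<circ> \<sigma>) \<phi>))"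
    unfolding sat.simps mcarrier_model by blast
  also have "\<dots> \<longleftrightarrow> ae (\<lambda>n. \<exists>a. sat S ((E n \<circ> \<tau>)(i := a)) (F n \<circ> \<sigma>) \<phi>)"
    using fo_witness_M[OF fo_sat[of \<phi>], of \<tau> i \<sigma>] unfolding fun_upd_comp
    by (blast intro: eventually_mono finite_free_mvars finite_free_wvars)
  finally show ?case by (simp only: sat.simps mcarrier bex_UNIV)
next
  case (WEx i \<phi>)
  have "sat model (repM \<circ> \<tau>) ((repW \<circ> \<sigma>)(i := repW j)) \<phi> \<longleftrightarrow>
      ae (\<lambda>n. sat S (E n \<circ> \<tau>) ((F n \<circ> \<sigma>)(i := F n j)) \<phi>)" for j
    using WEx[of \<tau> "\<sigma>(i := j)"] unfolding fun_upd_comp .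
  then have "sat model (repM \<circ> \<tau>) (repW \<circ> \<sigma>) (WEx i \<phi>) \<longleftrightarrow>
      (\<exists>j. ae (\<lambda>n. sat S (E n \<circ> \<tau>) ((F n \<circ> \<sigma>)(i := F n j)) \<phi>))"
    unfolding sat.simps wcarrier_model by blast
  also have "\<dots> \<longleftrightarrow> ae (\<lambda>n. \<exists>x. sat S (E n \<circ> \<tau>) ((F n \<circ> \<sigma>)(i := x)) \<phi>)"
    using fo_witness_W[OF fo_sat[of \<phi>], of \<tau> \<sigma> i] unfolding fun_upd_comp
    by (blast intro: eventually_mono finite_free_mvars finite_free_wvars)
  finally show ?case by (simp only: sat.simps wcarrier bex_UNIV)
qed

lemma is_model_model: "is_model model (theory_of S)"
proof -
  have "sat model e f \<phi>" if "\<phi> \<in> theory_of S" for \<phi> e f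
  proof -
    have "sat model e f \<phi> = sat model (repM \<circ> id) (repW \<circ> id) \<phi>"
      using that by (intro sat_cong) (auto simp: theory_of_def sentence_def)
    then show ?thesis
      using that unfolding sat_model by (simp add: theory_of_def)
  qed
  then show ?thesis by (simp add: is_model_def is_structure_model)
qed

text \<open>If the variables in a finite \<open>I\<close> named all elements, then in each
  coordinate some element would differ from the values of these variables, and the witness property
  would name a further element.\<close>

lemma infinite_mcarrier_model:
  assumes "infinite (UNIV :: 'm set)"
  shows "infinite (mcarrier model)"
proof
  assume "finite (mcarrier model)"
  then obtain I where I: "finite I" "range repM = repM ` I"
    unfolding mcarrier_model by (metis finite_subset_image subset_refl)
  let ?R = "\<lambda>e (f :: nat \<Rightarrow> 'w). \<forall>i\<in>I. \<not> e 0 = e (Suc i)"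
  have R: "fo (insert 0 (Suc ` I)) {} ?R"
    using I(1) by (intro fo_Ball fo_not fo_mvar_eq) auto
  have "\<exists>a. ?R ((E n \<circ> case_nat 0 id)(0 := a)) (F n \<circ> id)" for n
    using ex_new_if_finite[OF assms finite_imageI[OF I(1), of "E n"]] by auto
  then obtain j where j: "ae (\<lambda>n. ?R (E n \<circ> (case_nat 0 id)(0 := j)) (F n \<circ> id))"
    using fo_witness_M[OF R, where \<tau> = "case_nat 0 id" and i = 0] I(1) by auto
  obtain i where i: "i \<in> I" "repM j = repM i" using I(2) by blast
  have "ae (\<lambda>n. \<not> E n j = E n i)" using j by eventually_elim (use i(1) in auto)
  with i(2) show False unfolding repM_eq_iff ae_not by simp
qed

lemma infinite_wcarrier_model:
  assumes "infinite (UNIV :: 'w set)"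
  shows "infinite (wcarrier model)"
proof
  assume "finite (wcarrier model)"
  then obtain I where I: "finite I" "range repW = repW ` I"
    unfolding wcarrier_model by (metis finite_subset_image subset_refl)
  let ?R = "\<lambda>(e :: nat \<Rightarrow> 'm) f. \<forall>i\<in>I. \<not> f 0 = f (Suc i)"
  have R: "fo {} (insert 0 (Suc ` I)) ?R"
    using I(1) by (intro fo_Ball fo_not fo_wvar_eq) auto
  have "\<exists>a. ?R (E n \<circ> id) ((F n \<circ> case_nat 0 id)(0 := a))" for n
    using ex_new_if_finite[OF assms finite_imageI[OF I(1), of "F n"]] by auto
  then obtain j where j: "ae (\<lambda>n. ?R (E n \<circ> id) (F n \<circ> (case_nat 0 id)(0 := j)))"
    using fo_witness_W[OF R, where \<sigma> = "case_nat 0 id" and i = 0] I(1) by auto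
  obtain i where i: "i \<in> I" "repW j = repW i" using I(2) by blast
  have "ae (\<lambda>n. \<not> F n j = F n i)" using j by eventually_elim (use i(1) in auto)
  with i(2) show False unfolding repW_eq_iff ae_not by simp
qed

end

section \<open>Countable models that realize given sequences of tuples\<close>

definition skolem_task :: "nat \<Rightarrow> nat \<times> 'f::countable form" where
  "skolem_task j = fst (from_nat j :: (nat \<times> 'f form) \<times> nat)"

text \<open>The second component of the decoded pair is idle; varying it makes each task recur
  arbitrarily late, after the variables of its formula have received their final values.\<close>

lemma skolem_task_unbounded: "\<exists>j\<ge>m. skolem_task j = t"
proof -
  have "inj (\<lambda>i :: nat. to_nat (t, i))"
    by (auto intro: injI)
  then have "infinite (range (\<lambda>i :: nat. to_nat (t, i)))"
    by (simp add: finite_image_iff)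
  then obtain i where "m \<le> to_nat (t, i :: nat)"
    unfolding infinite_nat_iff_unbounded_le by blast
  then show ?thesis
    by (intro exI[of _ "to_nat (t, i)"]) (simp add: skolem_task_def)
qed

text \<open>Variables below \<open>N\<close> keep prescribed values. Each later stage
  \<open>j\<close> sets the variable \<open>j\<close> in both sorts for the same task, so one list
  of tasks serves both sorts.\<close>

definition skolem_step :: "('f::countable, 'm, 'w) two_sorted \<Rightarrow> nat \<Rightarrow> nat \<Rightarrow>
    (nat \<Rightarrow> 'm) \<times> (nat \<Rightarrow> 'w) \<Rightarrow> (nat \<Rightarrow> 'm) \<times> (nat \<Rightarrow> 'w)" where
  "skolem_step S N j = (\<lambda>(e, f). case skolem_task j of (v, \<phi>) \<Rightarrow>
     if j < N then (e, f)
     else (e(j := SOME a. sat S (e(v := a)) f \<phi>), f(j := SOME x. sat S e (f(v := x)) \<phi>)))"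

primrec skolem :: "('f::countable, 'm, 'w) two_sorted \<Rightarrow> nat \<Rightarrow>
    (nat \<Rightarrow> 'm) \<times> (nat \<Rightarrow> 'w) \<Rightarrow> nat \<Rightarrow> (nat \<Rightarrow> 'm) \<times> (nat \<Rightarrow> 'w)" where
  "skolem S N ef 0 = ef"
| "skolem S N ef (Suc j) = skolem_step S N j (skolem S N ef j)"

lemma skolem_below: "m \<le> N \<Longrightarrow> skolem S N ef m = ef"
  by (induction m) (auto simp: skolem_step_def split: prod.splits)

lemma skolem_stable:
  assumes "i < m"
  shows "fst (skolem S N ef m) i = fst (skolem S N ef (Suc i)) i"
    and "snd (skolem S N ef m) i = snd (skolem S N ef (Suc i)) i"
  using Suc_leI[OF assms]
  by (induction m rule: dec_induct) (auto simp: skolem_step_def split: prod.splits)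

locale countable_structure = full_structure S for S :: "('f::countable, 'm, 'w) two_sorted"
begin

text \<open>Witnesses are added in each coordinate separately, hence in all coordinates and not only
  almost everywhere. The first \<open>N\<close> variables retain the given tuples, so the model
  realizes their limit type.\<close>

lemma skolem_expansion:
  assumes "nonprincipal_ultrafilter U"
  obtains E F where "henkin S E F U" "\<And>n i. i < N \<Longrightarrow> E n i = a n i" "\<And>n i. i < N \<Longrightarrow> F n i = b n i"
proof -
  define G where "G n = skolem S N (a n, b n)" for n
  define E where "E n i = fst (G n (Suc i)) i" for n i
  define F where "F n i = snd (G n (Suc i)) i" for n i
  have E: "fst (G n m) i = E n i" and F: "snd (G n m) i = F n i" if "i < m" for n m i
    using skolem_stable[OF that] by (simp_all add: G_def E_def F_def)
  have *: "((\<exists>a. sat S ((E n)(v := a)) (F n) \<phi>) \<longrightarrow> sat S ((E n)(v := E n j)) (F n) \<phi>) \<and>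
      ((\<exists>x. sat S (E n) ((F n)(v := x)) \<phi>) \<longrightarrow> sat S (E n) ((F n)(v := F n j)) \<phi>)"
    if j: "skolem_task j = (v, \<phi>)" "j \<ge> N" "free_mvars \<phi> \<subseteq> {..<j}" "free_wvars \<phi> \<subseteq> {..<j}" for n v \<phi> j
  proof -
    obtain e f where ef: "G n j = (e, f)" by fastforce
    have "G n (Suc j) = (e(j := SOME a. sat S (e(v := a)) f \<phi>), f(j := SOME x. sat S e (f(v := x)) \<phi>))"
      using ef j(1,2) by (simp add: G_def skolem_step_def)
    then have Ej: "E n j = (SOME a. sat S (e(v := a)) f \<phi>)" and Fj: "F n j = (SOME x. sat S e (f(v := x)) \<phi>)"
      by (simp_all add: E_def F_def)
    have "e i = E n i" "f i = F n i" if "i < j" for i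
      using E[OF that, of n] F[OF that, of n] by (simp_all add: ef)
    then have "sat S ((E n)(v := a)) (F n) \<phi> = sat S (e(v := a)) f \<phi>"
      "sat S (E n) ((F n)(v := x)) \<phi> = sat S e (f(v := x)) \<phi>" for a x
      using j(3,4) by (auto intro!: sat_cong)
    then show ?thesis
      unfolding Ej Fj by (auto intro: someI)
  qed
  \<comment> \<open>Beyond all free variables of \<open>\<phi>\<close>, the assignment at stage
    \<open>j\<close> already agrees with the final one wherever \<open>\<phi>\<close> looks.\<close>
  have task: "\<exists>j\<ge>N. skolem_task j = (v, \<phi>) \<and> free_mvars \<phi> \<subseteq> {..<j} \<and> free_wvars \<phi> \<subseteq> {..<j}"
    for v and \<phi> :: "'f form"
  proof -
    obtain K where K: "free_mvars \<phi> \<union> free_wvars \<phi> \<subseteq> {..<K}"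
      using finite_nat_iff_bounded[of "free_mvars \<phi> \<union> free_wvars \<phi>"] by auto
    obtain j where "max N K \<le> j" "skolem_task j = (v, \<phi>)"
      using skolem_task_unbounded by blast
    with K show ?thesis by (intro exI[of _ j]) auto
  qed
  have "henkin S E F U"
  proof
    fix \<phi> :: "'f form" and v
    obtain j where j: "skolem_task j = (v, \<phi>)" "j \<ge> N" "free_mvars \<phi> \<subseteq> {..<j}" "free_wvars \<phi> \<subseteq> {..<j}"
      using task by blast
    show "\<exists>j. eventually (\<lambda>n. sat S ((E n)(v := E n j)) (F n) \<phi>) U"
      if "eventually (\<lambda>n. \<exists>a. sat S ((E n)(v := a)) (F n) \<phi>) U"
      using that by (intro exI[of _ j], elim eventually_mono) (use *[OF j] in blast)
    show "\<exists>j. eventually (\<lambda>n. sat S (E n) ((F n)(v := F n j)) \<phi>) U"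
      if "eventually (\<lambda>n. \<exists>x. sat S (E n) ((F n)(v := x)) \<phi>) U"
      using that by (intro exI[of _ j], elim eventually_mono) (use *[OF j] in blast)
  qed (fact assms)
  moreover have "E n i = a n i" "F n i = b n i" if "i < N" for n i
    using skolem_below[of "Suc i" N S "(a n, b n)"] that by (simp_all add: E_def F_def G_def del: skolem.simps)
  ultimately show thesis using that by blast
qed

section \<open>Omitting types by a decreasing sequence of finite satisfiable conditions\<close>

definition condition :: "((nat \<Rightarrow> 'm) \<Rightarrow> (nat \<Rightarrow> 'w) \<Rightarrow> bool) \<Rightarrow> bool" where
  "condition C \<longleftrightarrow> (\<exists>V U. finite V \<and> finite U \<and> fo V U C) \<and> (\<exists>e f. C e f)"

text \<open>Either the condition already excludes every witness, and is kept, or it is strengthened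
  by declaring a fresh variable to be a witness.\<close>

lemma condition_witness_M:
  assumes "condition C"
  shows "\<exists>C'. condition C' \<and> (\<forall>e f. C' e f \<longrightarrow> C e f) \<and>
    ((\<forall>e f. C' e f \<longrightarrow> \<not> (\<exists>a. sat S (e(v := a)) f \<phi>)) \<or> (\<exists>j. \<forall>e f. C' e f \<longrightarrow> sat S (e(v := e j)) f \<phi>))"
proof (cases "\<exists>e f a. C e f \<and> sat S (e(v := a)) f \<phi>")
  case False
  then show ?thesis using assms by blast
next
  case True
  then obtain e f a where ef: "C e f" "sat S (e(v := a)) f \<phi>" by blast
  obtain V U where VU: "finite V" "finite U" "fo V U C"
    using assms unfolding condition_def by blast
  \<comment> \<open>Freshness allows the value at \<open>j\<close> to be replaced by the witness
    \<open>a\<close> without changing \<open>C\<close> or the rest of \<open>\<phi>\<close>.\<close>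
  obtain j where j: "j \<notin> V \<union> free_mvars \<phi> \<union> {v}"
    using ex_new_if_finite[OF infinite_UNIV_nat, of "V \<union> free_mvars \<phi> \<union> {v}"] VU(1) by auto
  let ?C = "\<lambda>e f. C e f \<and> sat S (e \<circ> id(v := j)) (f \<circ> id) \<phi>"
  have "fo (V \<union> (id(v := j)) ` free_mvars \<phi>) (U \<union> id ` free_wvars \<phi>) ?C"
    by (intro fo_conj fo_mono[OF VU(3)] fo_mono[OF fo_rename[OF _ _ fo_sat]]) auto
  moreover have "?C (e(j := a)) f"
  proof -
    have "C (e(j := a)) f = C e f"
      using j by (intro fo_cong[OF VU(3)]) auto
    moreover have "sat S (e(j := a) \<circ> id(v := j)) (f \<circ> id) \<phi> = sat S (e(v := a)) f \<phi>"
      using j by (intro sat_cong) auto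
    ultimately show ?thesis using ef by simp
  qed
  ultimately have "condition ?C"
    unfolding condition_def using VU by (intro conjI exI) auto
  moreover have "e \<circ> id(v := j) = e(v := e j)" for e :: "nat \<Rightarrow> 'm" by auto
  ultimately show ?thesis by (intro exI[of _ ?C]) auto
qed

lemma condition_witness_W:
  assumes "condition C"
  shows "\<exists>C'. condition C' \<and> (\<forall>e f. C' e f \<longrightarrow> C e f) \<and>
    ((\<forall>e f. C' e f \<longrightarrow> \<not> (\<exists>x. sat S e (f(v := x)) \<phi>)) \<or> (\<exists>j. \<forall>e f. C' e f \<longrightarrow> sat S e (f(v := f j)) \<phi>))"
proof (cases "\<exists>e f a. C e f \<and> sat S e (f(v := a)) \<phi>")
  case False
  then show ?thesis using assms by blast
next
  case True
  then obtain e f a where ef: "C e f" "sat S e (f(v := a)) \<phi>" by blast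
  obtain V U where VU: "finite V" "finite U" "fo V U C"
    using assms unfolding condition_def by blast
  obtain j where j: "j \<notin> U \<union> free_wvars \<phi> \<union> {v}"
    using ex_new_if_finite[OF infinite_UNIV_nat, of "U \<union> free_wvars \<phi> \<union> {v}"] VU(2) by auto
  let ?C = "\<lambda>e f. C e f \<and> sat S (e \<circ> id) (f \<circ> id(v := j)) \<phi>"
  have "fo (V \<union> id ` free_mvars \<phi>) (U \<union> (id(v := j)) ` free_wvars \<phi>) ?C"
    by (intro fo_conj fo_mono[OF VU(3)] fo_mono[OF fo_rename[OF _ _ fo_sat]]) auto
  moreover have "?C e (f(j := a))"
  proof -
    have "C e (f(j := a)) = C e f"
      using j by (intro fo_cong[OF VU(3)]) auto
    moreover have "sat S (e \<circ> id) (f(j := a) \<circ> id(v := j)) \<phi> = sat S e (f(v := a)) \<phi>"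
      using j by (intro sat_cong) auto
    ultimately show ?thesis using ef by simp
  qed
  ultimately have "condition ?C"
    unfolding condition_def using VU by (intro conjI exI) auto
  moreover have "f \<circ> id(v := j) = f(v := f j)" for f :: "nat \<Rightarrow> 'w" by auto
  ultimately show ?thesis by (intro exI[of _ ?C]) auto
qed

text \<open>What \<open>C\<close> says about the tuple named by \<open>\<tau>\<close> and
  \<open>\<sigma>\<close>, as a relation in the first \<open>N\<close> variables, to which
  nonisolation applies. The variables of \<open>C\<close> are shifted by \<open>N\<close> out of the
  way and quantified.\<close>

lemma fo_projection:
  assumes "finite V" "finite U" "fo V U C"
  shows "fo {..<N} {..<N} (\<lambda>e f. \<exists>e' f'. C e' f' \<and> (\<forall>i<N. e i = e' (\<tau> i) \<and> f i = f' (\<sigma> i)))"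
proof -
  define V' where "V' = V \<union> \<tau> ` {..<N}"
  define U' where "U' = U \<union> \<sigma> ` {..<N}"
  have fin: "finite V'" "finite U'" and C: "fo V' U' C"
    using assms by (auto simp: V'_def U'_def intro: fo_mono)
  let ?\<pi> = "(+) N"
  define R where "R e f \<longleftrightarrow> C (e \<circ> ?\<pi>) (f \<circ> ?\<pi>) \<and>
      (\<forall>i\<in>{..<N}. e i = e (N + \<tau> i) \<and> f i = f (N + \<sigma> i))" for e f
  have "fo ({..<N} \<union> ?\<pi> ` V') ({..<N} \<union> ?\<pi> ` U') R"
    unfolding R_def
    by (intro fo_conj fo_mono[OF fo_rename[OF fin C]] fo_Ball fo_mvar_eq fo_wvar_eq)
      (auto simp: V'_def U'_def)
  from fo_WExs[OF finite_imageI[OF fin(2)] fo_MExs[OF finite_imageI[OF fin(1)] this]]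
  have Q: "fo ({..<N} \<union> ?\<pi> ` V' - ?\<pi> ` V') ({..<N} \<union> ?\<pi> ` U' - ?\<pi> ` U')
      (\<lambda>e f. \<exists>h g. R (\<lambda>i. if i \<in> ?\<pi> ` V' then g i else e i) (\<lambda>j. if j \<in> ?\<pi> ` U' then h j else f j))" .
  have iff: "(\<exists>h g. R (\<lambda>i. if i \<in> ?\<pi> ` V' then g i else e i) (\<lambda>j. if j \<in> ?\<pi> ` U' then h j else f j)) \<longleftrightarrow>
      (\<exists>e' f'. C e' f' \<and> (\<forall>i<N. e i = e' (\<tau> i) \<and> f i = f' (\<sigma> i)))" for e f
  proof
    assume "\<exists>h g. R (\<lambda>i. if i \<in> ?\<pi> ` V' then g i else e i) (\<lambda>j. if j \<in> ?\<pi> ` U' then h j else f j)"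
    then obtain h g where R: "R (\<lambda>i. if i \<in> ?\<pi> ` V' then g i else e i) (\<lambda>j. if j \<in> ?\<pi> ` U' then h j else f j)"
      by blast
    let ?e = "(\<lambda>i. if i \<in> ?\<pi> ` V' then g i else e i) \<circ> ?\<pi>"
    let ?f = "(\<lambda>j. if j \<in> ?\<pi> ` U' then h j else f j) \<circ> ?\<pi>"
    have "C ?e ?f"
      by (rule conjunct1[OF R[unfolded R_def]])
    moreover have "e i = ?e (\<tau> i) \<and> f i = ?f (\<sigma> i)" if "i < N" for i
    proof -
      have "i \<notin> ?\<pi> ` V'" "i \<notin> ?\<pi> ` U'" using that by auto
      then show ?thesis
        using bspec[OF conjunct2[OF R[unfolded R_def]], of i] that by (simp only: comp_apply lessThan_iff if_False)
    qed
    ultimately show "\<exists>e' f'. C e' f' \<and> (\<forall>i<N. e i = e' (\<tau> i) \<and> f i = f' (\<sigma> i))" by blast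
  next
    assume "\<exists>e' f'. C e' f' \<and> (\<forall>i<N. e i = e' (\<tau> i) \<and> f i = f' (\<sigma> i))"
    then obtain e' f' where e': "C e' f'" "\<And>i. i < N \<Longrightarrow> e i = e' (\<tau> i) \<and> f i = f' (\<sigma> i)" by blast
    let ?g = "\<lambda>i. e' (i - N)" and ?h = "\<lambda>i. f' (i - N)"
    have "C ((\<lambda>i. if i \<in> ?\<pi> ` V' then ?g i else e i) \<circ> ?\<pi>) ((\<lambda>j. if j \<in> ?\<pi> ` U' then ?h j else f j) \<circ> ?\<pi>) = C e' f'"
      by (intro fo_cong[OF C]) auto
    then have "R (\<lambda>i. if i \<in> ?\<pi> ` V' then ?g i else e i) (\<lambda>j. if j \<in> ?\<pi> ` U' then ?h j else f j)"
      using e' unfolding R_def by (auto simp: V'_def U'_def)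
    then show "\<exists>h g. R (\<lambda>i. if i \<in> ?\<pi> ` V' then g i else e i) (\<lambda>j. if j \<in> ?\<pi> ` U' then h j else f j)"
      by (intro exI[of _ ?h] exI[of _ ?g])
  qed
  show ?thesis
    by (rule fo_mono[OF Q[unfolded iff]]) auto
qed

text \<open>The projection of \<open>C\<close> to the tuple does not imply \<open>P\<close>: it
  contains a tuple at which some \<open>\<theta>\<close> of \<open>P\<close> fails. This tuple lifts
  to a solution of \<open>C\<close>, so \<open>C\<close> together with the negation of
  \<open>\<theta>\<close> is a condition.\<close>

lemma condition_omit:
  assumes "condition C"
    and P: "\<And>\<theta>. \<theta> \<in> P \<Longrightarrow> free_mvars \<theta> \<subseteq> {..<N} \<and> free_wvars \<theta> \<subseteq> {..<N}"
    and nonisolated: "\<And>R. fo {..<N} {..<N} R \<Longrightarrow> \<exists>e f. R e f \<Longrightarrow> \<exists>\<theta>\<in>P. \<exists>e f. R e f \<and> \<not> sat S e f \<theta>"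
  shows "\<exists>C'. condition C' \<and> (\<forall>e f. C' e f \<longrightarrow> C e f) \<and>
    (\<exists>\<theta>\<in>P. \<forall>e f. C' e f \<longrightarrow> \<not> sat S (e \<circ> \<tau>) (f \<circ> \<sigma>) \<theta>)"
proof -
  obtain V U where VU: "finite V" "finite U" "fo V U C" and ne: "\<exists>e f. C e f"
    using assms(1) unfolding condition_def by blast
  obtain e0 f0 where "C e0 f0" using ne by blast
  then have "\<exists>e f. \<exists>e' f'. C e' f' \<and> (\<forall>i<N. e i = e' (\<tau> i) \<and> f i = f' (\<sigma> i))"
    by (intro exI[of _ "e0 \<circ> \<tau>"] exI[of _ "f0 \<circ> \<sigma>"] exI[of _ e0] exI[of _ f0]) auto
  from nonisolated[OF fo_projection[OF VU] this]
  obtain \<theta> e f e' f' where \<theta>: "\<theta> \<in> P" "\<not> sat S e f \<theta>" "C e' f'"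
    "\<forall>i<N. e i = e' (\<tau> i) \<and> f i = f' (\<sigma> i)" by blast
  let ?C = "\<lambda>e f. C e f \<and> \<not> sat S (e \<circ> \<tau>) (f \<circ> \<sigma>) \<theta>"
  have "sat S (e' \<circ> \<tau>) (f' \<circ> \<sigma>) \<theta> = sat S e f \<theta>"
    using P[OF \<theta>(1)] \<theta>(4) by (intro sat_cong) auto
  then have "\<exists>e f. ?C e f" using \<theta> by blast
  moreover have "fo (V \<union> \<tau> ` free_mvars \<theta>) (U \<union> \<sigma> ` free_wvars \<theta>) ?C"
    by (intro fo_conj fo_not fo_mono[OF VU(3)] fo_mono[OF fo_rename[OF _ _ fo_sat]]) auto
  ultimately have "condition ?C"
    unfolding condition_def using VU by (intro conjI exI[of _ "_ :: nat set"]) auto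
  with \<theta>(1) show ?thesis by (intro exI[of _ ?C]) blast
qed

text \<open>The \<open>n\<close>-th coordinate is any solution of the \<open>n\<close>-th condition.
  Each condition then holds in all later coordinates, so what it forces holds along
  \<open>U\<close>.\<close>

lemma omitting_types:
  assumes U: "nonprincipal_ultrafilter U"
    and P: "\<And>\<theta>. \<theta> \<in> P \<Longrightarrow> free_mvars \<theta> \<subseteq> {..<N} \<and> free_wvars \<theta> \<subseteq> {..<N}"
    and nonisolated: "\<And>R. fo {..<N} {..<N} R \<Longrightarrow> \<exists>e f. R e f \<Longrightarrow> \<exists>\<theta>\<in>P. \<exists>e f. R e f \<and> \<not> sat S e f \<theta>"
  obtains E F where "henkin S E F U"
    "\<And>\<tau> \<sigma>. \<exists>\<theta>\<in>P. eventually (\<lambda>n. \<not> sat S (E n \<circ> \<tau>) (F n \<circ> \<sigma>) \<theta>) U"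
proof -
  \<comment> \<open>A task contains a variable and a formula, to be witnessed in both sorts, and two
    lists that name a tuple at which \<open>P\<close> must fail.\<close>
  define task :: "nat \<Rightarrow> nat \<times> 'f form \<times> nat list \<times> nat list" where "task = from_nat"
  have task: "\<exists>n. task n = t" for t
    unfolding task_def by (metis from_nat_to_nat)
  define Q where "Q n C C' \<longleftrightarrow> (\<forall>e f. C' e f \<longrightarrow> C e f) \<and> (case task n of (v, \<phi>, l, l') \<Rightarrow>
      ((\<forall>e f. C' e f \<longrightarrow> \<not> (\<exists>a. sat S (e(v := a)) f \<phi>)) \<or> (\<exists>j. \<forall>e f. C' e f \<longrightarrow> sat S (e(v := e j)) f \<phi>)) \<and>
      ((\<forall>e f. C' e f \<longrightarrow> \<not> (\<exists>x. sat S e (f(v := x)) \<phi>)) \<or> (\<exists>j. \<forall>e f. C' e f \<longrightarrow> sat S e (f(v := f j)) \<phi>)) \<and>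
      (\<exists>\<theta>\<in>P. \<forall>e f. C' e f \<longrightarrow> \<not> sat S (e \<circ> (!) l) (f \<circ> (!) l') \<theta>))" for n C C'
  have "\<exists>C. \<forall>n. condition (C n) \<and> Q n (C n) (C (Suc n))"
  proof (rule dependent_nat_choice)
    have "condition (\<lambda>e f. True)"
      using fo_True unfolding condition_def by blast
    then show "\<exists>C. condition C" by (rule exI[of condition])
  next
    fix C n assume C: "condition C"
    obtain v \<phi> l l' where t: "task n = (v, \<phi>, l, l')" by (metis prod_cases4)
    obtain C1 where C1: "condition C1" "\<forall>e f. C1 e f \<longrightarrow> C e f"
      "(\<forall>e f. C1 e f \<longrightarrow> \<not> (\<exists>a. sat S (e(v := a)) f \<phi>)) \<or> (\<exists>j. \<forall>e f. C1 e f \<longrightarrow> sat S (e(v := e j)) f \<phi>)"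
      using condition_witness_M[OF C] by metis
    obtain C2 where C2: "condition C2" "\<forall>e f. C2 e f \<longrightarrow> C1 e f"
      "(\<forall>e f. C2 e f \<longrightarrow> \<not> (\<exists>x. sat S e (f(v := x)) \<phi>)) \<or> (\<exists>j. \<forall>e f. C2 e f \<longrightarrow> sat S e (f(v := f j)) \<phi>)"
      using condition_witness_W[OF C1(1)] by metis
    obtain C3 where C3: "condition C3" "\<forall>e f. C3 e f \<longrightarrow> C2 e f"
      "\<exists>\<theta>\<in>P. \<forall>e f. C3 e f \<longrightarrow> \<not> sat S (e \<circ> (!) l) (f \<circ> (!) l') \<theta>"
      using condition_omit[OF C2(1) P nonisolated] by metis
    have "Q n C C3"
      unfolding Q_def t prod.case
    proof (intro conjI)
      show "\<forall>e f. C3 e f \<longrightarrow> C e f" using C1(2) C2(2) C3(2) by blast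
      show "(\<forall>e f. C3 e f \<longrightarrow> \<not> (\<exists>a. sat S (e(v := a)) f \<phi>)) \<or> (\<exists>j. \<forall>e f. C3 e f \<longrightarrow> sat S (e(v := e j)) f \<phi>)"
        using C1(3) C2(2) C3(2) by meson
      show "(\<forall>e f. C3 e f \<longrightarrow> \<not> (\<exists>x. sat S e (f(v := x)) \<phi>)) \<or> (\<exists>j. \<forall>e f. C3 e f \<longrightarrow> sat S e (f(v := f j)) \<phi>)"
        using C2(3) C3(2) by meson
    qed (fact C3(3))
    with C3(1) show "\<exists>C'. condition C' \<and> Q n C C'" by blast
  qed
  then obtain C where C: "\<And>n. condition (C n)" "\<And>n. Q n (C n) (C (Suc n))" by blast
  have "\<forall>n. \<exists>e f. C n e f" using C(1) unfolding condition_def by blast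
  then obtain E F where EF: "\<And>n. C n (E n) (F n)" by metis
  have C_mono: "C m e f" if "C n e f" "m \<le> n" for m n e f
    using that(2,1) by (induction n rule: dec_induct) (use C(2) in \<open>auto simp: Q_def\<close>)
  have ev: "eventually (\<lambda>n. C m (E n) (F n)) U" for m
  proof -
    have "eventually (\<lambda>n. m \<le> n) U"
      using U eventually_ge_at_top[of m] unfolding nonprincipal_ultrafilter_def le_filter_def by blast
    then show ?thesis by (rule eventually_mono) (use C_mono EF in blast)
  qed
  have proper: "\<not> (eventually R U \<and> eventually (\<lambda>n. \<not> R n) U)" for R
    using U by (auto simp: nonprincipal_ultrafilter_def trivial_limit_def
      eventually_conj_iff[symmetric] simp del: eventually_conj_iff)
  have "henkin S E F U"
  proof
    fix \<phi> :: "'f form" and v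
    obtain n where n: "task n = (v, \<phi>, [], [])" using task by blast
    note q = C(2)[of n, unfolded Q_def n prod.case]
    show "\<exists>j. eventually (\<lambda>n. sat S ((E n)(v := E n j)) (F n) \<phi>) U"
      if *: "eventually (\<lambda>n. \<exists>a. sat S ((E n)(v := a)) (F n) \<phi>) U"
    proof -
      have "\<not> (\<forall>e f. C (Suc n) e f \<longrightarrow> \<not> (\<exists>a. sat S (e(v := a)) f \<phi>))"
      proof
        assume "\<forall>e f. C (Suc n) e f \<longrightarrow> \<not> (\<exists>a. sat S (e(v := a)) f \<phi>)"
        with ev[of "Suc n"] have "eventually (\<lambda>n. \<not> (\<exists>a. sat S ((E n)(v := a)) (F n) \<phi>)) U"
          by (auto elim: eventually_mono)
        with * proper show False by blast
      qed
      then obtain j where j: "\<forall>e f. C (Suc n) e f \<longrightarrow> sat S (e(v := e j)) f \<phi>" using q by blast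
      show ?thesis
        by (intro exI[of _ j] eventually_mono[OF ev[of "Suc n"]]) (use j in blast)
    qed
    show "\<exists>j. eventually (\<lambda>n. sat S (E n) ((F n)(v := F n j)) \<phi>) U"
      if *: "eventually (\<lambda>n. \<exists>x. sat S (E n) ((F n)(v := x)) \<phi>) U"
    proof -
      have "\<not> (\<forall>e f. C (Suc n) e f \<longrightarrow> \<not> (\<exists>x. sat S e (f(v := x)) \<phi>))"
      proof
        assume "\<forall>e f. C (Suc n) e f \<longrightarrow> \<not> (\<exists>x. sat S e (f(v := x)) \<phi>)"
        with ev[of "Suc n"] have "eventually (\<lambda>n. \<not> (\<exists>x. sat S (E n) ((F n)(v := x)) \<phi>)) U"
          by (auto elim: eventually_mono)
        with * proper show False by blast
      qed
      then obtain j where j: "\<forall>e f. C (Suc n) e f \<longrightarrow> sat S e (f(v := f j)) \<phi>" using q by blast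
      show ?thesis
        by (intro exI[of _ j] eventually_mono[OF ev[of "Suc n"]]) (use j in blast)
    qed
  qed (fact U)
  moreover have "\<exists>\<theta>\<in>P. eventually (\<lambda>n. \<not> sat S (E n \<circ> \<tau>) (F n \<circ> \<sigma>) \<theta>) U" for \<tau> \<sigma>
  proof -
    \<comment> \<open>Formulas of \<open>P\<close> read only the first \<open>N\<close> places, so
      finite lists represent \<open>\<tau>\<close> and \<open>\<sigma>\<close>; this keeps the tasks
      countable.\<close>
    let ?l = "map \<tau> [0..<N]" and ?l' = "map \<sigma> [0..<N]"
    obtain n where n: "task n = (0, MEq MZero MZero, ?l, ?l')" using task by blast
    obtain \<theta> where \<theta>: "\<theta> \<in> P" "\<forall>e f. C (Suc n) e f \<longrightarrow> \<not> sat S (e \<circ> (!) ?l) (f \<circ> (!) ?l') \<theta>"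
      using C(2)[of n, unfolded Q_def n prod.case] by blast
    have "sat S (e \<circ> (!) ?l) (f \<circ> (!) ?l') \<theta> = sat S (e \<circ> \<tau>) (f \<circ> \<sigma>) \<theta>" for e f
      using P[OF \<theta>(1)] by (intro sat_cong) auto
    with \<theta> have "eventually (\<lambda>n. \<not> sat S (E n \<circ> \<tau>) (F n \<circ> \<sigma>) \<theta>) U"
      by (intro eventually_mono[OF ev[of "Suc n"]]) metis
    with \<theta>(1) show ?thesis by blast
  qed
  ultimately show thesis using that by blast
qed

text \<open>The case of \<open>finite_union_fo\<close> in which categoricity, which concerns
  infinite models, gives nothing: a relation is determined by its trace on the finitely many
  assignments to \<open>V\<close> and \<open>U\<close>.\<close>

lemma finite_fo:
  assumes "finite (UNIV :: 'm set)" "finite (UNIV :: 'w set)" "finite V" "finite U"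
  shows "finite {R. fo V U R}"
proof -
  let ?X = "PiE V (\<lambda>_. UNIV :: 'm set) \<times> PiE U (\<lambda>_. UNIV :: 'w set)"
  let ?F = "\<lambda>R. {(e, f) \<in> ?X. R e f}"
  have "inj_on ?F {R. fo V U R}"
  proof (rule inj_onI)
    fix R R' assume R: "R \<in> {R. fo V U R}" "R' \<in> {R. fo V U R}" and eq: "?F R = ?F R'"
    have "R e f = R' e f" for e f
    proof -
      have X: "(restrict e V, restrict f U) \<in> ?X" by auto
      have "R e f = R (restrict e V) (restrict f U)"
        using R(1) by (intro fo_cong[of V U R]) auto
      also have "\<dots> = R' (restrict e V) (restrict f U)"
      proof -
        have "(restrict e V, restrict f U) \<in> ?F R \<longleftrightarrow> (restrict e V, restrict f U) \<in> ?F R'"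
          by (simp only: eq)
        with X show ?thesis by simp
      qed
      also have "\<dots> = R' e f"
        using R(2) by (intro fo_cong[of V U R']) auto
      finally show ?thesis .
    qed
    then show "R = R'" by blast
  qed
  moreover have "finite (?F ` {R. fo V U R})"
  proof (rule finite_subset)
    show "?F ` {R. fo V U R} \<subseteq> Pow ?X" by blast
    show "finite (Pow ?X)" using assms by (auto intro!: finite_PiE)
  qed
  ultimately show ?thesis by (rule finite_imageD[rotated])
qed

text \<open>If no finite subset of \<open>\<R>\<close> had the same union as \<open>\<R>\<close>, assignments that avoid more and more
  members of \<open>\<R>\<close> would have a limit type along an ultrafilter which is not isolated. One countable
  model of the theory realizes it and another one omits it.\<close>

theorem finite_union_fo:
  assumes cat: "aleph0_categorical (theory_of S)"
    and "finite V" "finite U" "\<And>R. R \<in> \<R> \<Longrightarrow> fo V U R"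
  obtains \<R>\<^sub>0 where "\<R>\<^sub>0 \<subseteq> \<R>" "finite \<R>\<^sub>0" "\<And>R e f. R \<in> \<R> \<Longrightarrow> R e f \<Longrightarrow> \<exists>R\<in>\<R>\<^sub>0. R e f"
proof (cases "finite (UNIV :: 'm set) \<and> finite (UNIV :: 'w set)")
  case True
  then have "finite \<R>"
    using finite_fo[of V U] assms(2-4) by (auto elim: rev_finite_subset)
  with that[of \<R>] show thesis by blast
next
  case inf: False
  have "\<exists>\<R>\<^sub>0\<subseteq>\<R>. finite \<R>\<^sub>0 \<and> (\<forall>R e f. R \<in> \<R> \<longrightarrow> R e f \<longrightarrow> (\<exists>R\<in>\<R>\<^sub>0. R e f))"
  proof (rule ccontr)
    assume none: "\<nexists>\<R>\<^sub>0. \<R>\<^sub>0 \<subseteq> \<R> \<and> finite \<R>\<^sub>0 \<and> (\<forall>R e f. R \<in> \<R> \<longrightarrow> R e f \<longrightarrow> (\<exists>R\<in>\<R>\<^sub>0. R e f))"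
    have "\<R> \<subseteq> range (\<lambda>\<phi> e f. sat S e f \<phi>)"
      using assms(4) unfolding fo_def by blast
    then have "countable \<R>" by (rule countable_subset) auto
    moreover have "\<R> \<noteq> {}" using none by blast
    ultimately have range: "range (from_nat_into \<R>) = \<R>"
      by (simp add: range_from_nat_into)
    define D where "D = from_nat_into \<R>"
    have D: "\<And>s. D s \<in> \<R>" "\<And>R. R \<in> \<R> \<Longrightarrow> \<exists>s. R = D s" using range unfolding D_def by blast+
    \<comment> \<open>The first \<open>n\<close> relations do not cover the union, so some
      assignment in the union avoids them all.\<close>
    have "\<exists>e f. (\<exists>s. D s e f) \<and> (\<forall>t<n. \<not> D t e f)" for n
    proof -
      have "D ` {..<n} \<subseteq> \<R>" "finite (D ` {..<n})" using D(1) by auto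
      with none have "\<not> (\<forall>R e f. R \<in> \<R> \<longrightarrow> R e f \<longrightarrow> (\<exists>R\<in>D ` {..<n}. R e f))"
        by blast
      then obtain R e f where "R \<in> \<R>" "R e f" "\<not> (\<exists>R\<in>D ` {..<n}. R e f)"
        by blast
      with D(2)[of R] show ?thesis
        by (intro exI[of _ e] exI[of _ f]) auto
    qed
    then obtain a b where ab: "\<And>n. \<exists>s. D s (a n) (b n)" "\<And>n t. t < n \<Longrightarrow> \<not> D t (a n) (b n)"
      by metis
    obtain N where N: "V \<subseteq> {..<N}" "U \<subseteq> {..<N}"
      using finite_nat_iff_bounded[of "V \<union> U"] assms(2,3) by auto
    obtain \<U> where \<U>: "nonprincipal_ultrafilter \<U>" using nonprincipal_ultrafilter_exists ..
    \<comment> \<open>The limit type of the assignments \<open>a n\<close>, \<open>b n\<close> along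
      \<open>\<U>\<close>.\<close>
    define P where "P = {\<phi>. free_mvars \<phi> \<subseteq> {..<N} \<and> free_wvars \<phi> \<subseteq> {..<N} \<and>
        eventually (\<lambda>n. sat S (a n) (b n) \<phi>) \<U>}"
    have in_P: "\<exists>\<theta>\<in>P. \<forall>e f. sat S e f \<theta> = R e f"
      if R: "fo {..<N} {..<N} R" "eventually (\<lambda>n. R (a n) (b n)) \<U>" for R
    proof -
      obtain \<phi> where \<phi>: "free_mvars \<phi> \<subseteq> {..<N}" "free_wvars \<phi> \<subseteq> {..<N}" "\<And>e f. R e f = sat S e f \<phi>"
        using foE[OF R(1)] by metis
      with R(2) have "\<phi> \<in> P" by (simp add: P_def)
      with \<phi>(3) show ?thesis by blast
    qed
    \<comment> \<open>If \<open>R\<close> belongs to the limit type, it holds at some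
      \<open>a n\<close>, \<open>b n\<close>, which lies in some \<open>D s\<close>; but the
      negation of \<open>D s\<close> belongs to \<open>P\<close>, as all later assignments avoid
      \<open>D s\<close>. Otherwise the negation of \<open>R\<close> belongs to
      \<open>P\<close>.\<close>
    have nonisolated: "\<exists>\<theta>\<in>P. \<exists>e f. R e f \<and> \<not> sat S e f \<theta>"
      if R: "fo {..<N} {..<N} R" "\<exists>e f. R e f" for R
    proof (cases "eventually (\<lambda>n. R (a n) (b n)) \<U>")
      case True
      then obtain n where n: "R (a n) (b n)"
        using \<U> eventually_happens unfolding nonprincipal_ultrafilter_def by blast
      obtain s where s: "D s (a n) (b n)" using ab(1) by blast
      have "fo {..<N} {..<N} (\<lambda>e f. \<not> D s e f)"
        using N by (intro fo_not fo_mono[OF assms(4)[OF D(1)]])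
      moreover have "eventually (\<lambda>n. \<not> D s (a n) (b n)) \<U>"
      proof -
        have "eventually (\<lambda>n. s < n) \<U>"
          using \<U> eventually_gt_at_top[of s] unfolding nonprincipal_ultrafilter_def le_filter_def by blast
        then show ?thesis by (rule eventually_mono) (rule ab(2))
      qed
      ultimately obtain \<theta> where "\<theta> \<in> P" "\<forall>e f. sat S e f \<theta> = (\<not> D s e f)"
        using in_P[of "\<lambda>e f. \<not> D s e f"] by blast
      with n s have "R (a n) (b n) \<and> \<not> sat S (a n) (b n) \<theta>" by blast
      with \<open>\<theta> \<in> P\<close> show ?thesis by blast
    next
      case False
      then have "eventually (\<lambda>n. \<not> R (a n) (b n)) \<U>"
        using \<U> unfolding nonprincipal_ultrafilter_def by blast
      then obtain \<theta> where "\<theta> \<in> P" "\<forall>e f. sat S e f \<theta> = (\<not> R e f)"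
        using in_P[OF fo_not[OF R(1)]] by blast
      with R(2) show ?thesis by blast
    qed
    obtain E F where EF: "henkin S E F \<U>"
      "\<And>\<tau> \<sigma>. \<exists>\<theta>\<in>P. eventually (\<lambda>n. \<not> sat S (E n \<circ> \<tau>) (F n \<circ> \<sigma>) \<theta>) \<U>"
      by (rule omitting_types[of \<U> P N, OF \<U> _ nonisolated]) (auto simp: P_def)
    obtain E' F' where EF': "henkin S E' F' \<U>"
      "\<And>n i. i < N \<Longrightarrow> E' n i = a n i" "\<And>n i. i < N \<Longrightarrow> F' n i = b n i"
      using skolem_expansion[OF \<U>, of N a b] by blast
    interpret A: henkin S E F \<U> by (fact EF(1))
    interpret B: henkin S E' F' \<U> by (fact EF'(1))
    have "isomorphic B.model A.model"
      using cat inf A.is_model_model B.is_model_model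
        A.infinite_mcarrier_model A.infinite_wcarrier_model B.infinite_mcarrier_model B.infinite_wcarrier_model
      unfolding aleph0_categorical_def by blast
    then obtain g h where gh: "\<And>x. x \<in> mcarrier B.model \<Longrightarrow> g x \<in> mcarrier A.model"
      "\<And>x. x \<in> wcarrier B.model \<Longrightarrow> h x \<in> wcarrier A.model"
      "\<And>e f \<phi>. (\<And>i. e i \<in> mcarrier B.model) \<Longrightarrow> (\<And>j. f j \<in> wcarrier B.model) \<Longrightarrow>
        sat B.model e f \<phi> = sat A.model (g \<circ> e) (h \<circ> f) \<phi>"
      using isomorphic_sat[OF _ B.is_structure_model] by metis
    \<comment> \<open>The isomorphism carries the tuple that realizes \<open>P\<close> in
      \<open>B.model\<close> to a tuple named by \<open>\<tau>\<close> and \<open>\<sigma>\<close>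
      in \<open>A.model\<close>, where every named tuple omits \<open>P\<close>.\<close>
    have "\<forall>i. \<exists>j. g (B.repM i) = A.repM j" "\<forall>i. \<exists>j. h (B.repW i) = A.repW j"
      using gh(1,2) unfolding A.mcarrier_model A.wcarrier_model B.mcarrier_model B.wcarrier_model by blast+
    then obtain \<tau> \<sigma> where "\<And>i. g (B.repM i) = A.repM (\<tau> i)" "\<And>i. h (B.repW i) = A.repW (\<sigma> i)"
      by metis
    then have \<tau>: "g \<circ> (B.repM \<circ> id) = A.repM \<circ> \<tau>" "h \<circ> (B.repW \<circ> id) = A.repW \<circ> \<sigma>" by auto
    obtain \<theta> where \<theta>: "\<theta> \<in> P" "eventually (\<lambda>n. \<not> sat S (E n \<circ> \<tau>) (F n \<circ> \<sigma>) \<theta>) \<U>"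
      using EF(2) by blast
    have "sat S (E' n \<circ> id) (F' n \<circ> id) \<theta> = sat S (a n) (b n) \<theta>" for n
      using \<theta>(1) EF'(2,3) by (intro sat_cong) (auto simp: P_def)
    then have "sat B.model (B.repM \<circ> id) (B.repW \<circ> id) \<theta>"
      using \<theta>(1) unfolding B.sat_model by (simp add: P_def)
    moreover have "sat B.model (B.repM \<circ> id) (B.repW \<circ> id) \<theta> = sat A.model (A.repM \<circ> \<tau>) (A.repW \<circ> \<sigma>) \<theta>"
      unfolding \<tau>[symmetric] by (rule gh(3)) (auto simp: B.mcarrier_model B.wcarrier_model)
    moreover have "\<not> sat A.model (A.repM \<circ> \<tau>) (A.repW \<circ> \<sigma>) \<theta>"
      using \<theta>(2) unfolding A.sat_model A.ae_not[symmetric] .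
    ultimately show False by blast
  qed
  with that show thesis by blast
qed

end

section \<open>Vector spaces over finite fields\<close>

locale finite_field_vector_space = vector_space scale
  for scale :: "'f::{field,finite} \<Rightarrow> 'b::ab_group_add \<Rightarrow> 'b" (infixr "*s" 75)
begin

lemma finite_span:
  assumes "finite A"
  shows "finite (span A)"
  using assms
proof (induction A rule: finite_induct)
  case (insert a A)
  have "span (insert a A) \<subseteq> (\<lambda>(c, y). c *s a + y) ` (UNIV \<times> span A)"
  proof
    fix x assume "x \<in> span (insert a A)"
    then obtain c where "x - c *s a \<in> span A" by (auto simp: span_insert)
    then show "x \<in> (\<lambda>(c, y). c *s a + y) ` (UNIV \<times> span A)"
      by (intro image_eqI[of _ _ "(c, x - c *s a)"]) auto
  qed
  then show ?case by (rule finite_subset) (auto simp: insert)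
qed simp

lemma card_span:
  assumes "finite B" "independent B"
  shows "card (span B) = CARD('f) ^ card B"
  using assms
proof (induction B rule: finite_induct)
  case (insert b B)
  then have b: "b \<notin> span B" and B: "independent B" by (auto simp: independent_insert)
  let ?f = "\<lambda>(c, y). c *s b + y"
  have "inj_on ?f (UNIV \<times> span B)"
  proof (rule inj_onI, clarify)
    fix c y c' y'
    assume y: "y \<in> span B" "y' \<in> span B" and eq: "c *s b + y = c' *s b + y'"
    have "(c - c') *s b = y' - y" using eq by (simp add: scale_left_diff_distrib algebra_simps)
    then have "(c - c') *s b \<in> span B" using y by (simp add: span_diff)
    then have "c = c'" using b span_scale[of "(c - c') *s b" B "inverse (c - c')"] by (cases "c = c'") auto
    with eq show "c = c' \<and> y = y'" by simp
  qed
  moreover have "?f ` (UNIV \<times> span B) = span (insert b B)"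
  proof
    show "?f ` (UNIV \<times> span B) \<subseteq> span (insert b B)"
    proof clarify
      fix c y assume "y \<in> span B"
      then have "c *s b + y - c *s b \<in> span B" by simp
      then show "c *s b + y \<in> span (insert b B)" unfolding span_insert by blast
    qed
    show "span (insert b B) \<subseteq> ?f ` (UNIV \<times> span B)"
    proof
      fix x assume "x \<in> span (insert b B)"
      then obtain c where "x - c *s b \<in> span B" by (auto simp: span_insert)
      then show "x \<in> ?f ` (UNIV \<times> span B)"
        by (intro image_eqI[of _ _ "(c, x - c *s b)"]) auto
    qed
  qed
  ultimately have "card (span (insert b B)) = card ((UNIV :: 'f set) \<times> span B)"
    by (metis card_image)
  then show ?case using insert.IH[OF B] insert.hyps by (simp add: card_cartesian_product)
qed simp

lemma card_subspace:
  assumes "finite V" "subspace V"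
  shows "card V = CARD('f) ^ dim V"
proof -
  obtain B where B: "B \<subseteq> V" "independent B" "V \<subseteq> span B" "card B = dim V"
    by (rule basis_exists)
  then have "span B = V" using assms(2) by (metis span_subspace)
  with B card_span[of B] finite_subset[OF B(1) assms(1)] show ?thesis by simp
qed

lemma card_field_gt_1: "CARD('f) > 1"
  using card_mono[of UNIV "{0, 1 :: 'f}"] by simp

text \<open>By counting, comparisons of dimensions of finite subspaces become comparisons of finite
  sets; the ambient space may be infinite dimensional.\<close>

lemma dim_le_iff_card_le:
  assumes "finite V" "subspace V" "finite V'" "subspace V'"
  shows "dim V \<le> dim V' \<longleftrightarrow> card V \<le> card V'"
  using assms card_field_gt_1 by (simp add: card_subspace)

lemma dim_mono:
  assumes "finite V'" "subspace V" "subspace V'" "V \<subseteq> V'"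
  shows "dim V \<le> dim V'"
  using assms dim_le_iff_card_le[of V V'] finite_subset[of V V'] card_mono[of V' V] by auto

lemma subspace_dim_equal:
  assumes "finite V'" "subspace V" "subspace V'" "V \<subseteq> V'" "dim V' \<le> dim V"
  shows "V = V'"
  using assms dim_le_iff_card_le[of V' V] finite_subset[of V V'] by (intro card_seteq) auto

lemma span_Un_subspaces:
  assumes "subspace A" "subspace B"
  shows "span (A \<union> B) = {a + b | a b. a \<in> A \<and> b \<in> B}"
proof -
  have "span A = A" "span B = B" using assms by simp_all
  then show ?thesis by (simp only: span_Un)
qed

text \<open>Each fibre of addition on \<open>A \<times> B\<close> is in bijection with
  \<open>A \<inter> B\<close>; counting the pairs by fibres gives the identity in the
  exponents.\<close>

lemma dim_span_Un:
  assumes A: "finite A" "subspace A" and B: "finite B" "subspace B"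
  shows "dim (span (A \<union> B)) + dim (A \<inter> B) = dim A + dim B"
proof -
  let ?S = "span (A \<union> B)"
  have S: "?S = (\<lambda>(a, b). a + b) ` (A \<times> B)"
    unfolding span_Un_subspaces[OF A(2) B(2)] by auto
  have fib: "card {p \<in> A \<times> B. (\<lambda>(a, b). a + b) p = s} = card (A \<inter> B)" if s: "s \<in> ?S" for s
  proof -
    obtain a0 b0 where ab: "a0 \<in> A" "b0 \<in> B" "s = a0 + b0" using s unfolding S by auto
    have "bij_betw (\<lambda>x. (a0 + x, b0 - x)) (A \<inter> B) {p \<in> A \<times> B. (\<lambda>(a, b). a + b) p = s}"
    proof (rule bij_betwI')
      fix x y assume "x \<in> A \<inter> B" "y \<in> A \<inter> B"
      then show "((a0 + x, b0 - x) = (a0 + y, b0 - y)) = (x = y)" by auto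
    next
      fix x assume "x \<in> A \<inter> B"
      then show "(a0 + x, b0 - x) \<in> {p \<in> A \<times> B. (\<lambda>(a, b). a + b) p = s}"
        using ab A(2) B(2) by (auto intro: subspace_add subspace_diff)
    next
      fix p assume p: "p \<in> {p \<in> A \<times> B. (\<lambda>(a, b). a + b) p = s}"
      then obtain a b where p: "p = (a, b)" "a \<in> A" "b \<in> B" "a + b = a0 + b0"
        using ab(3) by auto
      have eq: "a - a0 = b0 - b" using p(4) by (simp add: algebra_simps)
      have "p = (a0 + (a - a0), b0 - (a - a0))"
        using p(1) by (subst (2) eq) simp
      moreover have "a - a0 \<in> A"
        by (rule subspace_diff[OF A(2) p(2) ab(1)])
      moreover have "a - a0 \<in> B"
        unfolding eq by (rule subspace_diff[OF B(2) ab(2) p(3)])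
      ultimately show "\<exists>x\<in>A \<inter> B. p = (a0 + x, b0 - x)" by blast
    qed
    then show ?thesis by (rule bij_betw_same_card[symmetric])
  qed
  have fS: "finite ?S" using finite_span A(1) B(1) by simp
  have "card (A \<times> B) = (\<Sum>s\<in>?S. card {p \<in> A \<times> B. (\<lambda>(a, b). a + b) p = s})"
  proof -
    have "A \<times> B = (\<Union>s\<in>?S. {p \<in> A \<times> B. (\<lambda>(a, b). a + b) p = s})"
      unfolding S by auto
    then have "card (A \<times> B) = card (\<Union>s\<in>?S. {p \<in> A \<times> B. (\<lambda>(a, b). a + b) p = s})" by simp
    also have "\<dots> = (\<Sum>s\<in>?S. card {p \<in> A \<times> B. (\<lambda>(a, b). a + b) p = s})"
      using fS A(1) B(1) by (intro card_UN_disjoint) (auto intro: finite_subset[of _ "A \<times> B"])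
    finally show ?thesis .
  qed
  also have "\<dots> = card ?S * card (A \<inter> B)" using fib by simp
  finally have "CARD('f) ^ (dim A + dim B) = CARD('f) ^ (dim ?S + dim (A \<inter> B))"
    using A B fS by (simp add: card_cartesian_product card_subspace power_add subspace_inter del: dim_span)
  then show ?thesis using card_field_gt_1 by (simp del: dim_span)
qed

end

section \<open>Linear projections, left inverses and extensions\<close>

context vector_space
begin

lemma projection_exists:
  assumes "subspace V"
  obtains g where "Vector_Spaces.linear scale scale g" "range g \<subseteq> V" "\<And>v. v \<in> V \<Longrightarrow> g v = v"
proof -
  interpret P: vector_space_pair scale scale by unfold_locales
  obtain g where "range g \<subseteq> V" "Vector_Spaces.linear scale scale g" "\<forall>v\<in>V. g (id v) = v"
    using P.linear_exists_left_inverse_on[of id V] linear_id assms by auto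
  with that show thesis by auto
qed

lemma left_inverse_exists:
  assumes "Vector_Spaces.linear scale scale g" "subspace V" "inj_on g V"
  obtains g' where "Vector_Spaces.linear scale scale g'" "\<And>v. v \<in> V \<Longrightarrow> g' (g v) = v"
proof -
  interpret P: vector_space_pair scale scale by unfold_locales
  show thesis
    using P.linear_exists_left_inverse_on[OF assms] that by auto
qed

text \<open>Subtracting a projection \<open>p\<close> onto \<open>D\<close> kills \<open>D\<close>
  and is injective on \<open>A\<close>, since \<open>x = p x\<close> with \<open>x\<close> in
  \<open>A\<close> puts \<open>x\<close> into \<open>A \<inter> D\<close>. A left inverse on
  \<open>A\<close> completes the map.\<close>

lemma projection_along_exists:
  assumes A: "subspace A" and D: "subspace D" and AD: "A \<inter> D \<subseteq> {0}"
  obtains g where "Vector_Spaces.linear scale scale g" "range g \<subseteq> A"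
    "\<And>a. a \<in> A \<Longrightarrow> g a = a" "\<And>d. d \<in> D \<Longrightarrow> g d = 0"
proof -
  obtain p where p: "Vector_Spaces.linear scale scale p" "range p \<subseteq> D" "\<And>v. v \<in> D \<Longrightarrow> p v = v"
    using projection_exists[OF D] by blast
  interpret p: Vector_Spaces.linear scale scale p by (fact p(1))
  let ?r = "\<lambda>v. v - p v"
  have r: "Vector_Spaces.linear scale scale ?r"
    by unfold_locales (auto simp: p.add p.scale scale_right_diff_distrib)
  have "inj_on ?r A"
  proof (rule inj_onI)
    fix x y assume xy: "x \<in> A" "y \<in> A" "x - p x = y - p y"
    have "x - y = p (x - y)" using xy(3) by (simp add: p.diff algebra_simps)
    then have "x - y \<in> A \<inter> D" using p(2) xy A by (auto intro: subspace_diff)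
    with AD show "x = y" by auto
  qed
  then obtain s where s: "range s \<subseteq> A" "Vector_Spaces.linear scale scale s" "\<And>v. v \<in> A \<Longrightarrow> s (v - p v) = v"
  proof -
    interpret P: vector_space_pair scale scale by unfold_locales
    show ?thesis
      using P.linear_exists_left_inverse_on[OF r A \<open>inj_on ?r A\<close>] that by auto
  qed
  interpret s: Vector_Spaces.linear scale scale s by (fact s(2))
  show thesis
  proof
    show "Vector_Spaces.linear scale scale (s \<circ> ?r)"
      using r s(2) by (rule Vector_Spaces.linear_compose)
    show "range (s \<circ> ?r) \<subseteq> A" using s(1) by auto
    show "(s \<circ> ?r) a = a" if "a \<in> A" for a using s(3) that by simp
    show "(s \<circ> ?r) d = 0" if "d \<in> D" for d
      using p(3)[OF that] by (simp add: s.zero)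
  qed
qed

lemma linear_extension_exists:
  assumes V: "subspace V" and add: "\<And>a b. a \<in> V \<Longrightarrow> b \<in> V \<Longrightarrow> g (a + b) = g a + g b"
    and scale: "\<And>c a. a \<in> V \<Longrightarrow> g (scale c a) = scale c (g a)"
  obtains G where "Vector_Spaces.linear scale scale G" "\<And>a. a \<in> V \<Longrightarrow> G a = g a"
proof -
  obtain p where p: "Vector_Spaces.linear scale scale p" "range p \<subseteq> V" "\<And>v. v \<in> V \<Longrightarrow> p v = v"
    using projection_exists[OF V] by blast
  interpret p: Vector_Spaces.linear scale scale p by (fact p(1))
  have pV: "p v \<in> V" for v using p(2) by auto
  show thesis
  proof
    show "Vector_Spaces.linear scale scale (\<lambda>v. g (p v))"
      by unfold_locales (simp_all add: p.add p.scale add scale pV)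
    show "g (p a) = g a" if "a \<in> V" for a using p(3)[OF that] by simp
  qed
qed

end

interpretation free: finite_field_vector_space "free_scale :: 'f::{field,finite} \<Rightarrow> ('x \<Rightarrow>\<^sub>0 'f) \<Rightarrow> ('x \<Rightarrow>\<^sub>0 'f)"
  by unfold_locales

section \<open>The exterior square as a functor\<close>

text \<open>The exterior square of the linear map \<open>g\<close>, obtained from the universal
  property with the exterior square as target.\<close>

definition ext_lift ::
    "('f::field \<Rightarrow> 'm::ab_group_add \<Rightarrow> 'm) \<Rightarrow> ('m \<Rightarrow> 'm) \<Rightarrow> ('m \<times> 'm \<Rightarrow>\<^sub>0 'f) \<Rightarrow> ('m \<times> 'm \<Rightarrow>\<^sub>0 'f)" where
  "ext_lift sM g = ext_map free_scale (\<lambda>a b. wedge sM (g a) (g b))"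

context vector_space
begin

lemma alternating_bilinear_comp:
  assumes "Vector_Spaces.linear scale scale g"
  shows "alternating_bilinear scale free_scale (\<lambda>a b. wedge scale (g a) (g b))"
proof -
  interpret g: Vector_Spaces.linear scale scale g by fact
  interpret w: alternating_bilinear scale free_scale "wedge scale"
    by (rule alternating_bilinear_wedge) unfold_locales
  interpret r: Vector_Spaces.linear scale free_scale "\<lambda>b. wedge scale a b" for a by (rule w.linear_right)
  interpret l: Vector_Spaces.linear scale free_scale "\<lambda>a. wedge scale a b" for b by (rule w.linear_left)
  show ?thesis
    by unfold_locales (simp_all add: g.add g.scale r.add r.scale l.add l.scale w.alternating)
qed

lemma
  assumes "Vector_Spaces.linear scale scale g"
  shows linear_ext_lift: "Vector_Spaces.linear free_scale free_scale (ext_lift scale g)"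
    and ext_lift_wedge: "ext_lift scale g (wedge scale a b) = wedge scale (g a) (g b)"
  using alternating_bilinear.linear_ext_map[OF alternating_bilinear_comp[OF assms]]
    alternating_bilinear.ext_map_wedge[OF alternating_bilinear_comp[OF assms]]
  by (simp_all add: ext_lift_def)

lemma ext_square_mono: "A \<subseteq> B \<Longrightarrow> ext_square scale A \<subseteq> ext_square scale B"
  unfolding ext_square_def by (intro free.span_mono) blast

lemma wedge_in_ext_square: "a \<in> A \<Longrightarrow> b \<in> A \<Longrightarrow> wedge scale a b \<in> ext_square scale A"
  unfolding ext_square_def by (intro free.span_base) blast

lemma subspace_ext_square: "free.subspace (ext_square scale A)"
  unfolding ext_square_def by (rule free.subspace_span)

lemma ext_lift_in_ext_square:
  assumes "Vector_Spaces.linear scale scale g" "g ` A \<subseteq> B" "x \<in> ext_square scale A"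
  shows "ext_lift scale g x \<in> ext_square scale B"
proof -
  interpret g: Vector_Spaces.linear free_scale free_scale "ext_lift scale g"
    using assms(1) by (rule linear_ext_lift)
  show ?thesis
    using assms(3) unfolding ext_square_def
  proof (induction rule: free.span_induct_alt)
    case base
    then show ?case by (simp add: g.zero free.span_zero)
  next
    case (step c x y)
    then have "ext_lift scale g x \<in> ext_square scale B"
      using assms(2) by (auto simp: ext_lift_wedge[OF assms(1)] image_subset_iff intro!: wedge_in_ext_square)
    with step show ?case
      by (simp add: g.add g.scale free.span_add free.span_scale ext_square_def)
  qed
qed

lemma ext_lift_left_inverse:
  assumes g: "Vector_Spaces.linear scale scale g" and h: "Vector_Spaces.linear scale scale h"
    and "\<And>a. a \<in> A \<Longrightarrow> h (g a) = a" and "x \<in> ext_square scale A"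
  shows "ext_lift scale h (ext_lift scale g x) = x"
proof -
  interpret g: Vector_Spaces.linear free_scale free_scale "ext_lift scale g" using g by (rule linear_ext_lift)
  interpret h: Vector_Spaces.linear free_scale free_scale "ext_lift scale h" using h by (rule linear_ext_lift)
  show ?thesis
    using assms(4) unfolding ext_square_def
  proof (induction rule: free.span_induct_alt)
    case base
    then show ?case by (simp add: g.zero h.zero)
  next
    case (step c x y)
    then have "ext_lift scale h (ext_lift scale g x) = x"
      using assms(3) by (auto simp: ext_lift_wedge[OF g] ext_lift_wedge[OF h])
    with step show ?case by (simp add: g.add g.scale h.add h.scale)
  qed
qed

lemma ext_lift_id:
  assumes g: "Vector_Spaces.linear scale scale g"
    and "\<And>a. a \<in> A \<Longrightarrow> g a = a" and "x \<in> ext_square scale A"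
  shows "ext_lift scale g x = x"
proof -
  interpret g: Vector_Spaces.linear free_scale free_scale "ext_lift scale g" using g by (rule linear_ext_lift)
  show ?thesis
    using assms(3) unfolding ext_square_def
  proof (induction rule: free.span_induct_alt)
    case base
    then show ?case by (simp add: g.zero)
  next
    case (step c x y)
    then have "ext_lift scale g x = x"
      using assms(2) by (auto simp: ext_lift_wedge[OF g])
    with step show ?case by (simp add: g.add g.scale)
  qed
qed

text \<open>The nontrivial inclusion follows by applying the exterior square of a linear projection onto
  \<open>A\<close> that maps \<open>B\<close> into \<open>A \<inter> B\<close>.\<close>

lemma ext_square_Int:
  assumes A: "subspace A" and B: "subspace B"
  shows "ext_square scale A \<inter> ext_square scale B = ext_square scale (A \<inter> B)"
proof
  obtain p where p: "Vector_Spaces.linear scale scale p" "range p \<subseteq> A \<inter> B" "\<And>v. v \<in> A \<inter> B \<Longrightarrow> p v = v"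
    using projection_exists[OF subspace_inter[OF A B]] by blast
  interpret p: Vector_Spaces.linear scale scale p by (fact p(1))
  let ?D = "{b \<in> B. p b = 0}"
  \<comment> \<open>The kernel of \<open>p\<close> on \<open>B\<close> complements
    \<open>A \<inter> B\<close> in \<open>B\<close> and meets \<open>A\<close> trivially, so a
    projection onto \<open>A\<close> may kill it.\<close>
  have "subspace ?D"
    using B by (auto simp: subspace_def p.add p.scale p.zero)
  moreover have "A \<inter> ?D \<subseteq> {0}" using p(3) by fastforce
  ultimately obtain g where g: "Vector_Spaces.linear scale scale g" "range g \<subseteq> A"
    "\<And>a. a \<in> A \<Longrightarrow> g a = a" "\<And>d. d \<in> ?D \<Longrightarrow> g d = 0"
    using projection_along_exists[OF A] by blast
  interpret g: Vector_Spaces.linear scale scale g by (fact g(1))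
  have "g b \<in> A \<inter> B" if "b \<in> B" for b
  proof -
    have pb: "p b \<in> A \<inter> B" using p(2) by auto
    then have "b - p b \<in> ?D" using that B p(3) by (auto simp: p.diff intro: subspace_diff)
    then have "g b = g (p b)" using g(4) by (metis g.diff eq_iff_diff_eq_0)
    with pb g(3) show ?thesis by auto
  qed
  then have "g ` B \<subseteq> A \<inter> B" by auto
  then show "ext_square scale A \<inter> ext_square scale B \<subseteq> ext_square scale (A \<inter> B)"
    using ext_lift_in_ext_square[OF g(1), of B "A \<inter> B"] ext_lift_id[OF g(1) g(3), of A] by fastforce
  show "ext_square scale (A \<inter> B) \<subseteq> ext_square scale A \<inter> ext_square scale B"
    by (simp add: ext_square_mono)
qed

end

lemma (in finite_field_vector_space) finite_ext_square:
  assumes "finite A"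
  shows "finite (ext_square (*s) A)"
proof -
  have "{wedge (*s) a b | a b. a \<in> A \<and> b \<in> A} = (\<lambda>(a, b). wedge (*s) a b) ` (A \<times> A)" by auto
  then show ?thesis using assms unfolding ext_square_def by (simp add: free.finite_span)
qed

section \<open>Submodularity and selfsufficient subspaces\<close>

locale bounded_relations = generating_alternating_bilinear sM sW \<beta>
  for sM :: "'f::{field,finite} \<Rightarrow> 'm::ab_group_add \<Rightarrow> 'm"
    and sW :: "'f \<Rightarrow> 'w::ab_group_add \<Rightarrow> 'w"
    and \<beta> :: "'m \<Rightarrow> 'm \<Rightarrow> 'w" +
  fixes k :: nat
  assumes k: "k \<ge> 1" and bound: "relation_bound k"

sublocale bounded_relations \<subseteq> M: finite_field_vector_space sM
  by unfold_locales

context bounded_relations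
begin

abbreviation ext :: "'m set \<Rightarrow> ('m \<times> 'm \<Rightarrow>\<^sub>0 'f) set" where
  "ext \<equiv> ext_square sM"

lemma N_eq: "N A = {x \<in> ext A. ext_map sW \<beta> x = 0}"
  using M.ext_square_mono[of A UNIV] by (auto simp: N_def N_kernel_def)

lemma subspace_N: "free.subspace (N A)"
proof -
  interpret f: Vector_Spaces.linear free_scale sW "ext_map sW \<beta>" by (rule linear_ext_map)
  show ?thesis
    using M.subspace_ext_square[of A]
    unfolding N_eq free.subspace_def by (auto simp: f.zero f.add f.scale)
qed

lemma finite_N: "finite A \<Longrightarrow> finite (N A)"
  by (rule finite_subset[OF _ M.finite_ext_square]) (auto simp: N_eq)

lemma N_mono: "A \<subseteq> B \<Longrightarrow> N A \<subseteq> N B"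
  using M.ext_square_mono[of A B] by (auto simp: N_eq)

lemma N_Int: "M.subspace A \<Longrightarrow> M.subspace B \<Longrightarrow> N A \<inter> N B = N (A \<inter> B)"
  using M.ext_square_Int[of A B] by (auto simp: N_eq)

section \<open>The integral predimension and selfsufficient closures\<close>

definition fin_subspace :: "'m set \<Rightarrow> bool" where
  "fin_subspace A \<longleftrightarrow> finite A \<and> M.subspace A"

lemma fin_subspace_span: "finite A \<Longrightarrow> fin_subspace (M.span A)"
  by (simp add: fin_subspace_def M.finite_span)

lemma fin_subspace_Int: "fin_subspace A \<Longrightarrow> M.subspace B \<Longrightarrow> fin_subspace (A \<inter> B)"
  by (auto simp: fin_subspace_def M.subspace_inter)

text \<open>This is \<open>k\<close> times \<open>\<delta> k A\<close>; being an integer, it permits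
  linear arithmetic and the choice of minima.\<close>

definition predim :: "'m set \<Rightarrow> int" where
  "predim A = int k * int (M.dim A) - int (free.dim (N A))"

lemma \<delta>_eq: "\<delta> k A = real_of_int (predim A) / real k"
  using k by (simp add: \<delta>_def predim_def field_simps)

lemma \<delta>_le_iff: "\<delta> k A \<le> \<delta> k B \<longleftrightarrow> predim A \<le> predim B"
  and \<delta>_eq_iff: "\<delta> k A = \<delta> k B \<longleftrightarrow> predim A = predim B"
  using k by (simp_all add: \<delta>_eq divide_le_cancel)

lemma predim_nonneg:
  assumes "fin_subspace A"
  shows "predim A \<ge> 0"
proof -
  have "free.dim (N A) \<le> k * M.dim A"
    using bound assms by (simp add: relation_bound_def fin_subspace_def)
  then have "int (free.dim (N A)) \<le> int (k * M.dim A)" by (simp only: of_nat_le_iff)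
  then show ?thesis by (simp add: predim_def)
qed

text \<open>The linear dimension is modular and \<open>N A \<inter> N B = N (A \<inter> B)\<close>,
  so the defect in submodularity is the codimension of \<open>N A + N B\<close> in the relations of
  the sum. Without defect there are no further relations.\<close>

lemma
  assumes A: "fin_subspace A" and B: "fin_subspace B"
  shows predim_submodular: "predim (M.span (A \<union> B)) + predim (A \<inter> B) \<le> predim A + predim B"
    and N_span_Un: "predim A + predim B \<le> predim (M.span (A \<union> B)) + predim (A \<inter> B) \<Longrightarrow>
      N (M.span (A \<union> B)) = free.span (N A \<union> N B)"
proof -
  let ?S = "M.span (A \<union> B)" and ?T = "free.span (N A \<union> N B)"
  note fin = A[unfolded fin_subspace_def] B[unfolded fin_subspace_def]
  have S: "finite (N ?S)" using fin by (simp add: finite_N M.finite_span)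
  have "N A \<union> N B \<subseteq> N ?S"
    using N_mono[of A ?S] N_mono[of B ?S] M.span_superset[of "A \<union> B"] by auto
  then have sub: "?T \<subseteq> N ?S" using subspace_N by (rule free.span_minimal)
  have "free.dim ?T + free.dim (N (A \<inter> B)) = free.dim (N A) + free.dim (N B)"
    using free.dim_span_Un[of "N A" "N B"] fin by (simp add: finite_N subspace_N N_Int)
  moreover have "M.dim ?S + M.dim (A \<inter> B) = M.dim A + M.dim B"
    using M.dim_span_Un[of A B] fin by simp
  then have "int k * int (M.dim ?S) + int k * int (M.dim (A \<inter> B)) = int k * int (M.dim A) + int k * int (M.dim B)"
    by (metis distrib_left of_nat_add)
  ultimately have *: "predim ?S + predim (A \<inter> B) + (int (free.dim (N ?S)) - int (free.dim ?T)) = predim A + predim B"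
    by (simp add: predim_def del: M.dim_span free.dim_span)
  have "free.dim ?T \<le> free.dim (N ?S)"
    using S sub subspace_N by (intro free.dim_mono) auto
  with * show "predim ?S + predim (A \<inter> B) \<le> predim A + predim B" by linarith
  assume "predim A + predim B \<le> predim ?S + predim (A \<inter> B)"
  with * have "free.dim (N ?S) \<le> free.dim ?T" by linarith
  then show "N ?S = ?T"
    using free.subspace_dim_equal[OF S _ subspace_N sub] by simp
qed

definition fss :: "'m set \<Rightarrow> bool" where
  "fss = fin_selfsufficient k"

lemma fss_def': "fss A \<longleftrightarrow> fin_subspace A \<and> (\<forall>K. fin_subspace K \<and> A \<subseteq> K \<longrightarrow> predim A \<le> predim K)"
  by (auto simp: fss_def fin_selfsufficient_def fin_subspace_def \<delta>_le_iff)

lemma fss_predim_le: "fss A \<Longrightarrow> fin_subspace K \<Longrightarrow> A \<subseteq> K \<Longrightarrow> predim A \<le> predim K"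
  by (simp add: fss_def')

lemma fss_fin_subspace: "fss A \<Longrightarrow> fin_subspace A"
  by (simp add: fss_def')

lemma fss_of_predim_le:
  assumes "fss A" "fin_subspace K" "A \<subseteq> K" "predim K \<le> predim A"
  shows "fss K"
  using assms unfolding fss_def' by (meson order_trans)

text \<open>The bound on the relations keeps predimensions nonnegative, so one of least predimension
  exists among the finite subspaces containing \<open>A\<close>.\<close>

lemma fss_exists:
  assumes "finite A"
  obtains K where "fss K" "A \<subseteq> K"
proof -
  let ?P = "\<lambda>K. fin_subspace K \<and> A \<subseteq> K"
  have "?P (M.span A)"
    using assms by (simp add: fin_subspace_span M.span_superset)
  then obtain K where K: "?P K" "\<And>K'. ?P K' \<Longrightarrow> nat (predim K) \<le> nat (predim K')"
    using ex_has_least_nat[of ?P "M.span A" "\<lambda>K. nat (predim K)"] by blast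
  have "predim K \<le> predim K'" if "fin_subspace K'" "K \<subseteq> K'" for K'
  proof -
    have "?P K'" using that K(1) by auto
    from K(2)[OF this] predim_nonneg[OF that(1)] show ?thesis by linarith
  qed
  with K(1) that show thesis by (auto simp: fss_def')
qed

lemma predim_Int_fss_le:
  assumes A: "fss A" and K: "fin_subspace K"
  shows "predim (K \<inter> A) \<le> predim K"
proof -
  note fA = fss_fin_subspace[OF A]
  have "predim A \<le> predim (M.span (K \<union> A))"
    using fA K M.span_superset[of "K \<union> A"]
    by (intro fss_predim_le[OF A] fin_subspace_span) (auto simp: fin_subspace_def)
  with predim_submodular[OF K fA] show ?thesis by linarith
qed

text \<open>By \<open>predim_Int_fss_le\<close>, cutting \<open>K\<close> down to \<open>A\<close>
  and then to \<open>B\<close> never raises the predimension, and the result is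
  \<open>A \<inter> B\<close>.\<close>

lemma fss_Int:
  assumes A: "fss A" and B: "fss B"
  shows "fss (A \<inter> B)"
  unfolding fss_def'
proof (intro conjI allI impI)
  note fin = fss_fin_subspace[OF A] fss_fin_subspace[OF B]
  then show "fin_subspace (A \<inter> B)" by (auto simp: fin_subspace_def intro: M.subspace_inter)
  fix K assume K: "fin_subspace K \<and> A \<inter> B \<subseteq> K"
  have "fin_subspace (K \<inter> A)" using K fin by (auto simp: fin_subspace_def intro: M.subspace_inter)
  from predim_Int_fss_le[OF B this] predim_Int_fss_le[OF A, of K] K
  have "predim (K \<inter> A \<inter> B) \<le> predim K" by auto
  moreover have "K \<inter> A \<inter> B = A \<inter> B" using K by auto
  ultimately show "predim (A \<inter> B) \<le> predim K" by simp
qed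

lemma CSS_minimal: "fss K \<Longrightarrow> A \<subseteq> K \<Longrightarrow> CSS k A \<subseteq> K"
  by (auto simp: CSS_def fss_def)

lemma subset_CSS: "A \<subseteq> CSS k A"
  by (auto simp: CSS_def)

text \<open>In a family closed under intersection a member of least cardinality is contained in
  every other member.\<close>

lemma fss_CSS:
  assumes "finite A"
  shows "fss (CSS k A)"
proof -
  let ?P = "\<lambda>K. fss K \<and> A \<subseteq> K"
  obtain K0 where "?P K0" using fss_exists[OF assms] by blast
  then obtain K where K: "?P K" "\<And>K'. ?P K' \<Longrightarrow> card K \<le> card K'"
    using ex_has_least_nat[of ?P K0 card] by blast
  have "finite K" using K(1) fss_fin_subspace by (auto simp: fin_subspace_def)
  have "K \<subseteq> K'" if "?P K'" for K'
  proof -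
    have "?P (K \<inter> K')" using that K(1) fss_Int by blast
    from K(2)[OF this] have "K \<inter> K' = K" using \<open>finite K\<close> by (intro card_seteq) auto
    then show ?thesis by blast
  qed
  then have "CSS k A = K" using K(1) unfolding CSS_def fss_def by blast
  with K(1) show ?thesis by simp
qed

end

section \<open>Finite extensions of predimension at most zero over \<open>H\<close>\<close>

locale selfsufficient_subspace = bounded_relations sM sW \<beta> k
  for sM :: "'f::{field,finite} \<Rightarrow> 'm::ab_group_add \<Rightarrow> 'm"
    and sW :: "'f \<Rightarrow> 'w::ab_group_add \<Rightarrow> 'w" and \<beta> k +
  fixes H :: "'m set"
  assumes selfsufficient: "selfsufficient k H"
begin

text \<open>The last conclusion serves \<open>in_cl\<close>, which for a finite \<open>H\<close>
  takes \<open>H\<close> itself as base and not one of its finite subsets.\<close>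

lemma fss_hull:
  assumes "finite A" "A \<subseteq> H"
  obtains H\<^sub>1 where "fss H\<^sub>1" "A \<subseteq> H\<^sub>1" "H\<^sub>1 \<subseteq> H" "finite H \<Longrightarrow> H\<^sub>1 = H"
  using selfsufficient assms unfolding selfsufficient_def fss_def by (auto split: if_splits)

lemma subspace_H: "M.subspace H"
  using selfsufficient unfolding selfsufficient_def fin_selfsufficient_def by (auto split: if_splits)

text \<open>Neither \<open>A\<close> nor \<open>A \<inter> H\<close> need be selfsufficient. The
  condition looks only at \<open>A\<close>, its relations and its trace on \<open>H\<close>, so it
  passes to isomorphic copies.\<close>

definition zero_ext :: "'m set \<Rightarrow> bool" where
  "zero_ext A \<longleftrightarrow> fin_subspace A \<and> predim A \<le> predim (A \<inter> H)"

lemma zero_ext_fin_subspace: "zero_ext A \<Longrightarrow> fin_subspace A"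
  by (simp add: zero_ext_def)

text \<open>Submodularity bounds the predimension of the sum by that of \<open>H\<^sub>1\<close>,
  and selfsufficiency of \<open>H\<^sub>1\<close> gives the converse; equality makes the relations
  split.\<close>

lemma
  assumes A: "zero_ext A" and H1: "fss H\<^sub>1" "A \<inter> H \<subseteq> H\<^sub>1" "H\<^sub>1 \<subseteq> H"
  shows predim_zero_ext_Un: "predim (M.span (A \<union> H\<^sub>1)) = predim H\<^sub>1"
    and zero_ext_Un_Int: "M.span (A \<union> H\<^sub>1) \<inter> H = H\<^sub>1"
    and N_zero_ext_Un: "N (M.span (A \<union> H\<^sub>1)) = free.span (N A \<union> N H\<^sub>1)"
proof -
  let ?S = "M.span (A \<union> H\<^sub>1)"
  have fA: "fin_subspace A" and fH1: "fin_subspace H\<^sub>1" and pA: "predim A \<le> predim (A \<inter> H)"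
    using A H1(1) by (auto simp: zero_ext_def intro: fss_fin_subspace)
  have int: "A \<inter> H\<^sub>1 = A \<inter> H" using H1 by auto
  have "predim H\<^sub>1 \<le> predim ?S"
    using fA fH1 M.span_superset[of "A \<union> H\<^sub>1"]
    by (intro fss_predim_le[OF H1(1)] fin_subspace_span) (auto simp: fin_subspace_def)
  with predim_submodular[OF fA fH1] N_span_Un[OF fA fH1] pA
  show "predim ?S = predim H\<^sub>1" "N ?S = free.span (N A \<union> N H\<^sub>1)"
    unfolding int by auto
  show "?S \<inter> H = H\<^sub>1"
  proof
    show "H\<^sub>1 \<subseteq> ?S \<inter> H" using H1(3) M.span_superset[of "A \<union> H\<^sub>1"] by auto
    show "?S \<inter> H \<subseteq> H\<^sub>1"
    proof
      fix x assume x: "x \<in> ?S \<inter> H"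
      have sA: "M.subspace A" and sH1: "M.subspace H\<^sub>1"
        using fA fH1 by (auto simp: fin_subspace_def)
      from x obtain a h where ah: "a \<in> A" "h \<in> H\<^sub>1" "x = a + h"
        by (auto simp: M.span_Un_subspaces[OF sA sH1])
      then have "a = x - h" by simp
      then have "a \<in> H" using x ah H1(3) M.subspace_diff[OF subspace_H] by blast
      then have "a \<in> H\<^sub>1" using ah H1(2) by blast
      then show "x \<in> H\<^sub>1" using ah sH1 M.subspace_add by blast
    qed
  qed
qed

text \<open>Adding a selfsufficient \<open>H1\<close> that contains the trace on \<open>H\<close>
  turns the inequality into an equality, which the exact dimension count needs.\<close>

lemma zero_ext_extend:
  assumes "zero_ext A"
  obtains A' where "fin_subspace A'" "A \<subseteq> A'" "predim A' = predim (A' \<inter> H)"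
proof -
  have A: "finite (A \<inter> H)" "fin_subspace A" using assms by (auto simp: zero_ext_def fin_subspace_def)
  obtain H1 where H1: "fss H1" "A \<inter> H \<subseteq> H1" "H1 \<subseteq> H"
    using fss_hull[OF A(1)] by blast
  have "fin_subspace (M.span (A \<union> H1))"
    using A(2) fss_fin_subspace[OF H1(1)] by (intro fin_subspace_span) (auto simp: fin_subspace_def)
  with predim_zero_ext_Un[OF assms H1] zero_ext_Un_Int[OF assms H1] show thesis
    using M.span_superset[of "A \<union> H1"] by (intro that[of "M.span (A \<union> H1)"]) auto
qed

text \<open>Over one \<open>H1\<close> containing the trace of the whole sum, \<open>A + H1\<close>
  and \<open>B + H1\<close> have the predimension of \<open>H1\<close>, while their sum and
  intersection have at least that. Equality in submodularity follows.\<close>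

lemma zero_ext_Un:
  assumes A: "zero_ext A" and B: "zero_ext B"
  obtains S H\<^sub>1 where "zero_ext S" "A \<union> B \<subseteq> S" "H\<^sub>1 \<subseteq> H"
    "N S = free.span (N A \<union> N B \<union> N H\<^sub>1)"
proof -
  have fA: "fin_subspace A" and fB: "fin_subspace B"
    using A B by (auto simp: zero_ext_def)
  have "finite (M.span (A \<union> B) \<inter> H)"
    using fA fB by (auto simp: fin_subspace_def M.finite_span)
  then obtain H1 where H1: "fss H1" "M.span (A \<union> B) \<inter> H \<subseteq> H1" "H1 \<subseteq> H"
    using fss_hull by (metis Int_lower2)
  then have AH: "A \<inter> H \<subseteq> H1" and BH: "B \<inter> H \<subseteq> H1"
    using M.span_superset[of "A \<union> B"] by auto
  let ?A = "M.span (A \<union> H1)" and ?B = "M.span (B \<union> H1)"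
  have fH1: "fin_subspace H1" using H1(1) by (rule fss_fin_subspace)
  then have f: "fin_subspace ?A" "fin_subspace ?B"
    using fA fB by (auto simp: fin_subspace_def M.finite_span)
  let ?S = "M.span (?A \<union> ?B)"
  have fS: "fin_subspace ?S" and fI: "fin_subspace (?A \<inter> ?B)"
    using f by (simp_all add: fin_subspace_def M.finite_span M.subspace_inter)
  have sup: "A \<union> H1 \<subseteq> ?A" "B \<union> H1 \<subseteq> ?B" "?A \<union> ?B \<subseteq> ?S"
    by (rule M.span_superset)+
  have "predim H1 \<le> predim ?S" "predim H1 \<le> predim (?A \<inter> ?B)"
    using sup by (auto intro!: fss_predim_le[OF H1(1)] fS fI)
  moreover have "predim ?A = predim H1" "predim ?B = predim H1"
    using predim_zero_ext_Un[OF A H1(1) AH H1(3)] predim_zero_ext_Un[OF B H1(1) BH H1(3)] by auto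
  ultimately have pS: "predim ?S \<le> predim H1" and NS: "N ?S = free.span (N ?A \<union> N ?B)"
    using predim_submodular[OF f] N_span_Un[OF f] by auto
  have "predim H1 \<le> predim (?S \<inter> H)"
    using sup H1(3) by (intro fss_predim_le[OF H1(1)] fin_subspace_Int fS subspace_H) auto
  with pS fS have "zero_ext ?S" by (simp add: zero_ext_def)
  moreover have "N ?S = free.span (N A \<union> N B \<union> N H1)"
  proof
    have "free.span (N A \<union> N H1) \<union> free.span (N B \<union> N H1) \<subseteq> free.span (N A \<union> N B \<union> N H1)"
      by (intro Un_least free.span_mono) auto
    then show "N ?S \<subseteq> free.span (N A \<union> N B \<union> N H1)"
      unfolding NS N_zero_ext_Un[OF A H1(1) AH H1(3)] N_zero_ext_Un[OF B H1(1) BH H1(3)]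
      by (intro free.span_minimal) auto
    have "A \<subseteq> ?S" "B \<subseteq> ?S" "H1 \<subseteq> ?S" using sup by blast+
    then have "N A \<union> N B \<union> N H1 \<subseteq> N ?S" by (intro Un_least N_mono)
    then show "free.span (N A \<union> N B \<union> N H1) \<subseteq> N ?S"
      using subspace_N by (rule free.span_minimal)
  qed
  ultimately show thesis
    using that[of ?S H1] sup H1(3) by blast
qed

lemma zero_ext_in_H: "fin_subspace A \<Longrightarrow> A \<subseteq> H \<Longrightarrow> zero_ext A"
  by (simp add: zero_ext_def Int_absorb2)

text \<open>From left to right, \<open>CSS\<close> of \<open>a\<close> and a finite base is itself a
  zero extension. Conversely, \<open>A + H1\<close> is selfsufficient with the predimension of
  \<open>H1\<close>, which squeezes that of the closure of \<open>a\<close> and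
  \<open>H1\<close>.\<close>

lemma cl_eq: "cl k H = \<Union> {A. zero_ext A}"
proof
  show "cl k H \<subseteq> \<Union> {A. zero_ext A}"
  proof
    fix a assume "a \<in> cl k H"
    then obtain B where B: "finite B" "B \<subseteq> H" "fin_in_cl k {a} B"
      unfolding cl_def in_cl_def by (auto split: if_splits)
    let ?K1 = "CSS k (M.span B)" and ?K2 = "CSS k (M.span ({a} \<union> B))"
    have K: "fss ?K1" "fss ?K2"
      using B(1) by (auto intro!: fss_CSS M.finite_span)
    have eq: "predim ?K2 = predim ?K1" using B(3) by (simp add: fin_in_cl_def \<delta>_eq_iff)
    obtain H1 where H1: "fss H1" "B \<subseteq> H1" "H1 \<subseteq> H" using fss_hull[OF B(1,2)] by blast
    have "M.span B \<subseteq> H1"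
      using H1(1,2) by (intro M.span_minimal) (auto simp: fss_def' fin_subspace_def)
    then have "?K1 \<subseteq> H" using CSS_minimal[OF H1(1)] H1(3) by blast
    moreover have "?K1 \<subseteq> ?K2"
      using subset_CSS[of "M.span ({a} \<union> B)"] M.span_mono[of B "{a} \<union> B"]
      by (intro CSS_minimal K(2)) auto
    ultimately have "predim ?K1 \<le> predim (?K2 \<inter> H)"
      using fss_fin_subspace[OF K(2)] subspace_H
      by (intro fss_predim_le[OF K(1)] fin_subspace_Int) auto
    with eq have "zero_ext ?K2" using fss_fin_subspace[OF K(2)] by (simp add: zero_ext_def)
    moreover have "a \<in> ?K2"
      using subset_CSS[of "M.span ({a} \<union> B)"] M.span_superset[of "{a} \<union> B"] by auto
    ultimately show "a \<in> \<Union> {A. zero_ext A}" by blast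
  qed
  show "\<Union> {A. zero_ext A} \<subseteq> cl k H"
  proof
    fix a assume "a \<in> \<Union> {A. zero_ext A}"
    then obtain A where A: "zero_ext A" "a \<in> A" by blast
    have fA: "fin_subspace A" using A(1) by (rule zero_ext_fin_subspace)
    then have "finite (A \<inter> H)" by (auto simp: fin_subspace_def)
    then obtain H1 where H1: "fss H1" "A \<inter> H \<subseteq> H1" "H1 \<subseteq> H" and H1_eq: "finite H \<Longrightarrow> H1 = H"
      using fss_hull by (metis Int_lower2)
    have fH1: "finite H1" "M.subspace H1" using H1(1) by (auto simp: fss_def' fin_subspace_def)
    let ?S = "M.span (A \<union> H1)"
    have sup: "A \<union> H1 \<subseteq> ?S" by (rule M.span_superset)
    have S: "fss ?S"
      using fA fH1 sup predim_zero_ext_Un[OF A(1) H1]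
      by (intro fss_of_predim_le[OF H1(1)] fin_subspace_span) (auto simp: fin_subspace_def)
    have span: "M.span H1 = H1" using fH1(2) by simp
    have CH1: "CSS k H1 = H1"
      using CSS_minimal[OF H1(1), of H1] subset_CSS[of H1] by auto
    let ?K = "CSS k (M.span ({a} \<union> H1))"
    have K: "fss ?K" using fH1(1) by (intro fss_CSS M.finite_span) auto
    have "M.span ({a} \<union> H1) \<subseteq> ?S"
      using A(2) by (intro M.span_mono) auto
    then have "?K \<subseteq> ?S" by (rule CSS_minimal[OF S])
    then have "predim ?K \<le> predim ?S" using fss_fin_subspace[OF S] by (intro fss_predim_le[OF K])
    also have "\<dots> = predim H1" by (rule predim_zero_ext_Un[OF A(1) H1])
    finally have "predim ?K \<le> predim H1" .
    moreover have "predim H1 \<le> predim ?K"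
      using subset_CSS[of "M.span ({a} \<union> H1)"] M.span_superset[of "{a} \<union> H1"]
      by (intro fss_predim_le[OF H1(1)] fss_fin_subspace[OF K]) auto
    ultimately have "fin_in_cl k {a} H1"
      unfolding fin_in_cl_def \<delta>_eq_iff span CH1 by simp
    then show "a \<in> cl k H"
      using H1(3) H1_eq fH1(1) unfolding cl_def in_cl_def by auto
  qed
qed

lemma H_subset_cl: "H \<subseteq> cl k H"
proof
  fix a assume "a \<in> H"
  then have "M.span {a} \<subseteq> H" using subspace_H by (intro M.span_minimal) auto
  then have "zero_ext (M.span {a})" by (intro zero_ext_in_H fin_subspace_span) auto
  then show "a \<in> cl k H" using M.span_base[of a "{a}"] unfolding cl_eq by blast
qed

lemma finite_subset_cl:
  assumes "finite X" "X \<subseteq> cl k H"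
  obtains A where "zero_ext A" "X \<subseteq> A"
proof -
  have "\<exists>A. zero_ext A \<and> X \<subseteq> A"
    using assms
  proof (induction X rule: finite_induct)
    case empty
    have "zero_ext (M.span {})"
      using subspace_H by (intro zero_ext_in_H fin_subspace_span) (auto intro: M.subspace_0)
    then show ?case by blast
  next
    case (insert x X)
    then obtain A where A: "zero_ext A" "X \<subseteq> A" by auto
    obtain B where B: "zero_ext B" "x \<in> B" using insert.prems unfolding cl_eq by auto
    obtain S where "zero_ext S" "A \<union> B \<subseteq> S" using zero_ext_Un[OF A(1) B(1)] by metis
    with A B show ?case by blast
  qed
  with that show thesis by blast
qed

end

section \<open>Counting\<close>

context vector_space
begin

lemma ext_square_zero: "ext_square scale {0} = {0}"
proof -
  interpret w: alternating_bilinear scale free_scale "wedge scale"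
    by (rule alternating_bilinear_wedge) unfold_locales
  show ?thesis by (simp add: ext_square_def w.alternating)
qed

text \<open>The coefficient of \<open>x \<and> y\<close> is read off by the alternating form
  \<open>(a, b) \<mapsto> a\<^sub>x b\<^sub>y - a\<^sub>y b\<^sub>x\<close> in coordinates with respect to a basis.\<close>

lemma inj_on_wedge_combination:
  assumes B: "independent (B\<^sub>1 \<union> B\<^sub>2)" "B\<^sub>1 \<inter> B\<^sub>2 = {}" "finite B\<^sub>1" "finite B\<^sub>2"
  shows "inj_on (\<lambda>c. \<Sum>(x, y)\<in>B\<^sub>1 \<times> B\<^sub>2. free_scale (c (x, y)) (wedge scale x y)) (PiE (B\<^sub>1 \<times> B\<^sub>2) (\<lambda>_. UNIV))"
proof (rule inj_onI)
  fix c c' assume c: "c \<in> PiE (B\<^sub>1 \<times> B\<^sub>2) (\<lambda>_. UNIV)" "c' \<in> PiE (B\<^sub>1 \<times> B\<^sub>2) (\<lambda>_. UNIV)"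
    and eq: "(\<Sum>(x, y)\<in>B\<^sub>1 \<times> B\<^sub>2. free_scale (c (x, y)) (wedge scale x y)) =
      (\<Sum>(x, y)\<in>B\<^sub>1 \<times> B\<^sub>2. free_scale (c' (x, y)) (wedge scale x y))"
  let ?B = "extend_basis (B\<^sub>1 \<union> B\<^sub>2)"
  have ext: "B\<^sub>1 \<union> B\<^sub>2 \<subseteq> ?B" "independent ?B" "span ?B = UNIV"
    using extend_basis_superset[OF B(1)] independent_extend_basis[OF B(1)] span_extend_basis[OF B(1)] by blast+
  let ?r = "representation ?B"
  interpret F: vector_space "(*) :: 'a \<Rightarrow> 'a \<Rightarrow> 'a"
    by unfold_locales (auto simp: algebra_simps)
  have coeff: "f (x, y) = ext_map (*) (\<lambda>a b. ?r a x * ?r b y - ?r a y * ?r b x)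
      (\<Sum>(x, y)\<in>B\<^sub>1 \<times> B\<^sub>2. free_scale (f (x, y)) (wedge scale x y))"
    if xy: "x \<in> B\<^sub>1" "y \<in> B\<^sub>2" for f x y
  proof -
    let ?\<omega> = "\<lambda>a b. ?r a x * ?r b y - ?r a y * ?r b x"
    have r: "?r (a + b) z = ?r a z + ?r b z" "?r (scale t a) z = t * ?r a z" for a b t z
      by (simp_all add: representation_add[OF ext(2)] representation_scale[OF ext(2)] ext(3))
    interpret \<omega>: alternating_bilinear scale "(*)" ?\<omega>
      by unfold_locales (simp_all only: r distrib_left distrib_right mult_ac add_ac
        diff_conv_add_uminus minus_add_distrib mult_minus_right right_minus)
    interpret f: Vector_Spaces.linear free_scale "(*)" "ext_map (*) ?\<omega>" by (rule \<omega>.linear_ext_map)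
    have "?\<omega> a b = (if (a, b) = (x, y) then 1 else 0)" if "a \<in> B\<^sub>1" "b \<in> B\<^sub>2" for a b
    proof -
      have "?r a z = (if z = a then 1 else 0)" if "a \<in> B\<^sub>1 \<union> B\<^sub>2" for a z
        using representation_basis[OF ext(2), of a] that ext(1) by auto
      with that xy B(2) show ?thesis by auto
    qed
    then have "(\<Sum>(a, b)\<in>B\<^sub>1 \<times> B\<^sub>2. f (a, b) * ?\<omega> a b) = (\<Sum>p\<in>B\<^sub>1 \<times> B\<^sub>2. f p * (if p = (x, y) then 1 else 0))"
      by (intro sum.cong) (auto split: if_splits)
    also have "\<dots> = f (x, y)"
      using xy B(3,4) by (simp add: sum.delta' if_distrib cong: if_cong)
    finally show ?thesis
      by (simp add: f.sum f.scale \<omega>.ext_map_wedge case_prod_beta)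
  qed
  have "c p = c' p" if "p \<in> B\<^sub>1 \<times> B\<^sub>2" for p
    using that coeff[of "fst p" "snd p" c] coeff[of "fst p" "snd p" c'] eq by auto
  with c show "c = c'" by (rule PiE_ext)
qed

end

context finite_field_vector_space
begin

text \<open>Products are formed only between two disjoint sets of \<open>m\<close> basis vectors.
  This needs no order on the basis and costs only a constant factor in the exponent.\<close>

lemma card_ext_square_ge:
  assumes E: "finite E" "subspace E" and m: "2 * m \<le> dim E"
  shows "CARD('f) ^ (m * m) \<le> card (ext_square (*s) E)"
proof -
  obtain B where B: "B \<subseteq> E" "independent B" "E \<subseteq> span B" "card B = dim E"
    by (rule basis_exists)
  have finB: "finite B" using B(1) E(1) by (rule finite_subset)
  obtain B1 where B1: "B1 \<subseteq> B" "card B1 = m"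
    using obtain_subset_with_card_n[of m B] m B(4) by auto
  have fin1: "finite B1" using B1(1) finB by (rule finite_subset)
  have "card (B - B1) = dim E - m" using B1 B(4) fin1 by (simp add: card_Diff_subset)
  then have "m \<le> card (B - B1)" using m by linarith
  then obtain B2 where B2: "B2 \<subseteq> B - B1" "card B2 = m"
    by (rule obtain_subset_with_card_n)
  have fin2: "finite B2" using B2(1) finB by (auto intro: finite_subset)
  have ind: "independent (B1 \<union> B2)"
    using B1(1) B2(1) by (intro independent_mono[OF B(2)]) auto
  let ?f = "\<lambda>c. \<Sum>(x, y)\<in>B1 \<times> B2. free_scale (c (x, y)) (wedge (*s) x y)"
  have "card (PiE (B1 \<times> B2) (\<lambda>_. UNIV :: 'f set)) \<le> card (ext_square (*s) E)"
  proof (rule card_inj_on_le)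
    show "inj_on ?f (PiE (B1 \<times> B2) (\<lambda>_. UNIV))"
      using ind B2(1) fin1 fin2 by (intro inj_on_wedge_combination) auto
    show "?f ` PiE (B1 \<times> B2) (\<lambda>_. UNIV) \<subseteq> ext_square (*s) E"
      using B(1) B1(1) B2(1)
      by (auto intro!: free.subspace_sum[OF subspace_ext_square] free.subspace_scale[OF subspace_ext_square]
        wedge_in_ext_square)
    show "finite (ext_square (*s) E)" using E(1) by (rule finite_ext_square)
  qed
  moreover have "card (PiE (B1 \<times> B2) (\<lambda>_. UNIV :: 'f set)) = CARD('f) ^ (m * m)"
    using fin1 fin2 B1 B2 by (simp add: card_PiE card_cartesian_product)
  ultimately show ?thesis by simp
qed

lemma complement_exists:
  assumes A: "finite A" "subspace A" and B: "subspace B" "B \<subseteq> A"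
  obtains E where "subspace E" "E \<subseteq> A" "E \<inter> B \<subseteq> {0}" "A = {e + b | e b. e \<in> E \<and> b \<in> B}"
    "dim E + dim B = dim A"
proof -
  obtain p where p: "Vector_Spaces.linear (*s) (*s) p" "range p \<subseteq> B" "\<And>v. v \<in> B \<Longrightarrow> p v = v"
    using projection_exists[OF B(1)] by blast
  interpret p: Vector_Spaces.linear "(*s)" "(*s)" p by (fact p(1))
  let ?E = "{a \<in> A. p a = 0}"
  have E: "subspace ?E"
    using A(2) by (auto simp: subspace_def p.add p.scale p.zero)
  have EB: "?E \<inter> B \<subseteq> {0}" using p(3) by fastforce
  have A_eq: "A = {e + b | e b. e \<in> ?E \<and> b \<in> B}"
  proof (intro equalityI subsetI)
    fix a assume a: "a \<in> A"
    have pa: "p a \<in> B" using p(2) by auto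
    then have "a - p a \<in> ?E"
      using a B(2) A(2) p(3) by (auto simp: p.diff intro: subspace_diff)
    with pa show "a \<in> {e + b | e b. e \<in> ?E \<and> b \<in> B}"
      by (intro CollectI exI[of _ "a - p a"] exI[of _ "p a"]) simp
  next
    fix a assume "a \<in> {e + b | e b. e \<in> ?E \<and> b \<in> B}"
    then show "a \<in> A" using B(2) A(2) by (auto intro: subspace_add)
  qed
  have "span (?E \<union> B) = A" unfolding span_Un_subspaces[OF E B(1)] using A_eq by simp
  moreover have "?E \<inter> B = {0}" using EB subspace_0[OF E] subspace_0[OF B(1)] by auto
  moreover have "dim (span (?E \<union> B)) + dim (?E \<inter> B) = dim ?E + dim B"
    using A(1) B E by (intro dim_span_Un) (auto intro: finite_subset)
  moreover have "dim {0} = 0" using dim_span[of "{}"] dim_eq_card_independent[OF independent_empty] by simp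
  ultimately have "dim ?E + dim B = dim A" by (simp del: dim_span)
  with E EB A_eq that[of ?E] show thesis by blast
qed

text \<open>Terms with the same first factor are collected, so the number of products is bounded by
  \<open>card D\<close>, however long the combination was.\<close>

lemma ext_square_wedge_sum:
  assumes D: "finite D" "subspace D" and "x \<in> ext_square (*s) D"
  obtains y where "\<And>a. a \<in> D \<Longrightarrow> y a \<in> D" "x = (\<Sum>a\<in>D. wedge (*s) a (y a))"
proof -
  interpret w: alternating_bilinear "(*s)" free_scale "wedge (*s)"
    by (rule alternating_bilinear_wedge) unfold_locales
  interpret r: Vector_Spaces.linear "(*s)" free_scale "\<lambda>b. wedge (*s) a b" for a by (rule w.linear_right)
  have "\<exists>y. (\<forall>a\<in>D. y a \<in> D) \<and> x = (\<Sum>a\<in>D. wedge (*s) a (y a))"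
    using assms(3) unfolding ext_square_def
  proof (induction rule: free.span_induct_alt)
    case base
    show ?case
      using subspace_0[OF D(2)] by (intro exI[of _ "\<lambda>_. 0"]) (simp add: r.zero)
  next
    case (step c x z)
    then obtain a b y where ab: "x = wedge (*s) a b" "a \<in> D" "b \<in> D"
      and y: "\<forall>a\<in>D. y a \<in> D" "z = (\<Sum>a\<in>D. wedge (*s) a (y a))" by blast
    let ?y = "\<lambda>a'. y a' + (if a' = a then c *s b else 0)"
    have "(\<Sum>a'\<in>D. wedge (*s) a' (?y a')) = z + (\<Sum>a'\<in>D. if a' = a then wedge (*s) a (c *s b) else 0)"
      unfolding y(2) sum.distrib[symmetric] by (intro sum.cong) (auto simp: r.add r.zero)
    also have "\<dots> = free_scale c x + z"
      using D(1) ab by (simp add: r.scale)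
    finally show ?case
      using y(1) ab D(2) by (intro exI[of _ ?y]) (auto intro!: subspace_add subspace_scale simp: subspace_0)
  qed
  with that show thesis by blast
qed

end

context selfsufficient_subspace
begin

definition wedge_sums :: "nat \<Rightarrow> 'm set \<Rightarrow> ('m \<times> 'm \<Rightarrow>\<^sub>0 'f) set" where
  "wedge_sums T E = (\<lambda>(x, y). \<Sum>i<T. wedge sM (x i) (y i)) ` (PiE {..<T} (\<lambda>_. E) \<times> PiE {..<T} (\<lambda>_. E))"

lemma
  assumes "finite E"
  shows finite_wedge_sums: "finite (wedge_sums T E)"
    and card_wedge_sums_le: "card (wedge_sums T E) \<le> card E ^ (2 * T)"
proof -
  have fin: "finite (PiE {..<T} (\<lambda>_. E) \<times> PiE {..<T} (\<lambda>_. E))"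
    using assms by (auto intro: finite_PiE)
  then show "finite (wedge_sums T E)" by (simp add: wedge_sums_def)
  have "card (wedge_sums T E) \<le> card (PiE {..<T} (\<lambda>_. E) \<times> PiE {..<T} (\<lambda>_. E))"
    unfolding wedge_sums_def using fin by (rule card_image_le)
  also have "\<dots> = card E ^ (2 * T)"
    by (simp add: card_cartesian_product card_PiE power_add[symmetric] mult_2)
  finally show "card (wedge_sums T E) \<le> card E ^ (2 * T)" .
qed

text \<open>Shorter sums are padded with \<open>0 \<and> 0 = 0\<close>, so that a single length
  \<open>T\<close> suffices for the counting.\<close>

lemma sum_wedge_in_wedge_sums:
  assumes D: "finite D" "card D \<le> T" and E: "0 \<in> E" "\<And>a. a \<in> D \<Longrightarrow> f a \<in> E" "\<And>a. a \<in> D \<Longrightarrow> g a \<in> E"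
  shows "(\<Sum>a\<in>D. wedge sM (f a) (g a)) \<in> wedge_sums T E"
proof -
  interpret w: alternating_bilinear sM free_scale "wedge sM"
    by (rule alternating_bilinear_wedge) unfold_locales
  obtain h where h: "bij_betw h {0..<card D} D"
    using ex_bij_betw_nat_finite[OF D(1)] by blast
  let ?x = "\<lambda>f. restrict (\<lambda>i. if i < card D then f (h i) else 0) {..<T}"
  have hD: "h i \<in> D" if "i < card D" for i
    using h that by (auto simp: bij_betw_def)
  have "(\<Sum>a\<in>D. wedge sM (f a) (g a)) = (\<Sum>i\<in>{0..<card D}. wedge sM (f (h i)) (g (h i)))"
    using h by (rule sum.reindex_bij_betw[symmetric])
  also have "\<dots> = (\<Sum>i<T. wedge sM (?x f i) (?x g i))"
    using D(2) by (intro sum.mono_neutral_cong_left) (auto simp: w.alternating)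
  finally have eq: "(\<Sum>a\<in>D. wedge sM (f a) (g a)) = (\<Sum>i<T. wedge sM (?x f i) (?x g i))" .
  have "?x f \<in> PiE {..<T} (\<lambda>_. E)" "?x g \<in> PiE {..<T} (\<lambda>_. E)"
    using E hD by auto
  then show ?thesis
    unfolding eq wedge_sums_def by (intro image_eqI[of _ _ "(?x f, ?x g)"]) auto
qed

text \<open>Under the hypothesis every element of the exterior square of \<open>E \<cong> A / (A \<inter> H)\<close> is the sum of
  an element of the image of \<open>N A\<close>, which is small, and of boundedly many elements \<open>x \<and> y\<close>. As the
  dimension of the exterior square is quadratic in that of \<open>E\<close>, the latter is bounded.\<close>

lemma dim_zero_ext_le:
  assumes T: "\<And>A u. zero_ext A \<Longrightarrow> u \<in> ext A \<Longrightarrow>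
      \<exists>D v. zero_ext D \<and> card D \<le> T \<and> v \<in> ext D \<and> ext_map sW \<beta> v = ext_map sW \<beta> u"
    and A: "fin_subspace A" "predim A = predim (A \<inter> H)"
  shows "M.dim A \<le> M.dim (A \<inter> H) + 6 * (k + 2 * T) + 1"
proof -
  have zA: "zero_ext A" using A by (simp add: zero_ext_def)
  have fA: "finite A" "M.subspace A" using A(1) by (auto simp: fin_subspace_def)
  obtain E where E: "M.subspace E" "E \<subseteq> A" "E \<inter> (A \<inter> H) \<subseteq> {0}"
    "A = {e + b | e b. e \<in> E \<and> b \<in> A \<inter> H}" "M.dim E + M.dim (A \<inter> H) = M.dim A"
    by (rule M.complement_exists[OF fA M.subspace_inter[OF fA(2) subspace_H] Int_lower1])
  have finE: "finite E" using E(2) fA(1) by (rule finite_subset)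
  let ?d = "M.dim E"
  have "E \<inter> H \<subseteq> {0}" using E(2,3) by blast
  \<comment> \<open>The map kills all of \<open>H\<close> and not only \<open>A \<inter> H\<close>,
    because relations of some \<open>H1\<close> outside \<open>A\<close> have to vanish as
    well.\<close>
  then obtain \<pi> where \<pi>: "Vector_Spaces.linear sM sM \<pi>" "range \<pi> \<subseteq> E" "\<And>a. a \<in> E \<Longrightarrow> \<pi> a = a"
    "\<And>h. h \<in> H \<Longrightarrow> \<pi> h = 0"
    using M.projection_along_exists[OF E(1) subspace_H] by metis
  interpret L: Vector_Spaces.linear free_scale free_scale "ext_lift sM \<pi>"
    using \<pi>(1) by (rule M.linear_ext_lift)
  have L0: "ext_lift sM \<pi> x = 0" if "x \<in> ext H'" "H' \<subseteq> H" for x H'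
  proof -
    have "\<pi> ` H' \<subseteq> {0}" using \<pi>(4) that(2) by auto
    from M.ext_lift_in_ext_square[OF \<pi>(1) this that(1)] show ?thesis
      by (simp add: M.ext_square_zero)
  qed
  have fN: "finite (N A)" "free.subspace (N A)" "free.subspace (N (A \<inter> H))" "N (A \<inter> H) \<subseteq> N A"
    using fA(1) by (auto simp: finite_N subspace_N N_mono)
  obtain C where C: "free.subspace C" "C \<subseteq> N A" "C \<inter> N (A \<inter> H) \<subseteq> {0}"
    "N A = {c + b | c b. c \<in> C \<and> b \<in> N (A \<inter> H)}"
    "free.dim C + free.dim (N (A \<inter> H)) = free.dim (N A)"
    by (rule free.complement_exists[OF fN])
  \<comment> \<open>Equal predimensions say that passing from \<open>A \<inter> H\<close> to
    \<open>A\<close> adds \<open>k\<close> relations per new dimension, hence the dimension of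
    \<open>C\<close>.\<close>
  have "int k * int (M.dim A) = int k * int ?d + int k * int (M.dim (A \<inter> H))"
    unfolding E(5)[symmetric] by (simp add: algebra_simps)
  with A(2) C(5) have "int (free.dim C) = int k * int ?d"
    unfolding predim_def by linarith
  then have dimC: "free.dim C = k * ?d" by (metis of_nat_mult of_nat_eq_iff)
  have LN: "ext_lift sM \<pi> ` N A \<subseteq> ext_lift sM \<pi> ` C"
  proof
    fix y assume "y \<in> ext_lift sM \<pi> ` N A"
    then obtain n where n: "n \<in> N A" "y = ext_lift sM \<pi> n" by blast
    from n(1)[unfolded C(4)] n(2)
    obtain c b where "c \<in> C" "b \<in> N (A \<inter> H)" "y = ext_lift sM \<pi> (c + b)"
      by blast
    moreover from this have "ext_lift sM \<pi> b = 0" by (intro L0[of b "A \<inter> H"]) (auto simp: N_eq)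
    ultimately show "y \<in> ext_lift sM \<pi> ` C" by (auto simp: L.add)
  qed
  have finC: "finite C" using C(2) fN(1) by (rule finite_subset)
  let ?F = "\<lambda>(x, y). x + y :: 'm \<times> 'm \<Rightarrow>\<^sub>0 'f"
  have sub: "ext E \<subseteq> ?F ` (ext_lift sM \<pi> ` C \<times> wedge_sums T E)"
  proof
    fix u assume u: "u \<in> ext E"
    then have uA: "u \<in> ext A" using M.ext_square_mono[OF E(2)] by blast
    obtain D v where D: "zero_ext D" "card D \<le> T" "v \<in> ext D" "ext_map sW \<beta> v = ext_map sW \<beta> u"
      using T[OF zA uA] by blast
    have fD: "finite D" "M.subspace D" using D(1) by (auto simp: zero_ext_def fin_subspace_def)
    obtain S H1 where S: "A \<union> D \<subseteq> S" "H1 \<subseteq> H" "N S = free.span (N A \<union> N D \<union> N H1)"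
      using zero_ext_Un[OF zA D(1)] by metis
    interpret f: Vector_Spaces.linear free_scale sW "ext_map sW \<beta>" by (rule linear_ext_map)
    have "u \<in> ext S" "v \<in> ext S"
      using uA D(3) S(1) M.ext_square_mono[of A S] M.ext_square_mono[of D S] by auto
    \<comment> \<open>With the same value under \<open>\<beta>\<close>, the two elements differ by a
      relation of the joint space, and this relation splits over \<open>A\<close>, \<open>D\<close>
      and \<open>H1\<close>.\<close>
    then have "u - v \<in> N S"
      using D(4) by (auto simp: N_eq f.diff intro: free.subspace_diff[OF M.subspace_ext_square])
    moreover have "free.span (N A) = N A" "free.span (N D) = N D" "free.span (N H1) = N H1"
      using subspace_N by simp_all
    ultimately obtain a d h where adh: "u - v = a + d + h" "a \<in> N A" "d \<in> N D" "h \<in> N H1"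
      unfolding S(3) free.span_Un by auto
    have "v + d \<in> ext D"
      using D(3) adh(3) by (intro free.subspace_add[OF M.subspace_ext_square]) (auto simp: N_eq)
    then obtain y where y: "\<And>a. a \<in> D \<Longrightarrow> y a \<in> D" "v + d = (\<Sum>a\<in>D. wedge sM a (y a))"
      using M.ext_square_wedge_sum[OF fD] by metis
    have u_eq: "u = a + (v + d) + h" using adh(1) by (simp add: algebra_simps)
    \<comment> \<open>The map fixes \<open>u\<close>, kills \<open>h\<close>, and turns
      \<open>v + d\<close> into at most \<open>T\<close> products of elements of
      \<open>E\<close>.\<close>
    have "u = ext_lift sM \<pi> (a + (v + d) + h)"
      using M.ext_lift_id[OF \<pi>(1) \<pi>(3) u] by (simp only: u_eq[symmetric])
    also have "\<dots> = ext_lift sM \<pi> a + ext_lift sM \<pi> (v + d)"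
      using L0[of h H1] adh(4) S(2) by (simp add: L.add N_eq)
    also have "ext_lift sM \<pi> (v + d) = (\<Sum>a\<in>D. wedge sM (\<pi> a) (\<pi> (y a)))"
      unfolding y(2) by (simp add: L.sum M.ext_lift_wedge[OF \<pi>(1)])
    finally have "u = ext_lift sM \<pi> a + (\<Sum>a\<in>D. wedge sM (\<pi> a) (\<pi> (y a)))" .
    moreover have "(\<Sum>a\<in>D. wedge sM (\<pi> a) (\<pi> (y a))) \<in> wedge_sums T E"
      using fD(1) D(2) \<pi>(2) M.subspace_0[OF E(1)] by (intro sum_wedge_in_wedge_sums) auto
    moreover have "ext_lift sM \<pi> a \<in> ext_lift sM \<pi> ` C" using adh(2) LN by blast
    ultimately show "u \<in> ?F ` (ext_lift sM \<pi> ` C \<times> wedge_sums T E)" by blast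
  qed
  have fin: "finite (ext_lift sM \<pi> ` C \<times> wedge_sums T E)"
    using finC finite_wedge_sums[OF finE] by simp
  have "card (ext E) \<le> card (ext_lift sM \<pi> ` C \<times> wedge_sums T E)"
    using surj_card_le[OF fin sub] .
  also have "\<dots> \<le> card C * card E ^ (2 * T)"
    unfolding card_cartesian_product
    by (intro mult_le_mono card_image_le[OF finC] card_wedge_sums_le[OF finE])
  also have "\<dots> = CARD('f) ^ (k * ?d + ?d * (2 * T))"
    using free.card_subspace[OF finC C(1)] M.card_subspace[OF finE E(1)]
    by (simp add: dimC power_add power_mult[symmetric])
  finally have upper: "card (ext E) \<le> CARD('f) ^ (k * ?d + ?d * (2 * T))" .
  let ?m = "?d div 2"
  have "CARD('f) ^ (?m * ?m) \<le> card (ext E)"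
    by (rule M.card_ext_square_ge[OF finE E(1)]) simp
  with upper have "CARD('f) ^ (?m * ?m) \<le> CARD('f) ^ (k * ?d + ?d * (2 * T))" by (rule order_trans[rotated])
  then have le: "?m * ?m \<le> (k + 2 * T) * ?d"
    using M.card_field_gt_1 by (simp add: algebra_simps)
  \<comment> \<open>With \<open>m = d div 2\<close> positive, \<open>d \<le> 3 * m\<close>, so
    cancelling \<open>m\<close> gives \<open>m \<le> 3 * (k + 2 * T)\<close>; then
    \<open>d \<le> 2 * m + 1\<close>.\<close>
  have "?d \<le> 6 * (k + 2 * T) + 1"
  proof (cases "?m = 0")
    case False
    then have "?d \<le> 3 * ?m" by linarith
    then have "(k + 2 * T) * ?d \<le> (k + 2 * T) * (3 * ?m)" by (rule mult_le_mono2)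
    from order_trans[OF le this] have "?m * ?m \<le> (3 * (k + 2 * T)) * ?m" by (simp add: algebra_simps)
    with False have "?m \<le> 3 * (k + 2 * T)" by simp
    then show ?thesis by linarith
  qed linarith
  with E(5) show ?thesis by linarith
qed

end

context selfsufficient_subspace
begin

text \<open>Too many cosets would have representatives in one zero extension \<open>A\<close>. They
  would be distinct modulo \<open>A \<inter> H\<close>, hence represented in a complement whose
  dimension is bounded.\<close>

lemma finite_cl_quotient:
  assumes T: "\<And>A u. zero_ext A \<Longrightarrow> u \<in> ext A \<Longrightarrow>
      \<exists>D v. zero_ext D \<and> card D \<le> T \<and> v \<in> ext D \<and> ext_map sW \<beta> v = ext_map sW \<beta> u"
  shows "finite (cl k H // {(x, y). x - y \<in> H})"
proof (rule ccontr)
  let ?r = "{(x, y). x - y \<in> H}" and ?K = "6 * (k + 2 * T) + 1"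
  assume "infinite (cl k H // ?r)"
  then obtain Q where Q: "finite Q" "card Q = Suc (CARD('f) ^ ?K)" "Q \<subseteq> cl k H // ?r"
    using infinite_arbitrarily_large by blast
  have "\<forall>c\<in>Q. \<exists>x. x \<in> cl k H \<and> c = ?r `` {x}"
    using Q(3) by (auto simp: quotient_def)
  then obtain x where x: "\<And>c. c \<in> Q \<Longrightarrow> x c \<in> cl k H" "\<And>c. c \<in> Q \<Longrightarrow> c = ?r `` {x c}"
    by metis
  obtain A0 where A0: "zero_ext A0" "x ` Q \<subseteq> A0"
    using finite_subset_cl[of "x ` Q"] Q(1) x(1) by blast
  obtain A where A: "fin_subspace A" "A0 \<subseteq> A" "predim A = predim (A \<inter> H)"
    using zero_ext_extend[OF A0(1)] by blast
  have fA: "finite A" "M.subspace A" using A(1) by (auto simp: fin_subspace_def)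
  obtain E where E: "M.subspace E" "E \<subseteq> A" "E \<inter> (A \<inter> H) \<subseteq> {0}"
    "A = {e + b | e b. e \<in> E \<and> b \<in> A \<inter> H}" "M.dim E + M.dim (A \<inter> H) = M.dim A"
    by (rule M.complement_exists[OF fA M.subspace_inter[OF fA(2) subspace_H] Int_lower1])
  have finE: "finite E" using E(2) fA(1) by (rule finite_subset)
  have "Q \<subseteq> (\<lambda>e. ?r `` {e}) ` E"
  proof
    fix c assume c: "c \<in> Q"
    then have "x c \<in> A" using A0(2) A(2) by blast
    then have "x c \<in> {e + b | e b. e \<in> E \<and> b \<in> A \<inter> H}" using E(4) by (rule subst[rotated])
    then obtain e b where eb: "e \<in> E" "b \<in> H" "x c = e + b" by blast
    have "e + b - y \<in> H \<longleftrightarrow> e - y \<in> H" for y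
      using M.subspace_add[OF subspace_H _ eb(2), of "e - y"]
        M.subspace_diff[OF subspace_H _ eb(2), of "e + b - y"] by (auto simp: algebra_simps)
    then have "?r `` {x c} = ?r `` {e}" by (auto simp: eb(3))
    with x(2)[OF c] eb(1) show "c \<in> (\<lambda>e. ?r `` {e}) ` E" by auto
  qed
  from surj_card_le[OF finE this] have "card Q \<le> CARD('f) ^ M.dim E"
    using M.card_subspace[OF finE E(1)] by simp
  also have "\<dots> \<le> CARD('f) ^ ?K"
  proof (rule power_increasing)
    have "M.dim A \<le> M.dim (A \<inter> H) + 6 * (k + 2 * T) + 1"
      by (rule dim_zero_ext_le[OF _ A(1,3)]) (rule T)
    with E(5) show "M.dim E \<le> ?K" by linarith
  qed simp
  finally show False using Q(2) by simp
qed

section \<open>Isomorphic copies of finite subspaces\<close>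

lemma predim_cong:
  assumes "fin_subspace A" "fin_subspace B" "card A = card B" "card (N A) = card (N B)"
  shows "predim A = predim B"
proof -
  have "CARD('f) ^ M.dim A = CARD('f) ^ M.dim B"
    using assms(1-3) by (simp add: M.card_subspace[symmetric] fin_subspace_def)
  moreover have "CARD('f) ^ free.dim (N A) = CARD('f) ^ free.dim (N B)"
    using assms by (simp add: free.card_subspace[symmetric] fin_subspace_def finite_N subspace_N)
  ultimately show ?thesis using M.card_field_gt_1 by (simp add: predim_def)
qed

lemma ext_square_combination:
  assumes "finite D" "x \<in> ext D"
  obtains c where "x = (\<Sum>(a, b)\<in>D \<times> D. free_scale (c (a, b)) (wedge sM a b))"
proof -
  have "\<exists>c. x = (\<Sum>(a, b)\<in>D \<times> D. free_scale (c (a, b)) (wedge sM a b))"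
    using assms(2) unfolding ext_square_def
  proof (induction rule: free.span_induct_alt)
    case base
    show ?case by (intro exI[of _ "\<lambda>_. 0"]) (simp add: case_prod_beta)
  next
    case (step r x z)
    then obtain a b c where ab: "x = wedge sM a b" "a \<in> D" "b \<in> D"
      and c: "z = (\<Sum>(a, b)\<in>D \<times> D. free_scale (c (a, b)) (wedge sM a b))" by blast
    let ?c = "\<lambda>p. c p + (if p = (a, b) then r else 0)"
    have "(\<Sum>p\<in>D \<times> D. free_scale (?c p) (wedge sM (fst p) (snd p))) =
        (\<Sum>p\<in>D \<times> D. free_scale (c p) (wedge sM (fst p) (snd p)) +
          (if p = (a, b) then free_scale r (wedge sM a b) else 0))"
      by (intro sum.cong) (auto simp: free.scale_left_distrib)
    also have "\<dots> = z + free_scale r x"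
      using assms(1) ab by (simp add: sum.distrib c case_prod_beta)
    finally have 1: "(\<Sum>p\<in>D \<times> D. free_scale (?c p) (wedge sM (fst p) (snd p))) = z + free_scale r x" .
    have 2: "(\<Sum>(a, b)\<in>D \<times> D. free_scale (?c (a, b)) (wedge sM a b)) =
        (\<Sum>p\<in>D \<times> D. free_scale (?c p) (wedge sM (fst p) (snd p)))"
      by (intro sum.cong) (auto split: if_splits)
    have "free_scale r x + z = (\<Sum>(a, b)\<in>D \<times> D. free_scale (?c (a, b)) (wedge sM a b))"
      by (rule trans[OF add.commute trans[OF 1[symmetric] 2[symmetric]]])
    then show ?case by (intro exI[of _ ?c])
  qed
  with that show thesis by blast
qed

text \<open>For finite \<open>D\<close> this is a finite list of first-order conditions. The last
  one determines the relations of the image without naming the exterior square; extensional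
  coefficient functions keep the list finite.\<close>

definition diagram_iso :: "'m set \<Rightarrow> ('m \<Rightarrow> 'm) \<Rightarrow> bool" where
  "diagram_iso D g \<longleftrightarrow>
     (\<forall>a\<in>D. \<forall>b\<in>D. g (a + b) = g a + g b) \<and>
     (\<forall>c. \<forall>a\<in>D. g (sM c a) = sM c (g a)) \<and>
     (\<forall>a\<in>D. g a = 0 \<longrightarrow> a = 0) \<and>
     (\<forall>a\<in>D. g a \<in> H \<longleftrightarrow> a \<in> H) \<and>
     (\<forall>c\<in>PiE (D \<times> D) (\<lambda>_. UNIV).
       (\<Sum>(a, b)\<in>D \<times> D. sW (c (a, b)) (\<beta> (g a) (g b))) = 0 \<longleftrightarrow>
       (\<Sum>(a, b)\<in>D \<times> D. sW (c (a, b)) (\<beta> a b)) = 0)"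

lemma diagram_iso_id: "diagram_iso D (\<lambda>a. a)"
  by (simp add: diagram_iso_def)

lemma diagram_iso_cong:
  assumes "M.subspace D" "\<And>a. a \<in> D \<Longrightarrow> g a = g' a"
  shows "diagram_iso D g = diagram_iso D g'"
proof -
  have "(\<Sum>(a, b)\<in>D \<times> D. sW (c (a, b)) (\<beta> (g a) (g b))) =
      (\<Sum>(a, b)\<in>D \<times> D. sW (c (a, b)) (\<beta> (g' a) (g' b)))" for c
    using assms(2) by (intro sum.cong) auto
  then show ?thesis
    using assms by (simp add: diagram_iso_def M.subspace_add M.subspace_scale)
qed

text \<open>Extended to a linear map with a left inverse on \<open>D\<close>, \<open>g\<close>
  induces bijections from \<open>N D'\<close> to the relations of the image, both for
  \<open>D' = D\<close> and for \<open>D' = D \<inter> H\<close>. Cardinalities determine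
  predimensions.\<close>

lemma zero_ext_image:
  assumes D: "zero_ext D" and g: "diagram_iso D g"
  shows "zero_ext (g ` D)"
proof -
  have fD: "finite D" "M.subspace D" using D by (auto simp: zero_ext_def fin_subspace_def)
  have add: "\<And>a b. a \<in> D \<Longrightarrow> b \<in> D \<Longrightarrow> g (a + b) = g a + g b"
    and scale: "\<And>c a. a \<in> D \<Longrightarrow> g (sM c a) = sM c (g a)"
    and zero: "\<And>a. a \<in> D \<Longrightarrow> g a = 0 \<Longrightarrow> a = 0"
    and H: "\<And>a. a \<in> D \<Longrightarrow> g a \<in> H \<longleftrightarrow> a \<in> H"
    using g unfolding diagram_iso_def by blast+
  have rel: "(\<Sum>(a, b)\<in>D \<times> D. sW (c (a, b)) (\<beta> (g a) (g b))) = 0 \<longleftrightarrow>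
       (\<Sum>(a, b)\<in>D \<times> D. sW (c (a, b)) (\<beta> a b)) = 0" for c
  proof -
    let ?c = "restrict c (D \<times> D)"
    have c: "(\<Sum>(a, b)\<in>D \<times> D. sW (c (a, b)) (f a b)) = (\<Sum>(a, b)\<in>D \<times> D. sW (?c (a, b)) (f a b))" for f
      by (intro sum.cong) auto
    have "\<forall>c\<in>PiE (D \<times> D) (\<lambda>_. UNIV).
       (\<Sum>(a, b)\<in>D \<times> D. sW (c (a, b)) (\<beta> (g a) (g b))) = 0 \<longleftrightarrow>
       (\<Sum>(a, b)\<in>D \<times> D. sW (c (a, b)) (\<beta> a b)) = 0"
      using g unfolding diagram_iso_def by blast
    moreover have "?c \<in> PiE (D \<times> D) (\<lambda>_. UNIV)" by auto
    ultimately show ?thesis unfolding c by (rule bspec)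
  qed
  obtain G where G: "Vector_Spaces.linear sM sM G" "\<And>a. a \<in> D \<Longrightarrow> G a = g a"
    using M.linear_extension_exists[OF fD(2) add scale] by metis
  interpret G: Vector_Spaces.linear sM sM G by (fact G(1))
  have inj: "inj_on G D"
  proof (rule inj_onI)
    fix a b assume "a \<in> D" "b \<in> D" "G a = G b"
    then have "g (a - b) = 0" "a - b \<in> D"
      using G(2)[of "a - b"] fD(2) by (auto simp: G.diff M.subspace_diff)
    with zero[of "a - b"] show "a = b" by simp
  qed
  obtain G' where G': "Vector_Spaces.linear sM sM G'" "\<And>a. a \<in> D \<Longrightarrow> G' (G a) = a"
    using M.left_inverse_exists[OF G(1) fD(2) inj] by metis
  interpret L: Vector_Spaces.linear free_scale free_scale "ext_lift sM G"
    using G(1) by (rule M.linear_ext_lift)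
  interpret f: Vector_Spaces.linear free_scale sW "ext_map sW \<beta>" by (rule linear_ext_map)
  have lift: "ext_map sW \<beta> (ext_lift sM G x) = 0 \<longleftrightarrow> ext_map sW \<beta> x = 0" if x: "x \<in> ext D" for x
  proof -
    obtain c where c: "x = (\<Sum>(a, b)\<in>D \<times> D. free_scale (c (a, b)) (wedge sM a b))"
      using ext_square_combination[OF fD(1) x] by blast
    have "ext_map sW \<beta> x = (\<Sum>(a, b)\<in>D \<times> D. sW (c (a, b)) (\<beta> a b))"
      unfolding c by (simp add: f.sum f.scale ext_map_wedge case_prod_beta)
    moreover have "ext_map sW \<beta> (ext_lift sM G x) = (\<Sum>(a, b)\<in>D \<times> D. sW (c (a, b)) (\<beta> (G a) (G b)))"
      unfolding c by (simp add: L.sum L.scale f.sum f.scale M.ext_lift_wedge[OF G(1)] ext_map_wedge case_prod_beta)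
    moreover have "\<dots> = (\<Sum>(a, b)\<in>D \<times> D. sW (c (a, b)) (\<beta> (g a) (g b)))"
      using G(2) by (intro sum.cong) auto
    ultimately show ?thesis using rel[of c] by simp
  qed
  have image: "fin_subspace (G ` D') \<and> predim (G ` D') = predim D'" if D': "M.subspace D'" "D' \<subseteq> D" for D'
  proof -
    have fD': "fin_subspace D'" using D' fD(1) by (auto simp: fin_subspace_def intro: finite_subset)
    have "M.subspace (G ` D')" using D'(1) by (rule G.subspace_image)
    with fD' have fG: "fin_subspace (G ` D')" by (simp add: fin_subspace_def)
    have extD: "ext D' \<subseteq> ext D" using D'(2) by (rule M.ext_square_mono)
    have GG': "G (G' y) = y" if "y \<in> G ` D'" for y using that G'(2) D'(2) by auto
    have "bij_betw (ext_lift sM G) (N D') (N (G ` D'))"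
    proof (rule bij_betw_byWitness[where f' = "ext_lift sM G'"])
      show "\<forall>x\<in>N D'. ext_lift sM G' (ext_lift sM G x) = x"
        using M.ext_lift_left_inverse[OF G(1) G'(1) G'(2), of D'] D'(2) by (auto simp: N_eq)
      show "\<forall>y\<in>N (G ` D'). ext_lift sM G (ext_lift sM G' y) = y"
        using M.ext_lift_left_inverse[OF G'(1) G(1) GG'] by (auto simp: N_eq)
      show "ext_lift sM G ` N D' \<subseteq> N (G ` D')"
        using lift extD M.ext_lift_in_ext_square[OF G(1) subset_refl] by (auto simp: N_eq)
      show "ext_lift sM G' ` N (G ` D') \<subseteq> N D'"
      proof
        fix x assume "x \<in> ext_lift sM G' ` N (G ` D')"
        then obtain y where y: "y \<in> ext (G ` D')" "ext_map sW \<beta> y = 0" "x = ext_lift sM G' y"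
          by (auto simp: N_eq)
        have "G' ` G ` D' \<subseteq> D'" using G'(2) D'(2) by auto
        then have "x \<in> ext D'" unfolding y(3) using M.ext_lift_in_ext_square[OF G'(1) _ y(1)] by blast
        moreover have "ext_lift sM G x = y"
          unfolding y(3) using M.ext_lift_left_inverse[OF G'(1) G(1) GG' y(1)] .
        ultimately show "x \<in> N D'" using lift[of x] extD y(2) by (auto simp: N_eq)
      qed
    qed
    then have "card (N D') = card (N (G ` D'))" by (rule bij_betw_same_card)
    moreover have "card (G ` D') = card D'"
      using inj D'(2) by (intro card_image) (rule inj_on_subset)
    ultimately show ?thesis using predim_cong[OF fG fD'] fG by simp
  qed
  have gG: "g ` D = G ` D" using G(2) by auto
  have "G ` D \<inter> H = G ` (D \<inter> H)" using G(2) H by auto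
  moreover have "M.subspace (D \<inter> H)" using fD(2) subspace_H by (rule M.subspace_inter)
  ultimately show ?thesis
    using D image[OF fD(2) subset_refl] image[of "D \<inter> H"] unfolding gG zero_ext_def by simp
qed

end

section \<open>Definability\<close>

context full_structure
begin

text \<open>The place \<open>Suc i\<close> holds the \<open>i\<close>-th element as a parameter;
  place 0 is the defined variable.\<close>

lemma finite_definable:
  assumes "finite X"
  shows "definable_over S X {} X"
proof -
  obtain h where h: "bij_betw h {0..<card X} X"
    using ex_bij_betw_nat_finite[OF assms] by blast
  have "fo (insert 0 (Suc ` {0..<card X})) {} (\<lambda>e f. \<exists>i\<in>{0..<card X}. e 0 = e (Suc i))"
    by (intro fo_Bex fo_mvar_eq) auto
  then obtain \<phi> where \<phi>: "free_mvars \<phi> \<subseteq> insert 0 (Suc ` {0..<card X})" "free_wvars \<phi> \<subseteq> {}"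
    "\<And>e f. (\<exists>i\<in>{0..<card X}. e 0 = e (Suc i)) = sat S e f \<phi>"
    by (rule foE) blast
  let ?e = "\<lambda>i. h (i - 1)"
  have "?e i \<in> X" if "i \<in> free_mvars \<phi> - {0}" for i
  proof -
    from that \<phi>(1) obtain j where "i = Suc j" "j \<in> {0..<card X}" by blast
    with h show ?thesis by (auto simp: bij_betw_def)
  qed
  moreover have "X = {a \<in> mcarrier S. sat S (?e(0 := a)) undefined \<phi>}"
    using h unfolding \<phi>(3)[symmetric] by (auto simp: bij_betw_def)
  ultimately show ?thesis
    using \<phi>(2) unfolding definable_over_def
    by (intro exI[of _ \<phi>] exI[of _ ?e] exI[of _ undefined]) blast
qed

end

lemma definable_over_mono:
  assumes "definable_over S P Q X" "P \<subseteq> P'" "Q \<subseteq> Q'"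
  shows "definable_over S P' Q' X"
proof -
  from assms(1) obtain \<phi> e f where "\<forall>i\<in>free_mvars \<phi> - {0}. e i \<in> P" "\<forall>j\<in>free_wvars \<phi>. f j \<in> Q"
    "X = {a \<in> mcarrier S. sat S (e(0 := a)) f \<phi>}"
    unfolding definable_over_def by (elim exE conjE)
  with assms(2,3) show ?thesis
    unfolding definable_over_def by (intro exI[of _ \<phi>] exI[of _ e] exI[of _ f]) auto
qed

locale definable_subspace = selfsufficient_subspace sM sW \<beta> k H
  for sM :: "'f::{field,finite} \<Rightarrow> 'm::ab_group_add \<Rightarrow> 'm"
    and sW :: "'f \<Rightarrow> 'w::ab_group_add \<Rightarrow> 'w" and \<beta> k and H :: "'m set" +
  fixes \<phi>\<^sub>0 :: "'f form" and e\<^sub>0 :: "nat \<Rightarrow> 'm" and f\<^sub>0 :: "nat \<Rightarrow> 'w"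
  assumes categorical: "aleph0_categorical (theory_of (bilinear_structure sM sW \<beta>))"
    and H_eq: "H = {a. sat (bilinear_structure sM sW \<beta>) (e\<^sub>0(0 := a)) f\<^sub>0 \<phi>\<^sub>0}"

sublocale definable_subspace \<subseteq> S: countable_structure "bilinear_structure sM sW \<beta>"
  by unfold_locales (simp_all add: bilinear_structure_def)

context definable_subspace
begin

abbreviation "S \<equiv> bilinear_structure sM sW \<beta>"

lemma S_simps [simp]:
  "mzero S = 0" "madd S = (+)" "mscale S = sM" "wzero S = 0" "wadd S = (+)" "wscale S = sW" "beta S = \<beta>"
  by (simp_all add: bilinear_structure_def)

definition V\<^sub>0 :: "nat set" where
  "V\<^sub>0 = free_mvars \<phi>\<^sub>0 - {0}"

text \<open>Formulas about \<open>H\<close> are interpreted only at such assignments, since with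
  other parameters \<open>\<phi>\<^sub>0\<close> defines another set.\<close>

definition same_parameters :: "(nat \<Rightarrow> 'm) \<Rightarrow> (nat \<Rightarrow> 'w) \<Rightarrow> bool" where
  "same_parameters e f \<longleftrightarrow> (\<forall>i\<in>V\<^sub>0. e i = e\<^sub>0 i) \<and> (\<forall>j\<in>free_wvars \<phi>\<^sub>0. f j = f\<^sub>0 j)"

lemma sat_H: "same_parameters e f \<Longrightarrow> sat S (e(0 := a)) f \<phi>\<^sub>0 \<longleftrightarrow> a \<in> H"
  unfolding H_eq mem_Collect_eq by (intro sat_cong) (auto simp: same_parameters_def V\<^sub>0_def)

lemma fo_H: "S.fo (insert i V\<^sub>0) (free_wvars \<phi>\<^sub>0) (\<lambda>e f. sat S (e(0 := e i)) f \<phi>\<^sub>0)"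
proof -
  have "S.fo ((id(0 := i)) ` free_mvars \<phi>\<^sub>0) (id ` free_wvars \<phi>\<^sub>0) (\<lambda>e f. sat S (e \<circ> id(0 := i)) (f \<circ> id) \<phi>\<^sub>0)"
    by (intro S.fo_rename S.fo_sat) auto
  moreover have "e \<circ> id(0 := i) = e(0 := e i)" for e :: "nat \<Rightarrow> 'm" by auto
  ultimately have "S.fo ((id(0 := i)) ` free_mvars \<phi>\<^sub>0) (id ` free_wvars \<phi>\<^sub>0) (\<lambda>e f. sat S (e(0 := e i)) f \<phi>\<^sub>0)"
    by simp
  then show ?thesis by (rule S.fo_mono) (auto simp: V\<^sub>0_def)
qed

lemma beta_sum_term:
  assumes "finite I"
  obtains t where "wterm_mvars t \<subseteq> p ` I \<union> q ` I" "wterm_wvars t = {}"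
    "\<And>e f. wval S e f t = (\<Sum>i\<in>I. sW (c i) (\<beta> (e (p i)) (e (q i))))"
proof -
  have "\<exists>t. wterm_mvars t \<subseteq> p ` I \<union> q ` I \<and> wterm_wvars t = {} \<and>
      (\<forall>e f. wval S e f t = (\<Sum>i\<in>I. sW (c i) (\<beta> (e (p i)) (e (q i)))))"
    using assms
  proof (induction I rule: finite_induct)
    case empty
    show ?case by (intro exI[of _ WZero]) auto
  next
    case (insert i I)
    then obtain t where "wterm_mvars t \<subseteq> p ` I \<union> q ` I" "wterm_wvars t = {}"
      "\<forall>e f. wval S e f t = (\<Sum>i\<in>I. sW (c i) (\<beta> (e (p i)) (e (q i))))" by blast
    then show ?case
      using insert.hyps
      by (intro exI[of _ "WAdd (WScale (c i) (Beta (MVar (p i)) (MVar (q i)))) t"]) auto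
  qed
  with that show thesis by blast
qed

lemma
  assumes "finite D"
  shows fo_beta_sum_eq_0: "S.fo (\<iota> ` D) {} (\<lambda>e f. (\<Sum>(a, b)\<in>D \<times> D. sW (c (a, b)) (\<beta> (e (\<iota> a)) (e (\<iota> b)))) = 0)"
    and fo_beta_sum_eq_wvar:
      "S.fo (\<iota> ` D) {u} (\<lambda>e f. f u = (\<Sum>(a, b)\<in>D \<times> D. sW (c (a, b)) (\<beta> (e (\<iota> a)) (e (\<iota> b)))))"
proof -
  obtain t where t: "wterm_mvars t \<subseteq> (\<lambda>p. \<iota> (fst p)) ` (D \<times> D) \<union> (\<lambda>p. \<iota> (snd p)) ` (D \<times> D)" "wterm_wvars t = {}"
    "\<And>e f. wval S e f t = (\<Sum>p\<in>D \<times> D. sW (c p) (\<beta> (e (\<iota> (fst p))) (e (\<iota> (snd p)))))"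
    using assms by (auto intro: beta_sum_term[of "D \<times> D" "\<lambda>p. \<iota> (fst p)" "\<lambda>p. \<iota> (snd p)" c])
  have sum: "wval S e f t = (\<Sum>(a, b)\<in>D \<times> D. sW (c (a, b)) (\<beta> (e (\<iota> a)) (e (\<iota> b))))" for e f
    unfolding t(3) by (intro sum.cong) auto
  have sub: "wterm_mvars t \<subseteq> \<iota> ` D" using t(1) by auto
  show "S.fo (\<iota> ` D) {} (\<lambda>e f. (\<Sum>(a, b)\<in>D \<times> D. sW (c (a, b)) (\<beta> (e (\<iota> a)) (e (\<iota> b)))) = 0)"
    using sub t(2) by (intro S.foI[of "WEq t WZero"]) (simp_all add: sum)
  show "S.fo (\<iota> ` D) {u} (\<lambda>e f. f u = (\<Sum>(a, b)\<in>D \<times> D. sW (c (a, b)) (\<beta> (e (\<iota> a)) (e (\<iota> b)))))"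
    using sub t(2) by (intro S.foI[of "WEq (WVar u) t"]) (simp_all add: sum)
qed

text \<open>The variable \<open>\<iota> a\<close> stands for the image of \<open>a\<close>.\<close>

definition diagram :: "'m set \<Rightarrow> ('m \<Rightarrow> nat) \<Rightarrow> (nat \<Rightarrow> 'm) \<Rightarrow> (nat \<Rightarrow> 'w) \<Rightarrow> bool" where
  "diagram D \<iota> e f \<longleftrightarrow>
     (\<forall>a\<in>D. \<forall>b\<in>D. e (\<iota> (a + b)) = e (\<iota> a) + e (\<iota> b)) \<and>
     (\<forall>c\<in>UNIV. \<forall>a\<in>D. e (\<iota> (sM c a)) = sM c (e (\<iota> a))) \<and>
     (\<forall>a\<in>D. \<not> e (\<iota> a) = 0 \<or> a = 0) \<and>
     (\<forall>a\<in>D. sat S (e(0 := e (\<iota> a))) f \<phi>\<^sub>0 \<longleftrightarrow> a \<in> H) \<and>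
     (\<forall>c\<in>PiE (D \<times> D) (\<lambda>_. UNIV).
       (\<Sum>(a, b)\<in>D \<times> D. sW (c (a, b)) (\<beta> (e (\<iota> a)) (e (\<iota> b)))) = 0 \<longleftrightarrow>
       (\<Sum>(a, b)\<in>D \<times> D. sW (c (a, b)) (\<beta> a b)) = 0)"

lemma diagram_iff:
  assumes "same_parameters e f"
  shows "diagram D \<iota> e f \<longleftrightarrow> diagram_iso D (\<lambda>a. e (\<iota> a))"
  unfolding diagram_def diagram_iso_def sat_H[OF assms] by blast

lemma fo_diagram:
  assumes "fin_subspace D"
  shows "S.fo (\<iota> ` D \<union> V\<^sub>0) (free_wvars \<phi>\<^sub>0) (diagram D \<iota>)"
proof -
  have D: "finite D" "M.subspace D" using assms by (auto simp: fin_subspace_def)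
  have "S.fo (\<iota> ` D \<union> V\<^sub>0) (free_wvars \<phi>\<^sub>0) (\<lambda>e f. e (\<iota> (a + b)) = e (\<iota> a) + e (\<iota> b))" if "a \<in> D" "b \<in> D" for a b
    using that M.subspace_add[OF D(2) that]
    by (intro S.foI[of "MEq (MVar (\<iota> (a + b))) (MAdd (MVar (\<iota> a)) (MVar (\<iota> b)))"]) auto
  moreover have "S.fo (\<iota> ` D \<union> V\<^sub>0) (free_wvars \<phi>\<^sub>0) (\<lambda>e f. e (\<iota> (sM c a)) = sM c (e (\<iota> a)))" if "a \<in> D" for c a
    using that M.subspace_scale[OF D(2) that]
    by (intro S.foI[of "MEq (MVar (\<iota> (sM c a))) (MScale c (MVar (\<iota> a)))"]) auto
  moreover have "S.fo (\<iota> ` D \<union> V\<^sub>0) (free_wvars \<phi>\<^sub>0) (\<lambda>e f. e (\<iota> a) = 0)" if "a \<in> D" for a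
    using that by (intro S.foI[of "MEq (MVar (\<iota> a)) MZero"]) auto
  moreover have "S.fo (\<iota> ` D \<union> V\<^sub>0) (free_wvars \<phi>\<^sub>0) (\<lambda>e f. sat S (e(0 := e (\<iota> a))) f \<phi>\<^sub>0)" if "a \<in> D" for a
    by (rule S.fo_mono[OF fo_H[of "\<iota> a"]]) (use that in auto)
  moreover have "S.fo (\<iota> ` D \<union> V\<^sub>0) (free_wvars \<phi>\<^sub>0)
      (\<lambda>e f. (\<Sum>(a, b)\<in>D \<times> D. sW (c (a, b)) (\<beta> (e (\<iota> a)) (e (\<iota> b)))) = 0)" for c
    by (rule S.fo_mono[OF fo_beta_sum_eq_0[OF D(1)]]) auto
  moreover have "finite (PiE (D \<times> D) (\<lambda>_. UNIV :: 'f set))"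
    using D(1) by (auto intro: finite_PiE)
  ultimately show ?thesis
    unfolding diagram_def using D(1)
    by (intro S.fo_conj S.fo_Ball S.fo_disj S.fo_not S.fo_iff S.fo_const) auto
qed

lemma diagram_variables:
  assumes "finite D" "finite V"
  obtains \<iota> :: "'m \<Rightarrow> nat" where "inj_on \<iota> D" "\<iota> ` D \<inter> V = {}"
proof -
  obtain n where n: "V \<subseteq> {..<n}" using assms(2) finite_nat_iff_bounded by blast
  obtain h where h: "bij_betw h D {0..<card D}"
    using ex_bij_betw_finite_nat[OF assms(1)] by blast
  have "inj_on (\<lambda>a. n + h a) D" "(\<lambda>a. n + h a) ` D \<inter> V = {}"
    using h n by (auto simp: bij_betw_def inj_on_def)
  with that show thesis by blast
qed

text \<open>The variables for the copy of \<open>D\<close> are quantified away, so \<open>V\<close>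
  and \<open>U\<close> do not depend on \<open>D\<close>. Hence the relations for all
  \<open>D\<close> together form a family to which \<open>finite_union_fo\<close> applies.\<close>

lemma fo_ex_diagram_iso:
  assumes D: "fin_subspace D" and V: "finite V" "V\<^sub>0 \<subseteq> V" and U: "free_wvars \<phi>\<^sub>0 \<subseteq> U"
    and R: "\<And>\<iota>. \<iota> ` D \<inter> V = {} \<Longrightarrow> S.fo (\<iota> ` D \<union> V) U (R \<iota>)"
    and R_eq: "\<And>\<iota> e f. \<iota> ` D \<inter> V = {} \<Longrightarrow> R \<iota> e f \<longleftrightarrow> R' (\<lambda>a. e (\<iota> a)) e f"
    and R'_cong: "\<And>g g' e e' f. (\<And>a. a \<in> D \<Longrightarrow> g a = g' a) \<Longrightarrow> (\<And>i. i \<in> V \<Longrightarrow> e i = e' i) \<Longrightarrow> R' g e f \<longleftrightarrow> R' g' e' f"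
  obtains Q where "S.fo V U Q"
    "\<And>e f. same_parameters e f \<Longrightarrow> Q e f \<longleftrightarrow> (\<exists>g. diagram_iso D g \<and> R' g e f)"
proof -
  have fD: "finite D" "M.subspace D" using D by (auto simp: fin_subspace_def)
  obtain \<iota> :: "'m \<Rightarrow> nat" where \<iota>: "inj_on \<iota> D" "\<iota> ` D \<inter> V = {}"
    using diagram_variables[OF fD(1) V(1)] by blast
  let ?I = "\<iota> ` D"
  let ?P = "\<lambda>e f. diagram D \<iota> e f \<and> R \<iota> e f"
  have "S.fo (?I \<union> V) U ?P"
    using V U by (intro S.fo_conj R \<iota>(2) S.fo_mono[OF fo_diagram[OF D]]) auto
  from S.fo_MExs[OF finite_imageI[OF fD(1)] this]
  have Q: "S.fo (?I \<union> V - ?I) U (\<lambda>e f. \<exists>h. ?P (\<lambda>i. if i \<in> ?I then h i else e i) f)" .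
  have iff: "(\<exists>h. ?P (\<lambda>i. if i \<in> ?I then h i else e i) f) \<longleftrightarrow> (\<exists>g. diagram_iso D g \<and> R' g e f)"
    if e: "same_parameters e f" for e f
  proof -
    have "?P (\<lambda>i. if i \<in> ?I then h i else e i) f \<longleftrightarrow> diagram_iso D (\<lambda>a. h (\<iota> a)) \<and> R' (\<lambda>a. h (\<iota> a)) e f" for h
    proof -
      have "same_parameters (\<lambda>i. if i \<in> ?I then h i else e i) f"
        using e \<iota>(2) V(2) by (auto simp: same_parameters_def)
      moreover have "R' (\<lambda>a. if \<iota> a \<in> ?I then h (\<iota> a) else e (\<iota> a)) (\<lambda>i. if i \<in> ?I then h i else e i) f \<longleftrightarrow>
          R' (\<lambda>a. h (\<iota> a)) e f"
        using \<iota>(2) by (intro R'_cong) auto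
      moreover have "diagram_iso D (\<lambda>a. if \<iota> a \<in> ?I then h (\<iota> a) else e (\<iota> a)) = diagram_iso D (\<lambda>a. h (\<iota> a))"
        by (rule diagram_iso_cong[OF fD(2)]) simp
      ultimately show ?thesis using \<iota>(2) by (simp only: diagram_iff R_eq)
    qed
    moreover have "\<exists>h. diagram_iso D (\<lambda>a. h (\<iota> a)) \<and> R' (\<lambda>a. h (\<iota> a)) e f"
      if g: "diagram_iso D g" "R' g e f" for g
    proof -
      \<comment> \<open>Injectivity of \<open>\<iota>\<close> on \<open>D\<close> lets the values at
        the variables encode \<open>g\<close>.\<close>
      let ?h = "\<lambda>i. g (inv_into D \<iota> i)"
      have "g a = ?h (\<iota> a)" if "a \<in> D" for a using that \<iota>(1) by simp
      then have "diagram_iso D (\<lambda>a. ?h (\<iota> a))" "R' (\<lambda>a. ?h (\<iota> a)) e f"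
        using g diagram_iso_cong[OF fD(2), of g "\<lambda>a. ?h (\<iota> a)"] R'_cong[of g "\<lambda>a. ?h (\<iota> a)" e e f] by auto
      then show ?thesis by (intro exI[of _ ?h] conjI)
    qed
    ultimately show ?thesis by blast
  qed
  have "S.fo V U (\<lambda>e f. \<exists>h. ?P (\<lambda>i. if i \<in> ?I then h i else e i) f)"
    by (rule S.fo_mono[OF Q]) auto
  with iff that show thesis by blast
qed

lemma finite_V\<^sub>0: "finite V\<^sub>0"
  by (simp add: V\<^sub>0_def)

text \<open>For each \<open>D\<close> and coefficients \<open>c\<close>, the relation says that the
  element at place \<open>w\<close> is the corresponding combination in some copy of
  \<open>D\<close>. Finitely many pairs cover all such elements, and \<open>T\<close> is the largest
  \<open>card D\<close> among them.\<close>

lemma small_representation: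
  obtains T where "\<And>A u. zero_ext A \<Longrightarrow> u \<in> ext A \<Longrightarrow>
      \<exists>D v. zero_ext D \<and> card D \<le> T \<and> v \<in> ext D \<and> ext_map sW \<beta> v = ext_map sW \<beta> u"
proof -
  obtain w where w: "w \<notin> free_wvars \<phi>\<^sub>0"
    using ex_new_if_finite[OF infinite_UNIV_nat finite_free_wvars] by blast
  let ?U = "insert w (free_wvars \<phi>\<^sub>0)" and ?X = "{(D, c). zero_ext D}"
  let ?R' = "\<lambda>D c g (e :: nat \<Rightarrow> 'm) f. f w = (\<Sum>(a, b)\<in>D \<times> D. sW (c (a, b)) (\<beta> (g a) (g b)))"
  have "\<exists>Q. S.fo V\<^sub>0 ?U Q \<and> (\<forall>e f. same_parameters e f \<longrightarrow> Q e f = (\<exists>g. diagram_iso D g \<and> ?R' D c g e f))"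
    if D: "zero_ext D" for D c
  proof -
    have fD: "fin_subspace D" "finite D" using D by (auto simp: zero_ext_def fin_subspace_def)
    obtain Q where "S.fo V\<^sub>0 ?U Q" "\<And>e f. same_parameters e f \<Longrightarrow> Q e f = (\<exists>g. diagram_iso D g \<and> ?R' D c g e f)"
    proof (rule fo_ex_diagram_iso[OF fD(1) finite_V\<^sub>0 subset_refl, of ?U "\<lambda>\<iota> e f. ?R' D c (\<lambda>a. e (\<iota> a)) e f" "?R' D c"])
      show "S.fo (\<iota> ` D \<union> V\<^sub>0) ?U (\<lambda>e f. ?R' D c (\<lambda>a. e (\<iota> a)) e f)" for \<iota>
        by (rule S.fo_mono[OF fo_beta_sum_eq_wvar[OF fD(2)]]) auto
      show "?R' D c g e f \<longleftrightarrow> ?R' D c g' e' f" if "\<And>a. a \<in> D \<Longrightarrow> g a = g' a" for g g' e e' f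
      proof -
        have "(\<Sum>(a, b)\<in>D \<times> D. sW (c (a, b)) (\<beta> (g a) (g b))) = (\<Sum>(a, b)\<in>D \<times> D. sW (c (a, b)) (\<beta> (g' a) (g' b)))"
          using that by (intro sum.cong) auto
        then show ?thesis by simp
      qed
    qed auto
    then show ?thesis by blast
  qed
  then have "\<forall>p\<in>?X. \<exists>Q. S.fo V\<^sub>0 ?U Q \<and>
      (\<forall>e f. same_parameters e f \<longrightarrow> Q e f = (\<exists>g. diagram_iso (fst p) g \<and> ?R' (fst p) (snd p) g e f))"
    by auto
  from bchoice[OF this] obtain Q where "\<forall>p\<in>?X. S.fo V\<^sub>0 ?U (Q p) \<and>
      (\<forall>e f. same_parameters e f \<longrightarrow> Q p e f = (\<exists>g. diagram_iso (fst p) g \<and> ?R' (fst p) (snd p) g e f))" ..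
  then have Q: "\<And>p. p \<in> ?X \<Longrightarrow> S.fo V\<^sub>0 ?U (Q p)"
    "\<And>p e f. p \<in> ?X \<Longrightarrow> same_parameters e f \<Longrightarrow>
      Q p e f = (\<exists>g. diagram_iso (fst p) g \<and> ?R' (fst p) (snd p) g e f)"
    by blast+
  have fU: "finite ?U" by simp
  obtain \<R> where \<R>: "\<R> \<subseteq> Q ` ?X" "finite \<R>" "\<And>R e f. R \<in> Q ` ?X \<Longrightarrow> R e f \<Longrightarrow> \<exists>R\<in>\<R>. R e f"
    using S.finite_union_fo[OF categorical finite_V\<^sub>0 fU, of "Q ` ?X"] Q(1) by blast
  obtain F where F: "F \<subseteq> ?X" "finite F" "\<R> = Q ` F"
    using finite_subset_image[OF \<R>(2,1)] by blast
  show thesis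
  proof (rule that)
    fix A u assume A: "zero_ext A" and u: "u \<in> ext A"
    have fA: "finite A" using A by (simp add: zero_ext_def fin_subspace_def)
    obtain c where c: "u = (\<Sum>(a, b)\<in>A \<times> A. free_scale (c (a, b)) (wedge sM a b))"
      using ext_square_combination[OF fA u] by blast
    interpret f: Vector_Spaces.linear free_scale sW "ext_map sW \<beta>" by (rule linear_ext_map)
    \<comment> \<open>Only the value of \<open>u\<close> in \<open>W\<close> is placed at
      \<open>w\<close>, a variable that carries no parameter; \<open>A\<close> with the identity
      shows that it is covered.\<close>
    let ?f = "f\<^sub>0(w := ext_map sW \<beta> u)"
    have par: "same_parameters e\<^sub>0 ?f" using w by (auto simp: same_parameters_def)
    have "ext_map sW \<beta> u = (\<Sum>(a, b)\<in>A \<times> A. sW (c (a, b)) (\<beta> a b))"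
      unfolding c by (simp add: f.sum f.scale ext_map_wedge case_prod_beta)
    then have "Q (A, c) e\<^sub>0 ?f"
      using A diagram_iso_id by (subst Q(2)[OF _ par]) (auto intro!: exI[of _ "\<lambda>a. a"])
    then have "\<exists>R\<in>\<R>. R e\<^sub>0 ?f" using \<R>(3) A by blast
    then obtain D c' where D: "(D, c') \<in> F" "Q (D, c') e\<^sub>0 ?f" unfolding F(3) by auto
    then have zD: "zero_ext D" using F(1) by auto
    obtain g where g: "diagram_iso D g"
      "ext_map sW \<beta> u = (\<Sum>(a, b)\<in>D \<times> D. sW (c' (a, b)) (\<beta> (g a) (g b)))"
      using D(2) zD Q(2)[OF _ par, of "(D, c')"] by auto
    have fD: "finite D" using zD by (simp add: zero_ext_def fin_subspace_def)
    let ?v = "\<Sum>(a, b)\<in>D \<times> D. free_scale (c' (a, b)) (wedge sM (g a) (g b))"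
    have "?v \<in> ext (g ` D)"
      by (auto intro!: free.subspace_sum[OF M.subspace_ext_square] free.subspace_scale[OF M.subspace_ext_square]
        M.wedge_in_ext_square)
    moreover have "ext_map sW \<beta> ?v = ext_map sW \<beta> u"
      unfolding g(2) by (simp add: f.sum f.scale ext_map_wedge case_prod_beta)
    moreover have "card (g ` D) \<le> Max (card ` fst ` F)"
    proof -
      have "card (g ` D) \<le> card D" using fD by (rule card_image_le)
      also have "\<dots> \<le> Max (card ` fst ` F)" using F(2) D(1) by (intro Max_ge) force+
      finally show ?thesis .
    qed
    moreover have "zero_ext (g ` D)" using zD g(1) by (rule zero_ext_image)
    ultimately show "\<exists>D v. zero_ext D \<and> card D \<le> Max (card ` fst ` F) \<and> v \<in> ext D \<and> ext_map sW \<beta> v = ext_map sW \<beta> u"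
      by blast
  qed
qed

lemma finite_cl_mod_H: "finite (cl k H // {(x, y). x - y \<in> H})"
  using small_representation finite_cl_quotient by metis

text \<open>A finite subfamily of the relations "\<open>a\<close> is the image of \<open>d\<close>
  in some copy of \<open>D\<close>" covers the closure by the identity copies. It defines no more,
  because copies of zero extensions are zero extensions.\<close>

lemma cl_definable:
  obtains \<phi> where "free_mvars \<phi> \<subseteq> insert 0 (free_mvars \<phi>\<^sub>0)" "free_wvars \<phi> \<subseteq> free_wvars \<phi>\<^sub>0"
    "cl k H = {a. sat S (e\<^sub>0(0 := a)) f\<^sub>0 \<phi>}"
proof -
  let ?V = "insert 0 V\<^sub>0" and ?U = "free_wvars \<phi>\<^sub>0" and ?X = "{(D, d). zero_ext D \<and> d \<in> D}"
  let ?R' = "\<lambda>d g (e :: nat \<Rightarrow> 'm) (f :: nat \<Rightarrow> 'w). e 0 = g d"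
  have fV: "finite ?V" "V\<^sub>0 \<subseteq> ?V" "finite ?U" by (auto simp: finite_V\<^sub>0)
  have "\<exists>Q. S.fo ?V ?U Q \<and> (\<forall>e f. same_parameters e f \<longrightarrow> Q e f = (\<exists>g. diagram_iso D g \<and> ?R' d g e f))"
    if D: "zero_ext D" "d \<in> D" for D d
  proof -
    have fD: "fin_subspace D" using D by (auto simp: zero_ext_def)
    obtain Q where "S.fo ?V ?U Q" "\<And>e f. same_parameters e f \<Longrightarrow> Q e f = (\<exists>g. diagram_iso D g \<and> ?R' d g e f)"
    proof (rule fo_ex_diagram_iso[OF fD fV(1,2) subset_refl, of "\<lambda>\<iota> e f. ?R' d (\<lambda>a. e (\<iota> a)) e f" "?R' d"])
      show "S.fo (\<iota> ` D \<union> ?V) ?U (\<lambda>e f. ?R' d (\<lambda>a. e (\<iota> a)) e f)" for \<iota>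
        using D(2) by (intro S.fo_mvar_eq) auto
    qed (use D(2) in auto)
    then show ?thesis by blast
  qed
  then have "\<forall>p\<in>?X. \<exists>Q. S.fo ?V ?U Q \<and>
      (\<forall>e f. same_parameters e f \<longrightarrow> Q e f = (\<exists>g. diagram_iso (fst p) g \<and> ?R' (snd p) g e f))"
    by auto
  from bchoice[OF this] obtain Q where "\<forall>p\<in>?X. S.fo ?V ?U (Q p) \<and>
      (\<forall>e f. same_parameters e f \<longrightarrow> Q p e f = (\<exists>g. diagram_iso (fst p) g \<and> ?R' (snd p) g e f))" ..
  then have Q: "\<And>p. p \<in> ?X \<Longrightarrow> S.fo ?V ?U (Q p)"
    "\<And>p e f. p \<in> ?X \<Longrightarrow> same_parameters e f \<Longrightarrow> Q p e f = (\<exists>g. diagram_iso (fst p) g \<and> ?R' (snd p) g e f)"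
    by blast+
  obtain \<R> where \<R>: "\<R> \<subseteq> Q ` ?X" "finite \<R>" "\<And>R e f. R \<in> Q ` ?X \<Longrightarrow> R e f \<Longrightarrow> \<exists>R\<in>\<R>. R e f"
    using S.finite_union_fo[OF categorical fV(1,3), of "Q ` ?X"] Q(1) by blast
  have "S.fo ?V ?U (\<lambda>e f. \<exists>R\<in>\<R>. R e f)"
    using \<R>(1,2) Q(1) by (intro S.fo_Bex) blast+
  then obtain \<phi> where \<phi>: "free_mvars \<phi> \<subseteq> ?V" "free_wvars \<phi> \<subseteq> ?U" "\<And>e f. (\<exists>R\<in>\<R>. R e f) = sat S e f \<phi>"
    by (rule S.foE) blast
  have par: "same_parameters (e\<^sub>0(0 := a)) f\<^sub>0" for a by (auto simp: same_parameters_def V\<^sub>0_def)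
  have "cl k H = {a. sat S (e\<^sub>0(0 := a)) f\<^sub>0 \<phi>}"
  proof (intro equalityI subsetI)
    fix a assume "a \<in> cl k H"
    then obtain A where A: "zero_ext A" "a \<in> A" unfolding cl_eq by blast
    then have "Q (A, a) (e\<^sub>0(0 := a)) f\<^sub>0"
      using diagram_iso_id by (subst Q(2)[OF _ par]) (auto intro!: exI[of _ "\<lambda>a. a"])
    then have "\<exists>R\<in>\<R>. R (e\<^sub>0(0 := a)) f\<^sub>0" using \<R>(3) A by blast
    then show "a \<in> {a. sat S (e\<^sub>0(0 := a)) f\<^sub>0 \<phi>}" unfolding \<phi>(3) by simp
  next
    fix a assume "a \<in> {a. sat S (e\<^sub>0(0 := a)) f\<^sub>0 \<phi>}"
    then have "\<exists>R\<in>\<R>. R (e\<^sub>0(0 := a)) f\<^sub>0" unfolding \<phi>(3) by simp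
    then obtain D d where D: "zero_ext D" "d \<in> D" "Q (D, d) (e\<^sub>0(0 := a)) f\<^sub>0" using \<R>(1) by blast
    then obtain g where "diagram_iso D g" "a = g d"
      using Q(2)[OF _ par, of "(D, d)" a] by auto
    with zero_ext_image[OF D(1)] D(2) show "a \<in> cl k H" unfolding cl_eq by blast
  qed
  moreover have "?V \<subseteq> insert 0 (free_mvars \<phi>\<^sub>0)" by (auto simp: V\<^sub>0_def)
  ultimately show thesis using that[of \<phi>] \<phi>(1,2) by blast
qed

end

theorem theorem6p1:
  fixes sM :: "'p::prime_card mod_ring \<Rightarrow> 'm::ab_group_add \<Rightarrow> 'm"
    and sW :: "'p mod_ring \<Rightarrow> 'w::ab_group_add \<Rightarrow> 'w"
    and \<beta> :: "'m \<Rightarrow> 'm \<Rightarrow> 'w"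
    and k :: nat and H P :: "'m set" and Q :: "'w set"
  assumes "generating_alternating_bilinear sM sW \<beta>"
    and "aleph0_categorical (theory_of (bilinear_structure sM sW \<beta>))"
    and "generating_alternating_bilinear.few_relations sM sW \<beta>"
    and "k \<ge> 1"
    and "generating_alternating_bilinear.relation_bound sM sW \<beta> k"
    and "generating_alternating_bilinear.selfsufficient sM sW \<beta> k H"
    and "definable_over (bilinear_structure sM sW \<beta>) P Q H"
  shows "finite (generating_alternating_bilinear.cl sM sW \<beta> k H // {(x, y). x - y \<in> H})
    \<and> definable_over (bilinear_structure sM sW \<beta>) P Q
           (generating_alternating_bilinear.cl sM sW \<beta> k H)
    \<and> generating_alternating_bilinear.cl sM sW \<beta> k H
           \<subseteq> acl (bilinear_structure sM sW \<beta>) H {}"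
proof -
  let ?S = "bilinear_structure sM sW \<beta>" and ?cl = "generating_alternating_bilinear.cl sM sW \<beta> k"
  have univ: "mcarrier ?S = UNIV" by (simp add: bilinear_structure_def)
  \<comment> \<open>\<open>H\<close>, \<open>P\<close> and \<open>Q\<close> are general here,
    because the claim is also applied to a finite selfsufficient \<open>H1 \<subseteq> H\<close>
    defined by its own elements.\<close>
  have main: "finite (?cl H // {(x, y). x - y \<in> H}) \<and> definable_over ?S P Q (?cl H)"
    if ss: "selfsufficient_subspace sM sW \<beta> k H" and "definable_over ?S P Q H" for H P Q
  proof -
    from that(2) obtain \<phi> e f where \<phi>: "\<forall>i\<in>free_mvars \<phi> - {0}. e i \<in> P" "\<forall>j\<in>free_wvars \<phi>. f j \<in> Q"
      "H = {a \<in> mcarrier ?S. sat ?S (e(0 := a)) f \<phi>}"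
      unfolding definable_over_def by (elim exE conjE)
    interpret selfsufficient_subspace sM sW \<beta> k H by (fact ss)
    interpret definable_subspace sM sW \<beta> k H \<phi> e f
      using assms(2) \<phi>(3) by unfold_locales (simp_all add: univ)
    obtain \<psi> where \<psi>: "free_mvars \<psi> \<subseteq> insert 0 (free_mvars \<phi>)" "free_wvars \<psi> \<subseteq> free_wvars \<phi>"
      "?cl H = {a. sat ?S (e(0 := a)) f \<psi>}"
      by (rule cl_definable)
    have "definable_over ?S P Q (?cl H)"
      unfolding definable_over_def
      using \<psi> \<phi>(1,2) by (intro exI[of _ \<psi>] exI[of _ e] exI[of _ f]) (auto simp: univ)
    with finite_cl_mod_H show ?thesis by blast
  qed
  interpret generating_alternating_bilinear sM sW \<beta> by (fact assms(1))
  interpret selfsufficient_subspace sM sW \<beta> k H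
    using assms(4-6) by unfold_locales
  interpret S: full_structure ?S
    by unfold_locales (simp_all add: bilinear_structure_def)
  have "cl k H \<subseteq> acl ?S H {}"
  proof
    fix a assume "a \<in> cl k H"
    then obtain A where A: "zero_ext A" "a \<in> A" unfolding cl_eq by blast
    have fA: "fin_subspace A" using A(1) by (rule zero_ext_fin_subspace)
    then have "finite (A \<inter> H)" by (auto simp: fin_subspace_def)
    then obtain H1 where H1: "fss H1" "A \<inter> H \<subseteq> H1" "H1 \<subseteq> H"
      using fss_hull by (metis Int_lower2)
    have fH1: "finite H1" "M.subspace H1" using H1(1) by (auto simp: fss_def' fin_subspace_def)
    have "selfsufficient k H1" using H1(1) fH1(1) by (simp add: selfsufficient_def fss_def)
    then interpret H1: selfsufficient_subspace sM sW \<beta> k H1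
      by unfold_locales
    let ?A = "M.span (A \<union> H1)"
    have sup: "A \<union> H1 \<subseteq> ?A" by (rule M.span_superset)
    have "fin_subspace ?A"
      using fA fH1 by (intro fin_subspace_span) (auto simp: fin_subspace_def)
    \<comment> \<open>Over \<open>H1\<close> the trace of \<open>A + H1\<close> is
      \<open>H1\<close>, of the same predimension, so \<open>a\<close> lies in the closure of
      \<open>H1\<close> already.\<close>
    moreover have "?A \<inter> H1 = H1" using sup by blast
    ultimately have "H1.zero_ext ?A"
      using predim_zero_ext_Un[OF A(1) H1] by (simp add: H1.zero_ext_def)
    then have a: "a \<in> cl k H1" using A(2) sup unfolding H1.cl_eq by blast
    have H1_def: "definable_over ?S H1 {} H1" using fH1(1) by (rule S.finite_definable)
    from main[OF H1.selfsufficient_subspace_axioms H1_def]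
    have fin: "finite (cl k H1 // {(x, y). x - y \<in> H1})" and defn: "definable_over ?S H1 {} (cl k H1)"
      by auto
    \<comment> \<open>Finitely many cosets of a finite subspace make the closure of
      \<open>H1\<close> a finite set, definable with parameters in
      \<open>H1 \<subseteq> H\<close>.\<close>
    have "finite (\<Union> (cl k H1 // {(x, y). x - y \<in> H1}))"
    proof (rule finite_Union[OF fin])
      fix c assume "c \<in> cl k H1 // {(x, y). x - y \<in> H1}"
      then obtain x where "c = {y. x - y \<in> H1}" by (auto simp: quotient_def)
      then have "c \<subseteq> (\<lambda>h. x - h) ` H1" by (force intro: image_eqI[of _ _ "x - _"])
      then show "finite c" using fH1(1) by (rule finite_subset[OF _ finite_imageI])
    qed
    moreover have "cl k H1 \<subseteq> \<Union> (cl k H1 // {(x, y). x - y \<in> H1})"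
    proof
      fix x assume "x \<in> cl k H1"
      moreover have "x \<in> {(x, y). x - y \<in> H1} `` {x}" using M.subspace_0[OF fH1(2)] by simp
      ultimately show "x \<in> \<Union> (cl k H1 // {(x, y). x - y \<in> H1})" by (blast intro: quotientI)
    qed
    ultimately have "finite (cl k H1)" by (rule finite_subset[rotated])
    with a definable_over_mono[OF defn H1(3) subset_refl] show "a \<in> acl ?S H {}"
      unfolding acl_def by blast
  qed
  with main[OF selfsufficient_subspace_axioms assms(7)] show ?thesis by blast
qed

end
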